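(* The forgetful 2-functor $\mathbf{Doc}_{\{\exists,\land,\bigvee\}} \hookrightarrow \mathbf{Doc}_{\{\land,\bigvee\}}$ has a left 2-adjoint $(-)^\exists \colon \mathbf{Doc}_{\{\land,\bigvee\}} \to \mathbf{Doc}_{\{\exists,\land,\bigvee\}}$.
   Context: A $\{\land,\bigvee\}$-doctrine is a functor $P \colon \mathcal{C}^{op} \to \mathbf{Frm}$, where $\mathcal{C}$ has finite products and $\mathbf{Frm}$ is the category of frames and frame homomorphisms; write $f^\ast = P(f)$. For objects $d,c$, $\pi_d\colon d\times c\to c$ denotes the projection forgetting $d$. It is a $\{\exists,\land,\bigvee\}$-doctrine if each $\pi_d^\ast\colon P(c)\to P(d\times c)$ has a left adjoint $\Sigma_d$ satisfying Frobenius ($x\land\Sigma_d y=\Sigma_d(\pi_d^\ast x\land y)$) and Beck–Chevalley ($f^\ast\Sigma_d=\Sigma_d(1_d\times f)^\ast$ for all $f\colon c'\to c$). A morphism of $\{\land,\bigvee\}$-doctrines $P\to Q$ (with $Q\colon\mathcal{D}^{op}\to\mathbf{Frm}$) is a pair $(F,\alpha)$ with $F\colon\mathcal{C}\to\mathcal{D}$ finite-product-preserving and $\alpha\colon P\Rightarrow Q\circ F^{op}$ a natural transformation with frame-homomorphism components; a morphism of $\{\exists,\land,\bigvee\}$-doctrines additionally satisfies $\alpha_c\Sigma^P_d=\Sigma^Q_{Fd}\alpha_{d\times c}$. 2-cells $(F,\alpha)\Rightarrow(G,\beta)$ are natural transformations $\omega\colon F\Rightarrow G$ with $\alpha_c(x)\le\omega_c^\ast\beta_c(x)$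 for all $c$, $x\in P(c)$. This defines the 2-categories $\mathbf{Doc}_{\{\land,\bigvee\}}$ and $\mathbf{Doc}_{\{\exists,\land,\bigvee\}}$. *)

theory Defs
  imports "HOL-Algebra.Galois_Connection" "HOL-Library.Equipollence"
begin

section \<open>Categories and functors\<close>

record ('o, 'm) category =
  Obj :: "'o set"
  Arr :: "'m set"
  Dom :: "'m \<Rightarrow> 'o"
  Cod :: "'m \<Rightarrow> 'o"
  Ident :: "'o \<Rightarrow> 'm"
  Cmp :: "'m \<Rightarrow> 'm \<Rightarrow> 'm"  \<comment> \<open>in applicative order: \<open>Cmp C g f\<close> is "g after f"\<close>

definition homs :: "('o, 'm) category \<Rightarrow> 'o \<Rightarrow> 'o \<Rightarrow> 'm set" where
  "homs C a b = {f \<in> Arr C. Dom C f = a \<and> Cod C f = b}"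

definition is_category :: "('o, 'm) category \<Rightarrow> bool" where
  "is_category C \<longleftrightarrow>
     Dom C \<in> Arr C \<rightarrow> Obj C \<and>
     Cod C \<in> Arr C \<rightarrow> Obj C \<and>
     (\<forall>a \<in> Obj C. Ident C a \<in> homs C a a) \<and>
     (\<forall>f \<in> Arr C. \<forall>g \<in> Arr C. Dom C g = Cod C f \<longrightarrow> Cmp C g f \<in> homs C (Dom C f) (Cod C g)) \<and>
     (\<forall>f \<in> Arr C. Cmp C f (Ident C (Dom C f)) = f \<and> Cmp C (Ident C (Cod C f)) f = f) \<and>
     (\<forall>f \<in> Arr C. \<forall>g \<in> Arr C. \<forall>h \<in> Arr C. Dom C g = Cod C f \<and> Dom C h = Cod C g \<longrightarrow>
        Cmp C h (Cmp C g f) = Cmp C (Cmp C h g) f)"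

definition prod_category :: "('o1, 'm1) category \<Rightarrow> ('o2, 'm2) category \<Rightarrow> ('o1 \<times> 'o2, 'm1 \<times> 'm2) category"
  where "prod_category C D =
    \<lparr>Obj = Obj C \<times> Obj D,
     Arr = Arr C \<times> Arr D,
     Dom = map_prod (Dom C) (Dom D),
     Cod = map_prod (Cod C) (Cod D),
     Ident = map_prod (Ident C) (Ident D),
     Cmp = (\<lambda>(g, g') (f, f'). (Cmp C g f, Cmp D g' f'))\<rparr>"

record ('o1, 'm1, 'o2, 'm2) cfunctor =
  fobj :: "'o1 \<Rightarrow> 'o2"
  farr :: "'m1 \<Rightarrow> 'm2"

definition is_functor ::
  "('o1, 'm1) category \<Rightarrow> ('o2, 'm2) category \<Rightarrow> ('o1, 'm1, 'o2, 'm2) cfunctor \<Rightarrow> bool" where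
  "is_functor C D F \<longleftrightarrow>
     is_category C \<and> is_category D \<and>
     fobj F \<in> Obj C \<rightarrow> Obj D \<and>
     (\<forall>f \<in> Arr C. farr F f \<in> homs D (fobj F (Dom C f)) (fobj F (Cod C f))) \<and>
     (\<forall>a \<in> Obj C. farr F (Ident C a) = Ident D (fobj F a)) \<and>
     (\<forall>f \<in> Arr C. \<forall>g \<in> Arr C. Dom C g = Cod C f \<longrightarrow>
        farr F (Cmp C g f) = Cmp D (farr F g) (farr F f))"

definition is_nat_trans ::
  "('o1, 'm1) category \<Rightarrow> ('o2, 'm2) category \<Rightarrow> ('o1, 'm1, 'o2, 'm2) cfunctor \<Rightarrow>
   ('o1, 'm1, 'o2, 'm2) cfunctor \<Rightarrow> ('o1 \<Rightarrow> 'm2) \<Rightarrow> bool" where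
  "is_nat_trans C D F G w \<longleftrightarrow>
     is_functor C D F \<and> is_functor C D G \<and>
     (\<forall>a \<in> Obj C. w a \<in> homs D (fobj F a) (fobj G a)) \<and>
     (\<forall>f \<in> Arr C. Cmp D (w (Cod C f)) (farr F f) = Cmp D (farr G f) (w (Dom C f)))"

definition is_terminal :: "('o, 'm) category \<Rightarrow> 'o \<Rightarrow> bool" where
  "is_terminal C t \<longleftrightarrow> t \<in> Obj C \<and> (\<forall>a \<in> Obj C. \<exists>!f. f \<in> homs C a t)"

definition is_product :: "('o, 'm) category \<Rightarrow> 'o \<Rightarrow> 'o \<Rightarrow> 'o \<Rightarrow> 'm \<Rightarrow> 'm \<Rightarrow> bool" where
  "is_product C a b p p1 p2 \<longleftrightarrow>
     p1 \<in> homs C p a \<and> p2 \<in> homs C p b \<and>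
     (\<forall>x f g. f \<in> homs C x a \<and> g \<in> homs C x b \<longrightarrow>
        (\<exists>!h. h \<in> homs C x p \<and> Cmp C p1 h = f \<and> Cmp C p2 h = g))"

definition has_finite_products :: "('o, 'm) category \<Rightarrow> bool" where
  "has_finite_products C \<longleftrightarrow>
     (\<exists>t. is_terminal C t) \<and>
     (\<forall>a \<in> Obj C. \<forall>b \<in> Obj C. \<exists>p p1 p2. is_product C a b p p1 p2)"

definition preserves_finite_products ::
  "('o1, 'm1) category \<Rightarrow> ('o2, 'm2) category \<Rightarrow> ('o1, 'm1, 'o2, 'm2) cfunctor \<Rightarrow> bool" where
  "preserves_finite_products C D F \<longleftrightarrow>
     (\<forall>t. is_terminal C t \<longrightarrow> is_terminal D (fobj F t)) \<and>
     (\<forall>a b p p1 p2. is_product C a b p p1 p2 \<longrightarrow>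
        is_product D (fobj F a) (fobj F b) (fobj F p) (farr F p1) (farr F p2))"


section \<open>Strict 2-categories and 2-adjunctions\<close>

text \<open>A 2-category is given in \<open>Cat\<close>-enriched form: \<open>Hom2 X x y\<close> is the category of 1-cells from
  \<open>x\<close> to \<open>y\<close> and 2-cells between them (with vertical composition), and \<open>Comp2 X x y z\<close> is the
  composition functor, acting on 1-cells and (horizontally) on 2-cells.\<close>

record ('x, 'f, 't) two_category =
  Cell0 :: "'x set"
  Hom2 :: "'x \<Rightarrow> 'x \<Rightarrow> ('f, 't) category"
  Id1 :: "'x \<Rightarrow> 'f"
  Comp2 :: "'x \<Rightarrow> 'x \<Rightarrow> 'x \<Rightarrow> ('f \<times> 'f, 't \<times> 't, 'f, 't) cfunctor"

abbreviation Cell1 :: "('x, 'f, 't) two_category \<Rightarrow> 'x \<Rightarrow> 'x \<Rightarrow> 'f set" where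
  "Cell1 X x y \<equiv> Obj (Hom2 X x y)"

abbreviation Cell2 :: "('x, 'f, 't) two_category \<Rightarrow> 'x \<Rightarrow> 'x \<Rightarrow> 't set" where
  "Cell2 X x y \<equiv> Arr (Hom2 X x y)"

abbreviation Id2 :: "('x, 'f, 't) two_category \<Rightarrow> 'x \<Rightarrow> 'x \<Rightarrow> 'f \<Rightarrow> 't" where
  "Id2 X x y \<equiv> Ident (Hom2 X x y)"

definition is_two_category :: "('x, 'f, 't) two_category \<Rightarrow> bool" where
  "is_two_category X \<longleftrightarrow>
     (\<forall>x \<in> Cell0 X. Id1 X x \<in> Cell1 X x x) \<and>
     (\<forall>x \<in> Cell0 X. \<forall>y \<in> Cell0 X. is_category (Hom2 X x y)) \<and>
     (\<forall>x \<in> Cell0 X. \<forall>y \<in> Cell0 X. \<forall>z \<in> Cell0 X.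
        is_functor (prod_category (Hom2 X y z) (Hom2 X x y)) (Hom2 X x z) (Comp2 X x y z)) \<and>
     (\<forall>x \<in> Cell0 X. \<forall>y \<in> Cell0 X.
        (\<forall>f \<in> Cell1 X x y.
           fobj (Comp2 X x x y) (f, Id1 X x) = f \<and>
           fobj (Comp2 X x y y) (Id1 X y, f) = f) \<and>
        (\<forall>s \<in> Cell2 X x y.
           farr (Comp2 X x x y) (s, Id2 X x x (Id1 X x)) = s \<and>
           farr (Comp2 X x y y) (Id2 X y y (Id1 X y), s) = s)) \<and>
     (\<forall>w \<in> Cell0 X. \<forall>x \<in> Cell0 X. \<forall>y \<in> Cell0 X. \<forall>z \<in> Cell0 X.
        (\<forall>f \<in> Cell1 X w x. \<forall>g \<in> Cell1 X x y. \<forall>h \<in> Cell1 X y z.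
           fobj (Comp2 X w y z) (h, fobj (Comp2 X w x y) (g, f)) =
           fobj (Comp2 X w x z) (fobj (Comp2 X x y z) (h, g), f)) \<and>
        (\<forall>r \<in> Cell2 X w x. \<forall>s \<in> Cell2 X x y. \<forall>t \<in> Cell2 X y z.
           farr (Comp2 X w y z) (t, farr (Comp2 X w x y) (s, r)) =
           farr (Comp2 X w x z) (farr (Comp2 X x y z) (t, s), r)))"

record ('x, 'f, 't, 'y, 'g, 's) two_functor =
  fun0 :: "'x \<Rightarrow> 'y"
  fun12 :: "'x \<Rightarrow> 'x \<Rightarrow> ('f, 't, 'g, 's) cfunctor"

definition is_two_functor ::
  "('x, 'f, 't) two_category \<Rightarrow> ('y, 'g, 's) two_category \<Rightarrow> ('x, 'f, 't, 'y, 'g, 's) two_functor \<Rightarrow> bool"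
  where "is_two_functor X Y F \<longleftrightarrow>
     is_two_category X \<and> is_two_category Y \<and>
     fun0 F \<in> Cell0 X \<rightarrow> Cell0 Y \<and>
     (\<forall>x \<in> Cell0 X. fobj (fun12 F x x) (Id1 X x) = Id1 Y (fun0 F x)) \<and>
     (\<forall>x \<in> Cell0 X. \<forall>y \<in> Cell0 X.
        is_functor (Hom2 X x y) (Hom2 Y (fun0 F x) (fun0 F y)) (fun12 F x y)) \<and>
     (\<forall>x \<in> Cell0 X. \<forall>y \<in> Cell0 X. \<forall>z \<in> Cell0 X.
        (\<forall>f \<in> Cell1 X x y. \<forall>g \<in> Cell1 X y z.
           fobj (fun12 F x z) (fobj (Comp2 X x y z) (g, f)) =
           fobj (Comp2 Y (fun0 F x) (fun0 F y) (fun0 F z))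
             (fobj (fun12 F y z) g, fobj (fun12 F x y) f)) \<and>
        (\<forall>s \<in> Cell2 X x y. \<forall>t \<in> Cell2 X y z.
           farr (fun12 F x z) (farr (Comp2 X x y z) (t, s)) =
           farr (Comp2 Y (fun0 F x) (fun0 F y) (fun0 F z))
             (farr (fun12 F y z) t, farr (fun12 F x y) s)))"

definition two_functor_id :: "('x, 'f, 't, 'x, 'f, 't) two_functor" where
  "two_functor_id = \<lparr>fun0 = (\<lambda>x. x), fun12 = (\<lambda>_ _. \<lparr>fobj = (\<lambda>f. f), farr = (\<lambda>t. t)\<rparr>)\<rparr>"

definition two_functor_comp ::
  "('y, 'g, 's, 'z, 'h, 'r) two_functor \<Rightarrow> ('x, 'f, 't, 'y, 'g, 's) two_functor \<Rightarrow>
   ('x, 'f, 't, 'z, 'h, 'r) two_functor" where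
  "two_functor_comp G F =
    \<lparr>fun0 = fun0 G \<circ> fun0 F,
     fun12 = (\<lambda>x y.
       \<lparr>fobj = fobj (fun12 G (fun0 F x) (fun0 F y)) \<circ> fobj (fun12 F x y),
        farr = farr (fun12 G (fun0 F x) (fun0 F y)) \<circ> farr (fun12 F x y)\<rparr>)\<rparr>"

definition is_two_nat_trans ::
  "('x, 'f, 't) two_category \<Rightarrow> ('y, 'g, 's) two_category \<Rightarrow>
   ('x, 'f, 't, 'y, 'g, 's) two_functor \<Rightarrow> ('x, 'f, 't, 'y, 'g, 's) two_functor \<Rightarrow> ('x \<Rightarrow> 'g) \<Rightarrow> bool"
  where "is_two_nat_trans X Y F G w \<longleftrightarrow>
     is_two_functor X Y F \<and> is_two_functor X Y G \<and>
     (\<forall>x \<in> Cell0 X. w x \<in> Cell1 Y (fun0 F x) (fun0 G x)) \<and>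
     (\<forall>x \<in> Cell0 X. \<forall>y \<in> Cell0 X.
        (\<forall>f \<in> Cell1 X x y.
           fobj (Comp2 Y (fun0 F x) (fun0 F y) (fun0 G y)) (w y, fobj (fun12 F x y) f) =
           fobj (Comp2 Y (fun0 F x) (fun0 G x) (fun0 G y)) (fobj (fun12 G x y) f, w x)) \<and>
        (\<forall>s \<in> Cell2 X x y.
           farr (Comp2 Y (fun0 F x) (fun0 F y) (fun0 G y))
             (Id2 Y (fun0 F y) (fun0 G y) (w y), farr (fun12 F x y) s) =
           farr (Comp2 Y (fun0 F x) (fun0 G x) (fun0 G y))
             (farr (fun12 G x y) s, Id2 Y (fun0 F x) (fun0 G x) (w x))))"

text \<open>\<open>L : X \<rightarrow> Y\<close> is left 2-adjoint to \<open>U : Y \<rightarrow> X\<close>, with unit \<open>\<eta>\<close> and counit \<open>\<epsilon>\<close>, all strict.\<close>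

definition is_two_adjunction ::
  "('x, 'f, 't) two_category \<Rightarrow> ('y, 'g, 's) two_category \<Rightarrow>
   ('x, 'f, 't, 'y, 'g, 's) two_functor \<Rightarrow> ('y, 'g, 's, 'x, 'f, 't) two_functor \<Rightarrow>
   ('x \<Rightarrow> 'f) \<Rightarrow> ('y \<Rightarrow> 'g) \<Rightarrow> bool" where
  "is_two_adjunction X Y L U \<eta> \<epsilon> \<longleftrightarrow>
     is_two_functor X Y L \<and> is_two_functor Y X U \<and>
     is_two_nat_trans X X two_functor_id (two_functor_comp U L) \<eta> \<and>
     is_two_nat_trans Y Y (two_functor_comp L U) two_functor_id \<epsilon> \<and>
     (\<forall>x \<in> Cell0 X.
        fobj (Comp2 Y (fun0 L x) (fun0 L (fun0 U (fun0 L x))) (fun0 L x))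
          (\<epsilon> (fun0 L x), fobj (fun12 L x (fun0 U (fun0 L x))) (\<eta> x)) = Id1 Y (fun0 L x)) \<and>
     (\<forall>y \<in> Cell0 Y.
        fobj (Comp2 X (fun0 U y) (fun0 U (fun0 L (fun0 U y))) (fun0 U y))
          (fobj (fun12 U (fun0 L (fun0 U y)) y) (\<epsilon> y), \<eta> (fun0 U y)) = Id1 X (fun0 U y))"

definition has_left_two_adjoint ::
  "('y, 'g, 's) two_category \<Rightarrow> ('x, 'f, 't) two_category \<Rightarrow> ('y, 'g, 's, 'x, 'f, 't) two_functor \<Rightarrow> bool"
  where "has_left_two_adjoint Y X U \<longleftrightarrow> (\<exists>L \<eta> \<epsilon>. is_two_adjunction X Y L U \<eta> \<epsilon>)"


section \<open>Doctrines\<close>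

definition is_frame :: "'p gorder \<Rightarrow> bool" where
  "is_frame L \<longleftrightarrow> complete_lattice L \<and>
     (\<forall>x \<in> carrier L. \<forall>A \<subseteq> carrier L. x \<sqinter>\<^bsub>L\<^esub> (\<Squnion>\<^bsub>L\<^esub> A) = \<Squnion>\<^bsub>L\<^esub> ((\<lambda>a. x \<sqinter>\<^bsub>L\<^esub> a) ` A))"

definition is_frame_hom :: "'p gorder \<Rightarrow> 'q gorder \<Rightarrow> ('p \<Rightarrow> 'q) \<Rightarrow> bool" where
  "is_frame_hom L M h \<longleftrightarrow>
     h \<in> carrier L \<rightarrow> carrier M \<and> h \<top>\<^bsub>L\<^esub> = \<top>\<^bsub>M\<^esub> \<and> meet_pres L M h \<and> sup_pres L M h"

record ('o, 'm, 'p) doctrine =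
  base :: "('o, 'm) category"
  fib :: "'o \<Rightarrow> 'p gorder"
  reindex :: "'m \<Rightarrow> 'p \<Rightarrow> 'p"

definition is_doctrine :: "('o, 'm, 'p) doctrine \<Rightarrow> bool" where
  "is_doctrine P \<longleftrightarrow>
     is_category (base P) \<and> has_finite_products (base P) \<and>
     (\<forall>c \<in> Obj (base P). is_frame (fib P c)) \<and>
     (\<forall>f \<in> Arr (base P).
        is_frame_hom (fib P (Cod (base P) f)) (fib P (Dom (base P) f)) (reindex P f)) \<and>
     (\<forall>c \<in> Obj (base P). \<forall>x \<in> carrier (fib P c). reindex P (Ident (base P) c) x = x) \<and>
     (\<forall>f \<in> Arr (base P). \<forall>g \<in> Arr (base P). Dom (base P) g = Cod (base P) f \<longrightarrow>
        (\<forall>x \<in> carrier (fib P (Cod (base P) g)).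
           reindex P (Cmp (base P) g f) x = reindex P f (reindex P g x)))"

definition is_left_adjoint :: "('o, 'm, 'p) doctrine \<Rightarrow> 'm \<Rightarrow> ('p \<Rightarrow> 'p) \<Rightarrow> bool" where
  "is_left_adjoint P f s \<longleftrightarrow>
     galois_connection
       \<lparr>orderA = fib P (Dom (base P) f), orderB = fib P (Cod (base P) f),
        lower = s, upper = reindex P f\<rparr>"

text \<open>The left adjoint of \<open>f\<^sup>*\<close>, if there is one. Left adjoints are unique on the carrier, and
  extensionality makes them unique as functions.\<close>

definition Sig :: "('o, 'm, 'p) doctrine \<Rightarrow> 'm \<Rightarrow> 'p \<Rightarrow> 'p" where
  "Sig P f = (THE s. s \<in> extensional (carrier (fib P (Dom (base P) f))) \<and> is_left_adjoint P f s)"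

text \<open>No choice of products is fixed: \<open>d \<times> c\<close> ranges over all product cones, and in the
  Beck--Chevalley condition \<open>h\<close> is \<open>1\<^sub>d \<times> f\<close>.\<close>

definition is_ex_doctrine :: "('o, 'm, 'p) doctrine \<Rightarrow> bool" where
  "is_ex_doctrine P \<longleftrightarrow>
     is_doctrine P \<and>
     (\<forall>d c p \<pi>' \<pi>. is_product (base P) d c p \<pi>' \<pi> \<longrightarrow>
        (\<exists>s. is_left_adjoint P \<pi> s) \<and>
        (\<forall>x \<in> carrier (fib P c). \<forall>y \<in> carrier (fib P p).
           x \<sqinter>\<^bsub>fib P c\<^esub> Sig P \<pi> y = Sig P \<pi> (reindex P \<pi> x \<sqinter>\<^bsub>fib P p\<^esub> y)) \<and>
        (\<forall>c' q \<rho>' \<rho> f h.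
           is_product (base P) d c' q \<rho>' \<rho> \<and> f \<in> homs (base P) c' c \<and> h \<in> homs (base P) q p \<and>
           Cmp (base P) \<pi>' h = \<rho>' \<and> Cmp (base P) \<pi> h = Cmp (base P) f \<rho> \<longrightarrow>
           (\<forall>y \<in> carrier (fib P p). reindex P f (Sig P \<pi> y) = Sig P \<rho> (reindex P h y))))"


section \<open>The 2-categories of doctrines\<close>

text \<open>Functors, frame homomorphisms and families that occur in cells are extensional (\<open>undefined\<close>
  outside of their domains), so that equality of cells is equality of records.\<close>

record ('o, 'm, 'p) doc_mor =
  ftr :: "('o, 'm, 'o, 'm) cfunctor"
  fibmap :: "'o \<Rightarrow> 'p \<Rightarrow> 'p"

definition doc_mors ::
  "('o, 'm, 'p) doctrine \<Rightarrow> ('o, 'm, 'p) doctrine \<Rightarrow> ('o, 'm, 'p) doc_mor set" where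
  "doc_mors P Q = {m.
     is_functor (base P) (base Q) (ftr m) \<and>
     preserves_finite_products (base P) (base Q) (ftr m) \<and>
     (\<forall>c \<in> Obj (base P). is_frame_hom (fib P c) (fib Q (fobj (ftr m) c)) (fibmap m c)) \<and>
     (\<forall>f \<in> Arr (base P). \<forall>x \<in> carrier (fib P (Cod (base P) f)).
        fibmap m (Dom (base P) f) (reindex P f x) =
        reindex Q (farr (ftr m) f) (fibmap m (Cod (base P) f) x)) \<and>
     fobj (ftr m) \<in> extensional (Obj (base P)) \<and>
     farr (ftr m) \<in> extensional (Arr (base P)) \<and>
     fibmap m \<in> extensional (Obj (base P)) \<and>
     (\<forall>c \<in> Obj (base P). fibmap m c \<in> extensional (carrier (fib P c)))}"

definition ex_doc_mors ::
  "('o, 'm, 'p) doctrine \<Rightarrow> ('o, 'm, 'p) doctrine \<Rightarrow> ('o, 'm, 'p) doc_mor set" where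
  "ex_doc_mors P Q = {m \<in> doc_mors P Q.
     \<forall>d c p \<pi>' \<pi>. is_product (base P) d c p \<pi>' \<pi> \<longrightarrow>
       (\<forall>y \<in> carrier (fib P p).
          fibmap m c (Sig P \<pi> y) = Sig Q (farr (ftr m) \<pi>) (fibmap m p y))}"

record ('o, 'm, 'p) doc_2cell =
  source1 :: "('o, 'm, 'p) doc_mor"
  target1 :: "('o, 'm, 'p) doc_mor"
  nat_tr :: "'o \<Rightarrow> 'm"

definition is_doc_2cell ::
  "('o, 'm, 'p) doctrine \<Rightarrow> ('o, 'm, 'p) doctrine \<Rightarrow> ('o, 'm, 'p) doc_2cell \<Rightarrow> bool" where
  "is_doc_2cell P Q t \<longleftrightarrow>
     is_nat_trans (base P) (base Q) (ftr (source1 t)) (ftr (target1 t)) (nat_tr t) \<and>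
     (\<forall>c \<in> Obj (base P). \<forall>x \<in> carrier (fib P c).
        fibmap (source1 t) c x
          \<sqsubseteq>\<^bsub>fib Q (fobj (ftr (source1 t)) c)\<^esub> reindex Q (nat_tr t c) (fibmap (target1 t) c x)) \<and>
     nat_tr t \<in> extensional (Obj (base P))"

text \<open>The category whose objects are a given set \<open>M\<close> of 1-cells \<open>P \<rightarrow> Q\<close> and whose morphisms are
  all 2-cells between them.\<close>

definition doc_hom ::
  "('o, 'm, 'p) doctrine \<Rightarrow> ('o, 'm, 'p) doctrine \<Rightarrow> ('o, 'm, 'p) doc_mor set \<Rightarrow>
   (('o, 'm, 'p) doc_mor, ('o, 'm, 'p) doc_2cell) category" where
  "doc_hom P Q M =
    \<lparr>Obj = M,
     Arr = {t. source1 t \<in> M \<and> target1 t \<in> M \<and> is_doc_2cell P Q t},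
     Dom = source1,
     Cod = target1,
     Ident = (\<lambda>m. \<lparr>source1 = m, target1 = m,
       nat_tr = (\<lambda>c \<in> Obj (base P). Ident (base Q) (fobj (ftr m) c))\<rparr>),
     Cmp = (\<lambda>t s. \<lparr>source1 = source1 s, target1 = target1 t,
       nat_tr = (\<lambda>c \<in> Obj (base P). Cmp (base Q) (nat_tr t c) (nat_tr s c))\<rparr>)\<rparr>"

definition doc_id :: "('o, 'm, 'p) doctrine \<Rightarrow> ('o, 'm, 'p) doc_mor" where
  "doc_id P =
    \<lparr>ftr = \<lparr>fobj = (\<lambda>c \<in> Obj (base P). c), farr = (\<lambda>f \<in> Arr (base P). f)\<rparr>,
     fibmap = (\<lambda>c \<in> Obj (base P). \<lambda>x \<in> carrier (fib P c). x)\<rparr>"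

definition doc_comp1 ::
  "('o, 'm, 'p) doctrine \<Rightarrow> ('o, 'm, 'p) doc_mor \<Rightarrow> ('o, 'm, 'p) doc_mor \<Rightarrow> ('o, 'm, 'p) doc_mor" where
  "doc_comp1 P n m =
    \<lparr>ftr = \<lparr>fobj = (\<lambda>c \<in> Obj (base P). fobj (ftr n) (fobj (ftr m) c)),
            farr = (\<lambda>f \<in> Arr (base P). farr (ftr n) (farr (ftr m) f))\<rparr>,
     fibmap = (\<lambda>c \<in> Obj (base P). \<lambda>x \<in> carrier (fib P c).
                fibmap n (fobj (ftr m) c) (fibmap m c x))\<rparr>"

definition doc_comp2 ::
  "('o, 'm, 'p) doctrine \<Rightarrow> ('o, 'm, 'p) doctrine \<Rightarrow>
   ('o, 'm, 'p) doc_2cell \<Rightarrow> ('o, 'm, 'p) doc_2cell \<Rightarrow> ('o, 'm, 'p) doc_2cell" where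
  "doc_comp2 P R t s =
    \<lparr>source1 = doc_comp1 P (source1 t) (source1 s),
     target1 = doc_comp1 P (target1 t) (target1 s),
     nat_tr = (\<lambda>c \<in> Obj (base P).
       Cmp (base R) (nat_tr t (fobj (ftr (target1 s)) c)) (farr (ftr (source1 t)) (nat_tr s c)))\<rparr>"

text \<open>Size. All carriers live in fixed types, and fibres of the existential completion are
  unavoidably larger than the original ones, so the doctrines in the 2-categories below
  are those that are small with respect to a given family \<open>S\<close> of index sets: some \<open>A \<in> S\<close> bounds the
  arrows of the base category and a basis (join-dense subset) of every fibre. A fibre with a basis
  bounded by \<open>A\<close> has at most as many elements as \<open>Pow A\<close>, so the family \<open>S\<close> should have
  products, and \<open>'p\<close> should accommodate the powersets of its members; nothing else is required.
  Two instances: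

  \<^item> \<open>S\<close> consists of all sets of cardinality less than that of \<open>'p\<close>, where the latter is inaccessible.
    Then \<open>'p\<close> is a Grothendieck universe, and the small doctrines are those with a small base
    category and small fibres.

  \<^item> \<open>S = {UNIV :: 'k set}\<close> and \<open>'p = 'k set\<close> for an arbitrary infinite type \<open>'k\<close>
    (lemma \<open>size_instance\<close>). Every doctrine is, up to replacing its types by isomorphic
    carriers, of this kind for a large enough \<open>'k\<close>.\<close>

definition is_basis :: "'p gorder \<Rightarrow> 'p set \<Rightarrow> bool" where
  "is_basis L B \<longleftrightarrow> B \<subseteq> carrier L \<and> (\<forall>x \<in> carrier L. x = \<Squnion>\<^bsub>L\<^esub> {b \<in> B. b \<sqsubseteq>\<^bsub>L\<^esub> x})"

definition is_small :: "'s set set \<Rightarrow> ('o, 'm, 'p) doctrine \<Rightarrow> bool" where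
  "is_small S P \<longleftrightarrow>
     (\<exists>A \<in> S. Arr (base P) \<lesssim> A \<and> (\<forall>c \<in> Obj (base P). \<exists>B. is_basis (fib P c) B \<and> B \<lesssim> A))"

definition Doc ::
  "'s set set \<Rightarrow>
   (('o, 'm, 'p) doctrine, ('o, 'm, 'p) doc_mor, ('o, 'm, 'p) doc_2cell) two_category" where
  "Doc S =
    \<lparr>Cell0 = {P. is_doctrine P \<and> is_small S P},
     Hom2 = (\<lambda>P Q. doc_hom P Q (doc_mors P Q)),
     Id1 = doc_id,
     Comp2 = (\<lambda>P Q R. \<lparr>fobj = (\<lambda>(n, m). doc_comp1 P n m), farr = (\<lambda>(t, s). doc_comp2 P R t s)\<rparr>)\<rparr>"

definition ExDoc ::
  "'s set set \<Rightarrow>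
   (('o, 'm, 'p) doctrine, ('o, 'm, 'p) doc_mor, ('o, 'm, 'p) doc_2cell) two_category" where
  "ExDoc S =
    \<lparr>Cell0 = {P. is_ex_doctrine P \<and> is_small S P},
     Hom2 = (\<lambda>P Q. doc_hom P Q (ex_doc_mors P Q)),
     Id1 = doc_id,
     Comp2 = (\<lambda>P Q R. \<lparr>fobj = (\<lambda>(n, m). doc_comp1 P n m), farr = (\<lambda>(t, s). doc_comp2 P R t s)\<rparr>)\<rparr>"

text \<open>The forgetful 2-functor is the inclusion of the sub-2-category \<open>ExDoc S\<close> of \<open>Doc S\<close>.\<close>

definition forget ::
  "(('o, 'm, 'p) doctrine, ('o, 'm, 'p) doc_mor, ('o, 'm, 'p) doc_2cell,
    ('o, 'm, 'p) doctrine, ('o, 'm, 'p) doc_mor, ('o, 'm, 'p) doc_2cell) two_functor" where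
  "forget = \<lparr>fun0 = (\<lambda>P. P), fun12 = (\<lambda>_ _. \<lparr>fobj = (\<lambda>m. m), farr = (\<lambda>t. t)\<rparr>)\<rparr>"

lemma size_instance:
  assumes "infinite (UNIV :: 'k set)" and "A \<in> {UNIV :: 'k set}" and "B \<in> {UNIV :: 'k set}"
  shows "\<exists>C \<in> {UNIV :: 'k set}. A \<times> B \<lesssim> C" and "Pow A \<lesssim> (UNIV :: 'k set set)"
proof -
  have "A \<times> B \<approx> (UNIV :: 'k set)"
    using card_of_Times_same_infinite[OF assms(1)] assms(2,3) by (simp add: eqpoll_iff_card_of_ordIso)
  then show "\<exists>C \<in> {UNIV :: 'k set}. A \<times> B \<lesssim> C"
    by (auto intro: eqpoll_imp_lepoll)
  show "Pow A \<lesssim> (UNIV :: 'k set set)"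
    by (simp add: subset_imp_lepoll)
qed

lemma is_small_if_bounded:
  assumes "is_doctrine P" and "Arr (base P) \<lesssim> A" and "\<And>c. c \<in> Obj (base P) \<Longrightarrow> carrier (fib P c) \<lesssim> A"
    and "A \<in> S"
  shows "is_small S P"
proof -
  have "is_basis (fib P c) (carrier (fib P c))" if "c \<in> Obj (base P)" for c
  proof -
    have "complete_lattice (fib P c)"
      using assms(1) that by (auto simp: is_doctrine_def is_frame_def)
    then interpret L: complete_lattice "fib P c" .
    have "x = \<Squnion>\<^bsub>fib P c\<^esub> {b \<in> carrier (fib P c). b \<sqsubseteq>\<^bsub>fib P c\<^esub> x}"
      if x: "x \<in> carrier (fib P c)" for x
    proof (rule L.le_antisym)
      show "x \<sqsubseteq>\<^bsub>fib P c\<^esub> \<Squnion>\<^bsub>fib P c\<^esub> {b \<in> carrier (fib P c). b \<sqsubseteq>\<^bsub>fib P c\<^esub> x}"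
        using x by (intro L.sup_upper) auto
      show "\<Squnion>\<^bsub>fib P c\<^esub> {b \<in> carrier (fib P c). b \<sqsubseteq>\<^bsub>fib P c\<^esub> x} \<sqsubseteq>\<^bsub>fib P c\<^esub> x"
        using x by (intro L.sup_least) auto
    qed (use x in auto)
    then show ?thesis
      by (auto simp: is_basis_def)
  qed
  then show ?thesis
    using assms by (auto simp: is_small_def)
qed

end

theory Submission
  imports Defs
begin

text \<open>The completion keeps the base category. Its fibre over \<open>c\<close> consists of the closed sieves
  generated by pairs \<open>(\<pi>, x)\<close>, where \<open>\<pi> : p \<rightarrow> c\<close> is a product projection and \<open>x \<in> P p\<close>; such a pair stands
  for \<open>\<Sigma>\<^sub>\<pi> x\<close>. Sieves contain pairs over all arrows, not only projections, so that reindexing is plain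
  pullback of sieves. On all closed sieves, reindexing has a right adjoint and meets distribute over
  joins, hence every inclusion needed for Frobenius and Beck--Chevalley may be checked on
  generators, where it follows from the pullback squares of projections.

  A morphism \<open>(F, \<alpha>) : P \<rightarrow> Q\<close> extends by \<open>I \<mapsto> \<Squnion> {\<Sigma>\<^bsub>F \<pi>\<^esub> (\<alpha> x) | (\<pi>, x) \<in> I}\<close>, which is left adjoint to
  \<open>T \<mapsto> {(g, y). \<alpha> y \<le> (F g)\<^sup>* T}\<close>. Precomposition with the unit is thus an isomorphism of
  hom-categories, and such universal arrows assemble to a strict 2-adjunction.\<close>

section \<open>Universal arrows and 2-adjunctions\<close>

text \<open>Formal joins of formal existentials must be identified so that the unit preserves the
  joins that exist already, and the result must still be a frame. Closing sieves under joins
  \<open>\<Squnion> Y\<close> achieves exactly this, with inclusion as the order. Generation by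
  projections, however, is no closure condition on sieves: that pullbacks and binary intersections
  inherit it has to be proved, and this is where composites of projections enter. On the side of the
  universal property, joins and existentials are preserved by adjointness, whereas preservation of
  binary meets needs Frobenius and Beck-Chevalley in the target. 2-cells cost little: the unit is
  the identity on base categories, so a 2-cell keeps its components and only its inequality has to
  be extended. The remaining obstacle is size. The new fibres consist of sets of pairs and must be
  coded in the type of the old fibres; this is possible because a closed sieve is determined by its
  trace on bases of the fibres.\<close>

lemma homs_iff: "f \<in> homs C a b \<longleftrightarrow> f \<in> Arr C \<and> Dom C f = a \<and> Cod C f = b"
  by (auto simp: homs_def)

lemma category_obj:
  assumes "is_category C" "f \<in> homs C a b"
  shows "a \<in> Obj C" "b \<in> Obj C"
  using assms by (auto simp: is_category_def homs_def)

lemma category_dom_cod: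
  assumes "is_category C" "f \<in> Arr C"
  shows "Dom C f \<in> Obj C" "Cod C f \<in> Obj C"
  using assms by (auto simp: is_category_def)

lemma category_ident: "is_category C \<Longrightarrow> a \<in> Obj C \<Longrightarrow> Ident C a \<in> homs C a a"
  by (auto simp: is_category_def)

lemma category_cmp:
  "is_category C \<Longrightarrow> g \<in> homs C b c \<Longrightarrow> f \<in> homs C a b \<Longrightarrow> Cmp C g f \<in> homs C a c"
  by (auto simp: is_category_def homs_def)

lemma category_cmp_ident:
  assumes "is_category C" "f \<in> homs C a b"
  shows "Cmp C f (Ident C a) = f" "Cmp C (Ident C b) f = f"
  using assms by (auto simp: is_category_def homs_def)

lemma category_assoc:
  "is_category C \<Longrightarrow> h \<in> homs C c d \<Longrightarrow> g \<in> homs C b c \<Longrightarrow> f \<in> homs C a b \<Longrightarrow>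
   Cmp C h (Cmp C g f) = Cmp C (Cmp C h g) f"
  by (auto simp: is_category_def homs_def)

lemma is_functorD:
  assumes "is_functor C D F"
  shows "is_category C" "is_category D"
    and "a \<in> Obj C \<Longrightarrow> fobj F a \<in> Obj D"
    and "f \<in> homs C a b \<Longrightarrow> farr F f \<in> homs D (fobj F a) (fobj F b)"
    and "a \<in> Obj C \<Longrightarrow> farr F (Ident C a) = Ident D (fobj F a)"
    and "g \<in> homs C b c \<Longrightarrow> f \<in> homs C a b \<Longrightarrow> farr F (Cmp C g f) = Cmp D (farr F g) (farr F f)"
  using assms by (auto simp: is_functor_def homs_def)

lemma is_functorI:
  assumes "is_category C" "is_category D" "\<And>a. a \<in> Obj C \<Longrightarrow> fobj F a \<in> Obj D"
    and "\<And>f a b. f \<in> homs C a b \<Longrightarrow> farr F f \<in> homs D (fobj F a) (fobj F b)"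
    and "\<And>a. a \<in> Obj C \<Longrightarrow> farr F (Ident C a) = Ident D (fobj F a)"
    and "\<And>f g a b c. g \<in> homs C b c \<Longrightarrow> f \<in> homs C a b \<Longrightarrow>
      farr F (Cmp C g f) = Cmp D (farr F g) (farr F f)"
  shows "is_functor C D F"
  using assms unfolding is_functor_def homs_def by auto

section \<open>Composite and inverse functors\<close>

definition functor_comp ::
  "('o2, 'm2, 'o3, 'm3) cfunctor \<Rightarrow> ('o1, 'm1, 'o2, 'm2) cfunctor \<Rightarrow> ('o1, 'm1, 'o3, 'm3) cfunctor"
  where "functor_comp G F = \<lparr>fobj = fobj G \<circ> fobj F, farr = farr G \<circ> farr F\<rparr>"

lemma is_functor_comp:
  assumes "is_functor C D F" "is_functor D E G"
  shows "is_functor C E (functor_comp G F)"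
proof (rule is_functorI)
  note F = is_functorD[OF assms(1)] and G = is_functorD[OF assms(2)]
  show "farr (functor_comp G F) (Cmp C g f) =
      Cmp E (farr (functor_comp G F) g) (farr (functor_comp G F) f)"
    if "g \<in> homs C b c" "f \<in> homs C a b" for f g a b c
    using F(6)[OF that] G(6)[OF F(4)[OF that(1)] F(4)[OF that(2)]] by (simp add: functor_comp_def)
  show "farr (functor_comp G F) f \<in> homs E (fobj (functor_comp G F) a) (fobj (functor_comp G F) b)"
    if "f \<in> homs C a b" for f a b
    using G(4)[OF F(4)[OF that]] by (simp add: functor_comp_def)
qed (use is_functorD[OF assms(1)] is_functorD[OF assms(2)] in \<open>auto simp: functor_comp_def\<close>)

definition functor_inv ::
  "('o1, 'm1) category \<Rightarrow> ('o1, 'm1, 'o2, 'm2) cfunctor \<Rightarrow> ('o2, 'm2, 'o1, 'm1) cfunctor"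
  where "functor_inv C F =
    \<lparr>fobj = inv_into (Obj C) (fobj F), farr = inv_into (Arr C) (farr F)\<rparr>"

text \<open>Equations between inverse images are checked after applying \<open>F\<close>, which
  suffices by injectivity on arrows; domains and codomains are recovered by injectivity on
  objects.\<close>

lemma is_functor_inv:
  assumes F: "is_functor C D F"
    and obj: "bij_betw (fobj F) (Obj C) (Obj D)" and arr: "bij_betw (farr F) (Arr C) (Arr D)"
  shows "is_functor D C (functor_inv C F)"
proof -
  note FD = is_functorD[OF F]
  have o: "fobj (functor_inv C F) a \<in> Obj C" "fobj F (fobj (functor_inv C F) a) = a"
    if "a \<in> Obj D" for a
    using that obj by (auto simp: functor_inv_def bij_betw_def inv_into_into f_inv_into_f)
  have a: "farr (functor_inv C F) f \<in> Arr C" "farr F (farr (functor_inv C F) f) = f"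
    if "f \<in> Arr D" for f
    using that arr by (auto simp: functor_inv_def bij_betw_def inv_into_into f_inv_into_f)
  have oinj: "a = b" if "a \<in> Obj C" "b \<in> Obj C" "fobj F a = fobj F b" for a b
    using that obj by (auto simp: bij_betw_def inj_on_def)
  have ainj: "f = g" if "f \<in> Arr C" "g \<in> Arr C" "farr F f = farr F g" for f g
    using that arr by (auto simp: bij_betw_def inj_on_def)
  have hom: "farr (functor_inv C F) f \<in> homs C (fobj (functor_inv C F) a) (fobj (functor_inv C F) b)"
    if f: "f \<in> homs D a b" for f a b
  proof -
    let ?f = "farr (functor_inv C F) f"
    have fA: "?f \<in> Arr C" "farr F ?f = f" and ab: "a \<in> Obj D" "b \<in> Obj D"
      using a f category_obj[OF FD(2) f] by (auto simp: homs_iff)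
    have "farr F ?f \<in> homs D (fobj F (Dom C ?f)) (fobj F (Cod C ?f))"
      using fA by (intro FD(4)) (auto simp: homs_iff)
    then show ?thesis
      using fA f o[OF ab(1)] o[OF ab(2)] category_dom_cod[OF FD(1) fA(1)]
      by (auto simp: homs_iff intro: oinj)
  qed
  show ?thesis
  proof (rule is_functorI)
    show "farr (functor_inv C F) (Ident D c) = Ident C (fobj (functor_inv C F) c)"
      if c: "c \<in> Obj D" for c
      using category_ident[OF FD(2) c] category_ident[OF FD(1) o(1)[OF c]] a o[OF c] FD(5)[OF o(1)[OF c]]
      by (intro ainj) (auto simp: homs_iff)
    show "farr (functor_inv C F) (Cmp D g f) =
        Cmp C (farr (functor_inv C F) g) (farr (functor_inv C F) f)"
      if g: "g \<in> homs D y z" and f: "f \<in> homs D x y" for f g x y z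
      using category_cmp[OF FD(2) g f] category_cmp[OF FD(1) hom[OF g] hom[OF f]] a f g
        FD(6)[OF hom[OF g] hom[OF f]]
      by (intro ainj) (auto simp: homs_iff)
  qed (use FD o hom in auto)
qed

section \<open>Strict 2-functors and whiskering\<close>

lemma two_functor_id: "is_two_category Z \<Longrightarrow> is_two_functor Z Z two_functor_id"
  unfolding is_two_functor_def two_functor_id_def
  by (auto intro!: is_functorI simp: is_two_category_def)

lemma two_functor_comp:
  assumes F: "is_two_functor Z W F" and G: "is_two_functor W V G"
  shows "is_two_functor Z V (two_functor_comp G F)"
proof -
  have "is_functor (Hom2 Z x y) (Hom2 V (fun0 G (fun0 F x)) (fun0 G (fun0 F y)))
      (functor_comp (fun12 G (fun0 F x) (fun0 F y)) (fun12 F x y))"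
    if "x \<in> Cell0 Z" "y \<in> Cell0 Z" for x y
    using assms that by (intro is_functor_comp) (auto simp: is_two_functor_def Pi_iff)
  moreover have Ff: "is_functor (Hom2 Z x y) (Hom2 W (fun0 F x) (fun0 F y)) (fun12 F x y)"
    if "x \<in> Cell0 Z" "y \<in> Cell0 Z" for x y
    using F that by (simp add: is_two_functor_def)
  moreover have "fobj (fun12 F x y) f \<in> Cell1 W (fun0 F x) (fun0 F y)"
    if "x \<in> Cell0 Z" "y \<in> Cell0 Z" "f \<in> Cell1 Z x y" for x y f
    using is_functorD(3)[OF Ff] that by blast
  moreover have "farr (fun12 F x y) s \<in> Cell2 W (fun0 F x) (fun0 F y)"
    if "x \<in> Cell0 Z" "y \<in> Cell0 Z" "s \<in> Cell2 Z x y" for x y s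
    using is_functorD(4)[OF Ff] that by (auto simp: homs_iff)
  moreover have "fun0 F x \<in> Cell0 W" if "x \<in> Cell0 Z" for x
    using F that by (auto simp: is_two_functor_def)
  ultimately show ?thesis
    using assms unfolding is_two_functor_def two_functor_comp_def functor_comp_def by (simp add: Pi_iff)
qed

abbreviation cmp1 :: "('x, 'f, 't) two_category \<Rightarrow> 'x \<Rightarrow> 'x \<Rightarrow> 'x \<Rightarrow> 'f \<Rightarrow> 'f \<Rightarrow> 'f" where
  "cmp1 X x y z g f \<equiv> fobj (Comp2 X x y z) (g, f)"

abbreviation cmp2 :: "('x, 'f, 't) two_category \<Rightarrow> 'x \<Rightarrow> 'x \<Rightarrow> 'x \<Rightarrow> 't \<Rightarrow> 't \<Rightarrow> 't" where
  "cmp2 X x y z t s \<equiv> farr (Comp2 X x y z) (t, s)"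

locale two_cat =
  fixes X :: "('x, 'f, 't) two_category"
  assumes X: "is_two_category X"
begin

lemma hom_cat: "x \<in> Cell0 X \<Longrightarrow> y \<in> Cell0 X \<Longrightarrow> is_category (Hom2 X x y)"
  using X by (simp add: is_two_category_def)

lemma id1: "x \<in> Cell0 X \<Longrightarrow> Id1 X x \<in> Cell1 X x x"
  using X by (simp add: is_two_category_def)

lemma id2: "x \<in> Cell0 X \<Longrightarrow> y \<in> Cell0 X \<Longrightarrow> f \<in> Cell1 X x y \<Longrightarrow> Id2 X x y f \<in> homs (Hom2 X x y) f f"
  using category_ident[OF hom_cat] by blast

lemma id2_cell: "x \<in> Cell0 X \<Longrightarrow> y \<in> Cell0 X \<Longrightarrow> f \<in> Cell1 X x y \<Longrightarrow> Id2 X x y f \<in> Cell2 X x y"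
  using id2 by (auto simp: homs_iff)

lemma comp_functor:
  "x \<in> Cell0 X \<Longrightarrow> y \<in> Cell0 X \<Longrightarrow> z \<in> Cell0 X \<Longrightarrow>
   is_functor (prod_category (Hom2 X y z) (Hom2 X x y)) (Hom2 X x z) (Comp2 X x y z)"
  using X by (simp add: is_two_category_def)

lemma cmp1_closed:
  assumes "x \<in> Cell0 X" "y \<in> Cell0 X" "z \<in> Cell0 X" "f \<in> Cell1 X x y" "g \<in> Cell1 X y z"
  shows "cmp1 X x y z g f \<in> Cell1 X x z"
  using is_functorD(3)[OF comp_functor[OF assms(1-3)], of "(g, f)"] assms
  by (simp add: prod_category_def)

lemma cmp2_homs:
  assumes "x \<in> Cell0 X" "y \<in> Cell0 X" "z \<in> Cell0 X"
    and "s \<in> homs (Hom2 X x y) f f'" "t \<in> homs (Hom2 X y z) g g'"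
  shows "cmp2 X x y z t s \<in> homs (Hom2 X x z) (cmp1 X x y z g f) (cmp1 X x y z g' f')"
  using is_functorD(4)[OF comp_functor[OF assms(1-3)], of "(t, s)" "(g, f)" "(g', f')"] assms
  by (simp add: prod_category_def homs_iff)

lemma cmp2_closed:
  assumes "x \<in> Cell0 X" "y \<in> Cell0 X" "z \<in> Cell0 X" "s \<in> Cell2 X x y" "t \<in> Cell2 X y z"
  shows "cmp2 X x y z t s \<in> Cell2 X x z"
  using cmp2_homs[OF assms(1-3)] assms(4,5) by (auto simp: homs_iff)

lemma cmp2_id2:
  assumes "x \<in> Cell0 X" "y \<in> Cell0 X" "z \<in> Cell0 X" "f \<in> Cell1 X x y" "g \<in> Cell1 X y z"
  shows "cmp2 X x y z (Id2 X y z g) (Id2 X x y f) = Id2 X x z (cmp1 X x y z g f)"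
  using is_functorD(5)[OF comp_functor[OF assms(1-3)], of "(g, f)"] assms
  by (simp add: prod_category_def)

lemma interchange:
  assumes "x \<in> Cell0 X" "y \<in> Cell0 X" "z \<in> Cell0 X"
    and "s \<in> homs (Hom2 X x y) f f'" "s' \<in> homs (Hom2 X x y) f' f''"
    and "t \<in> homs (Hom2 X y z) g g'" "t' \<in> homs (Hom2 X y z) g' g''"
  shows "cmp2 X x y z (Cmp (Hom2 X y z) t' t) (Cmp (Hom2 X x y) s' s) =
    Cmp (Hom2 X x z) (cmp2 X x y z t' s') (cmp2 X x y z t s)"
  using is_functorD(6)[OF comp_functor[OF assms(1-3)], of "(t', s')" "(g', f')" "(g'', f'')" "(t, s)" "(g, f)"]
    assms by (simp add: prod_category_def homs_iff)

lemma cmp_id: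
  assumes "x \<in> Cell0 X" "y \<in> Cell0 X"
  shows "f \<in> Cell1 X x y \<Longrightarrow> cmp1 X x x y f (Id1 X x) = f"
    and "f \<in> Cell1 X x y \<Longrightarrow> cmp1 X x y y (Id1 X y) f = f"
    and "s \<in> Cell2 X x y \<Longrightarrow> cmp2 X x x y s (Id2 X x x (Id1 X x)) = s"
    and "s \<in> Cell2 X x y \<Longrightarrow> cmp2 X x y y (Id2 X y y (Id1 X y)) s = s"
  using X assms by (auto simp: is_two_category_def)

lemma cmp1_assoc:
  assumes "w \<in> Cell0 X" "x \<in> Cell0 X" "y \<in> Cell0 X" "z \<in> Cell0 X"
    and "f \<in> Cell1 X w x" "g \<in> Cell1 X x y" "h \<in> Cell1 X y z"
  shows "cmp1 X w y z h (cmp1 X w x y g f) = cmp1 X w x z (cmp1 X x y z h g) f"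
  using X assms by (auto simp: is_two_category_def)

lemma cmp2_assoc:
  assumes "w \<in> Cell0 X" "x \<in> Cell0 X" "y \<in> Cell0 X" "z \<in> Cell0 X"
    and "r \<in> Cell2 X w x" "s \<in> Cell2 X x y" "t \<in> Cell2 X y z"
  shows "cmp2 X w y z t (cmp2 X w x y s r) = cmp2 X w x z (cmp2 X x y z t s) r"
  using X assms by (auto simp: is_two_category_def)

definition precompose :: "'x \<Rightarrow> 'x \<Rightarrow> 'x \<Rightarrow> 'f \<Rightarrow> ('f, 't, 'f, 't) cfunctor" where
  "precompose x y z f =
    \<lparr>fobj = (\<lambda>g. cmp1 X x y z g f), farr = (\<lambda>t. cmp2 X x y z t (Id2 X x y f))\<rparr>"

definition postcompose :: "'x \<Rightarrow> 'x \<Rightarrow> 'x \<Rightarrow> 'f \<Rightarrow> ('f, 't, 'f, 't) cfunctor" where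
  "postcompose x y z g =
    \<lparr>fobj = (\<lambda>f. cmp1 X x y z g f), farr = (\<lambda>s. cmp2 X x y z (Id2 X y z g) s)\<rparr>"

lemma precompose_functor:
  assumes "x \<in> Cell0 X" "y \<in> Cell0 X" "z \<in> Cell0 X" "f \<in> Cell1 X x y"
  shows "is_functor (Hom2 X y z) (Hom2 X x z) (precompose x y z f)"
proof (rule is_functorI)
  note i = id2[OF assms(1,2,4)]
  \<comment> \<open>The interchange law leaves the vertical composite of the fixed identity 2-cell
    with itself; this collapses it.\<close>
  have ii: "Cmp (Hom2 X x y) (Id2 X x y f) (Id2 X x y f) = Id2 X x y f"
    using category_cmp_ident(1)[OF hom_cat[OF assms(1,2)] i] .
  show "farr (precompose x y z f) (Cmp (Hom2 X y z) t' t) =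
      Cmp (Hom2 X x z) (farr (precompose x y z f) t') (farr (precompose x y z f) t)"
    if "t' \<in> homs (Hom2 X y z) g' g''" "t \<in> homs (Hom2 X y z) g g'" for t t' g g' g''
    using interchange[OF assms(1-3) i i that(2,1)] by (simp add: precompose_def ii)
  show "farr (precompose x y z f) t
      \<in> homs (Hom2 X x z) (fobj (precompose x y z f) g) (fobj (precompose x y z f) g')"
    if "t \<in> homs (Hom2 X y z) g g'" for t g g'
    using cmp2_homs[OF assms(1-3) i that] by (simp add: precompose_def)
qed (use assms in \<open>auto simp: precompose_def hom_cat cmp1_closed cmp2_id2\<close>)

lemma postcompose_functor:
  assumes "x \<in> Cell0 X" "y \<in> Cell0 X" "z \<in> Cell0 X" "g \<in> Cell1 X y z"
  shows "is_functor (Hom2 X x y) (Hom2 X x z) (postcompose x y z g)"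
proof (rule is_functorI)
  note i = id2[OF assms(2-4)]
  have ii: "Cmp (Hom2 X y z) (Id2 X y z g) (Id2 X y z g) = Id2 X y z g"
    using category_cmp_ident(1)[OF hom_cat[OF assms(2,3)] i] .
  show "farr (postcompose x y z g) (Cmp (Hom2 X x y) s' s) =
      Cmp (Hom2 X x z) (farr (postcompose x y z g) s') (farr (postcompose x y z g) s)"
    if "s' \<in> homs (Hom2 X x y) f' f''" "s \<in> homs (Hom2 X x y) f f'" for s s' f f' f''
    using interchange[OF assms(1-3) that(2,1) i i] by (simp add: postcompose_def ii)
  show "farr (postcompose x y z g) s
      \<in> homs (Hom2 X x z) (fobj (postcompose x y z g) f) (fobj (postcompose x y z g) f')"
    if "s \<in> homs (Hom2 X x y) f f'" for s f f'
    using cmp2_homs[OF assms(1-3) that i] by (simp add: postcompose_def)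
qed (use assms in \<open>auto simp: postcompose_def hom_cat cmp1_closed cmp2_id2\<close>)

end

section \<open>Universal arrows give a strict left 2-adjoint\<close>

locale universal_arrows = X: two_cat X + Y: two_cat Y
  for X :: "('x, 'f, 't) two_category" and Y :: "('y, 'g, 's) two_category" +
  fixes U :: "('y, 'g, 's, 'x, 'f, 't) two_functor" and L0 :: "'x \<Rightarrow> 'y" and \<eta> :: "'x \<Rightarrow> 'f"
  assumes U: "is_two_functor Y X U"
    and L0: "x \<in> Cell0 X \<Longrightarrow> L0 x \<in> Cell0 Y"
    and \<eta>: "x \<in> Cell0 X \<Longrightarrow> \<eta> x \<in> Cell1 X x (fun0 U (L0 x))"
    and bij1: "x \<in> Cell0 X \<Longrightarrow> y \<in> Cell0 Y \<Longrightarrow>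
      bij_betw (\<lambda>g. cmp1 X x (fun0 U (L0 x)) (fun0 U y) (fobj (fun12 U (L0 x) y) g) (\<eta> x))
        (Cell1 Y (L0 x) y) (Cell1 X x (fun0 U y))"
    and bij2: "x \<in> Cell0 X \<Longrightarrow> y \<in> Cell0 Y \<Longrightarrow>
      bij_betw (\<lambda>t. cmp2 X x (fun0 U (L0 x)) (fun0 U y) (farr (fun12 U (L0 x) y) t)
          (Id2 X x (fun0 U (L0 x)) (\<eta> x)))
        (Cell2 Y (L0 x) y) (Cell2 X x (fun0 U y))"
begin

lemma U0: "y \<in> Cell0 Y \<Longrightarrow> fun0 U y \<in> Cell0 X"
  using U by (auto simp: is_two_functor_def)

lemma U_functor:
  "x \<in> Cell0 Y \<Longrightarrow> y \<in> Cell0 Y \<Longrightarrow>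
   is_functor (Hom2 Y x y) (Hom2 X (fun0 U x) (fun0 U y)) (fun12 U x y)"
  using U by (auto simp: is_two_functor_def)

lemma U_closed:
  assumes "x \<in> Cell0 Y" "y \<in> Cell0 Y"
  shows "f \<in> Cell1 Y x y \<Longrightarrow> fobj (fun12 U x y) f \<in> Cell1 X (fun0 U x) (fun0 U y)"
    and "s \<in> Cell2 Y x y \<Longrightarrow> farr (fun12 U x y) s \<in> Cell2 X (fun0 U x) (fun0 U y)"
  using U_functor[OF assms] by (auto simp: is_functor_def homs_iff)

lemma U_id: "x \<in> Cell0 Y \<Longrightarrow> fobj (fun12 U x x) (Id1 Y x) = Id1 X (fun0 U x)"
  using U by (auto simp: is_two_functor_def)

lemma U_cmp:
  assumes "x \<in> Cell0 Y" "y \<in> Cell0 Y" "z \<in> Cell0 Y"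
  shows "f \<in> Cell1 Y x y \<Longrightarrow> g \<in> Cell1 Y y z \<Longrightarrow>
    fobj (fun12 U x z) (cmp1 Y x y z g f) =
    cmp1 X (fun0 U x) (fun0 U y) (fun0 U z) (fobj (fun12 U y z) g) (fobj (fun12 U x y) f)"
    and "s \<in> Cell2 Y x y \<Longrightarrow> t \<in> Cell2 Y y z \<Longrightarrow>
    farr (fun12 U x z) (cmp2 Y x y z t s) =
    cmp2 X (fun0 U x) (fun0 U y) (fun0 U z) (farr (fun12 U y z) t) (farr (fun12 U x y) s)"
  using U assms by (auto simp: is_two_functor_def)

text \<open>Transposition along the universal arrow. Being \<open>U\<close> followed by
  precomposition with \<open>\<eta> x\<close>, it is automatically natural in \<open>y\<close>. The
  two bijectivity assumptions of the locale make each \<open>transp x y\<close> an isomorphism of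
  hom-categories.\<close>

definition transp :: "'x \<Rightarrow> 'y \<Rightarrow> ('g, 's, 'f, 't) cfunctor" where
  "transp x y = functor_comp (X.precompose x (fun0 U (L0 x)) (fun0 U y) (\<eta> x)) (fun12 U (L0 x) y)"

definition untransp :: "'x \<Rightarrow> 'y \<Rightarrow> ('f, 't, 'g, 's) cfunctor" where
  "untransp x y = functor_inv (Hom2 Y (L0 x) y) (transp x y)"

lemma transp_functor:
  assumes "x \<in> Cell0 X" "y \<in> Cell0 Y"
  shows "is_functor (Hom2 Y (L0 x) y) (Hom2 X x (fun0 U y)) (transp x y)"
  unfolding transp_def using assms
  by (intro is_functor_comp[OF U_functor X.precompose_functor]) (auto simp: L0 \<eta> U0)

lemma transp_bij:
  assumes "x \<in> Cell0 X" "y \<in> Cell0 Y"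
  shows "bij_betw (fobj (transp x y)) (Cell1 Y (L0 x) y) (Cell1 X x (fun0 U y))"
    and "bij_betw (farr (transp x y)) (Cell2 Y (L0 x) y) (Cell2 X x (fun0 U y))"
  using bij1[OF assms] bij2[OF assms]
  by (auto simp: transp_def functor_comp_def X.precompose_def comp_def)

lemma untransp_functor:
  assumes "x \<in> Cell0 X" "y \<in> Cell0 Y"
  shows "is_functor (Hom2 X x (fun0 U y)) (Hom2 Y (L0 x) y) (untransp x y)"
  unfolding untransp_def using transp_functor transp_bij assms by (intro is_functor_inv) auto

lemma untransp:
  assumes "x \<in> Cell0 X" "y \<in> Cell0 Y"
  shows "f \<in> Cell1 X x (fun0 U y) \<Longrightarrow> fobj (untransp x y) f \<in> Cell1 Y (L0 x) y"
    and "s \<in> Cell2 X x (fun0 U y) \<Longrightarrow> farr (untransp x y) s \<in> Cell2 Y (L0 x) y"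
    and "f \<in> Cell1 X x (fun0 U y) \<Longrightarrow> fobj (transp x y) (fobj (untransp x y) f) = f"
    and "s \<in> Cell2 X x (fun0 U y) \<Longrightarrow> farr (transp x y) (farr (untransp x y) s) = s"
  using transp_bij[OF assms]
  by (auto simp: untransp_def functor_inv_def bij_betw_def inv_into_into f_inv_into_f)

text \<open>The uniqueness half of universality. It reduces the functor laws of \<open>Ladj\<close>,
  the naturality of \<open>counit\<close> and the first triangle identity to computations in
  \<open>X\<close>.\<close>

lemma transp_eqI:
  assumes "x \<in> Cell0 X" "y \<in> Cell0 Y"
  shows "f \<in> Cell1 Y (L0 x) y \<Longrightarrow> g \<in> Cell1 Y (L0 x) y \<Longrightarrow>
      fobj (transp x y) f = fobj (transp x y) g \<Longrightarrow> f = g"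
    and "s \<in> Cell2 Y (L0 x) y \<Longrightarrow> t \<in> Cell2 Y (L0 x) y \<Longrightarrow>
      farr (transp x y) s = farr (transp x y) t \<Longrightarrow> s = t"
  using transp_bij[OF assms] by (auto simp: bij_betw_def inj_on_def)

lemma transp_id: "x \<in> Cell0 X \<Longrightarrow> fobj (transp x (L0 x)) (Id1 Y (L0 x)) = \<eta> x"
  by (simp add: transp_def functor_comp_def X.precompose_def U_id L0 \<eta> U0 X.cmp_id)

lemma transp_cmp:
  assumes [simp]: "x \<in> Cell0 X" "y \<in> Cell0 Y" "z \<in> Cell0 Y"
  shows "g \<in> Cell1 Y (L0 x) y \<Longrightarrow> h \<in> Cell1 Y y z \<Longrightarrow>
      fobj (transp x z) (cmp1 Y (L0 x) y z h g) =
      cmp1 X x (fun0 U y) (fun0 U z) (fobj (fun12 U y z) h) (fobj (transp x y) g)"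
    and "s \<in> Cell2 Y (L0 x) y \<Longrightarrow> t \<in> Cell2 Y y z \<Longrightarrow>
      farr (transp x z) (cmp2 Y (L0 x) y z t s) =
      cmp2 X x (fun0 U y) (fun0 U z) (farr (fun12 U y z) t) (farr (transp x y) s)"
  by (simp_all add: transp_def functor_comp_def X.precompose_def U_cmp L0 \<eta> U0 X.cmp1_assoc
      X.cmp2_assoc U_closed X.id2_cell)

text \<open>The value at a 1-cell \<open>f\<close> is forced by naturality of the unit: it must be
  the cell whose transpose is \<open>\<eta> x'\<close> after \<open>f\<close>. The same holds for
  2-cells, so one composite of functors defines both actions.\<close>

definition Ladj :: "('x, 'f, 't, 'y, 'g, 's) two_functor" where
  "Ladj = \<lparr>fun0 = L0, fun12 = (\<lambda>x x'. functor_comp (untransp x (L0 x'))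
     (X.postcompose x x' (fun0 U (L0 x')) (\<eta> x')))\<rparr>"

definition counit :: "'y \<Rightarrow> 'g" where
  "counit y = fobj (untransp (fun0 U y) y) (Id1 X (fun0 U y))"

lemma Ladj_fun0 [simp]: "fun0 Ladj = L0"
  by (simp add: Ladj_def)

lemma Ladj_functor:
  assumes "x \<in> Cell0 X" "y \<in> Cell0 X"
  shows "is_functor (Hom2 X x y) (Hom2 Y (L0 x) (L0 y)) (fun12 Ladj x y)"
  using assms unfolding Ladj_def two_functor.simps
  by (intro is_functor_comp[OF X.postcompose_functor untransp_functor]) (auto simp: L0 \<eta> U0)

lemma Ladj_closed:
  assumes "x \<in> Cell0 X" "y \<in> Cell0 X"
  shows "f \<in> Cell1 X x y \<Longrightarrow> fobj (fun12 Ladj x y) f \<in> Cell1 Y (L0 x) (L0 y)"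
    and "s \<in> Cell2 X x y \<Longrightarrow> farr (fun12 Ladj x y) s \<in> Cell2 Y (L0 x) (L0 y)"
  using Ladj_functor[OF assms] by (auto simp: is_functor_def homs_iff)

lemma transp_Ladj:
  assumes [simp]: "x \<in> Cell0 X" "y \<in> Cell0 X"
  shows "f \<in> Cell1 X x y \<Longrightarrow>
      fobj (transp x (L0 y)) (fobj (fun12 Ladj x y) f) = cmp1 X x y (fun0 U (L0 y)) (\<eta> y) f"
    and "s \<in> Cell2 X x y \<Longrightarrow>
      farr (transp x (L0 y)) (farr (fun12 Ladj x y) s) =
      cmp2 X x y (fun0 U (L0 y)) (Id2 X y (fun0 U (L0 y)) (\<eta> y)) s"
  by (simp_all add: Ladj_def functor_comp_def X.postcompose_def untransp L0 U0 \<eta> X.cmp1_closed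
      X.cmp2_closed X.id2_cell)

text \<open>Naturality of transposition in its source. Together with \<open>transp_cmp\<close> it
  evaluates every composite that occurs in the functor laws and in the naturality of
  \<open>counit\<close>.\<close>

lemma transp_cmp_Ladj:
  assumes [simp]: "x \<in> Cell0 X" "x' \<in> Cell0 X" "y \<in> Cell0 Y"
  shows "f \<in> Cell1 X x x' \<Longrightarrow> g \<in> Cell1 Y (L0 x') y \<Longrightarrow>
      fobj (transp x y) (cmp1 Y (L0 x) (L0 x') y g (fobj (fun12 Ladj x x') f)) =
      cmp1 X x x' (fun0 U y) (fobj (transp x' y) g) f"
    and "s \<in> Cell2 X x x' \<Longrightarrow> t \<in> Cell2 Y (L0 x') y \<Longrightarrow>
      farr (transp x y) (cmp2 Y (L0 x) (L0 x') y t (farr (fun12 Ladj x x') s)) =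
      cmp2 X x x' (fun0 U y) (farr (transp x' y) t) s"
   \<comment> \<open>The first pass turns the transpose of \<open>Ladj\<close> at \<open>f\<close>
     into \<open>\<eta> x'\<close> after \<open>f\<close>; the second unfolds the other transposes,
     so that the two sides differ by associativity only.\<close>
   apply (simp_all add: transp_cmp Ladj_closed L0 transp_Ladj)
   apply (simp_all add: transp_def functor_comp_def X.precompose_def L0 \<eta> U0 X.cmp1_assoc
      X.cmp2_assoc U_closed X.id2_cell)
  done

lemma Ladj_two_functor: "is_two_functor X Y Ladj"
  unfolding is_two_functor_def Ladj_fun0
proof (intro conjI ballI)
  fix x assume x [simp]: "x \<in> Cell0 X"
  show "fobj (fun12 Ladj x x) (Id1 X x) = Id1 Y (L0 x)"
    by (rule transp_eqI(1)[of x "L0 x"])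
      (simp_all add: L0 Ladj_closed X.id1 Y.id1 transp_Ladj transp_id X.cmp_id U0 \<eta>)
next
  fix x y z assume [simp]: "x \<in> Cell0 X" "y \<in> Cell0 X" "z \<in> Cell0 X"
  show "fobj (fun12 Ladj x z) (cmp1 X x y z g f) =
      cmp1 Y (L0 x) (L0 y) (L0 z) (fobj (fun12 Ladj y z) g) (fobj (fun12 Ladj x y) f)"
    if "f \<in> Cell1 X x y" "g \<in> Cell1 X y z" for f g
    using that by (intro transp_eqI(1)[of x "L0 z"])
      (simp_all add: L0 Ladj_closed Y.cmp1_closed X.cmp1_closed transp_Ladj transp_cmp_Ladj
        X.cmp1_assoc U0 \<eta>)
  show "farr (fun12 Ladj x z) (cmp2 X x y z t s) =
      cmp2 Y (L0 x) (L0 y) (L0 z) (farr (fun12 Ladj y z) t) (farr (fun12 Ladj x y) s)"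
    if "s \<in> Cell2 X x y" "t \<in> Cell2 X y z" for s t
    using that by (intro transp_eqI(2)[of x "L0 z"])
      (simp_all add: L0 Ladj_closed Y.cmp2_closed X.cmp2_closed transp_Ladj transp_cmp_Ladj
        X.cmp2_assoc U0 \<eta> X.id2_cell)
qed (use X.X Y.X L0 Ladj_functor in auto)

lemma transp_counit:
  "y \<in> Cell0 Y \<Longrightarrow> fobj (transp (fun0 U y) y) (counit y) = Id1 X (fun0 U y)"
  by (simp add: counit_def untransp U0 X.id1)

lemma counit: "y \<in> Cell0 Y \<Longrightarrow> counit y \<in> Cell1 Y (L0 (fun0 U y)) y"
  by (simp add: counit_def untransp U0 X.id1)

lemma transp_id2:
  "x \<in> Cell0 X \<Longrightarrow> y \<in> Cell0 Y \<Longrightarrow> g \<in> Cell1 Y (L0 x) y \<Longrightarrow>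
   farr (transp x y) (Id2 Y (L0 x) y g) = Id2 X x (fun0 U y) (fobj (transp x y) g)"
  by (rule is_functorD(5)[OF transp_functor])

text \<open>This is \<open>transp_Ladj\<close>, the defining property of \<open>Ladj\<close>, with
  transposition unfolded.\<close>

lemma unit_nat: "is_two_nat_trans X X two_functor_id (two_functor_comp U Ladj) \<eta>"
  unfolding is_two_nat_trans_def
proof (intro conjI ballI)
  show "is_two_functor X X two_functor_id"
    by (rule two_functor_id[OF X.X])
  show "is_two_functor X X (two_functor_comp U Ladj)"
    by (rule two_functor_comp[OF Ladj_two_functor U])
  fix x y assume xy: "x \<in> Cell0 X" "y \<in> Cell0 X"
  show "cmp1 X (fun0 two_functor_id x) (fun0 two_functor_id y) (fun0 (two_functor_comp U Ladj) y)
      (\<eta> y) (fobj (fun12 two_functor_id x y) f) =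
    cmp1 X (fun0 two_functor_id x) (fun0 (two_functor_comp U Ladj) x)
      (fun0 (two_functor_comp U Ladj) y) (fobj (fun12 (two_functor_comp U Ladj) x y) f) (\<eta> x)"
    if "f \<in> Cell1 X x y" for f
    using transp_Ladj(1)[OF xy that]
    by (simp add: two_functor_id_def two_functor_comp_def transp_def functor_comp_def
        X.precompose_def)
  show "cmp2 X (fun0 two_functor_id x) (fun0 two_functor_id y) (fun0 (two_functor_comp U Ladj) y)
      (Id2 X (fun0 two_functor_id y) (fun0 (two_functor_comp U Ladj) y) (\<eta> y))
      (farr (fun12 two_functor_id x y) s) =
    cmp2 X (fun0 two_functor_id x) (fun0 (two_functor_comp U Ladj) x)
      (fun0 (two_functor_comp U Ladj) y) (farr (fun12 (two_functor_comp U Ladj) x y) s)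
      (Id2 X (fun0 two_functor_id x) (fun0 (two_functor_comp U Ladj) x) (\<eta> x))"
    if "s \<in> Cell2 X x y" for s
    using transp_Ladj(2)[OF xy that]
    by (simp add: two_functor_id_def two_functor_comp_def transp_def functor_comp_def
        X.precompose_def)
qed (simp add: two_functor_id_def two_functor_comp_def \<eta>)

text \<open>Both sides of a naturality square transpose to the image of the given cell under
  \<open>U\<close>, because \<open>counit\<close> transposes to an identity.\<close>

lemma counit_nat: "is_two_nat_trans Y Y (two_functor_comp Ladj U) two_functor_id counit"
  unfolding is_two_nat_trans_def
proof (intro conjI ballI)
  show "is_two_functor Y Y two_functor_id"
    by (rule two_functor_id[OF Y.X])
  show "is_two_functor Y Y (two_functor_comp Ladj U)"
    by (rule two_functor_comp[OF U Ladj_two_functor])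
  fix x y assume [simp]: "x \<in> Cell0 Y" "y \<in> Cell0 Y"
  show "cmp1 Y (fun0 (two_functor_comp Ladj U) x) (fun0 (two_functor_comp Ladj U) y)
      (fun0 two_functor_id y) (counit y) (fobj (fun12 (two_functor_comp Ladj U) x y) f) =
    cmp1 Y (fun0 (two_functor_comp Ladj U) x) (fun0 two_functor_id x) (fun0 two_functor_id y)
      (fobj (fun12 two_functor_id x y) f) (counit x)"
    if "f \<in> Cell1 Y x y" for f
    unfolding two_functor_id_def two_functor_comp_def
  proof (simp, rule transp_eqI(1)[of "fun0 U x" y])
    show "fobj (transp (fun0 U x) y) (cmp1 Y (L0 (fun0 U x)) (L0 (fun0 U y)) y (counit y)
        (fobj (fun12 Ladj (fun0 U x) (fun0 U y)) (fobj (fun12 U x y) f))) =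
      fobj (transp (fun0 U x) y) (cmp1 Y (L0 (fun0 U x)) x y f (counit x))"
      using that by (subst transp_cmp_Ladj)
        (simp_all add: U0 U_closed counit transp_cmp transp_counit X.cmp_id)
  qed (use that in \<open>simp_all add: U0 L0 Ladj_closed U_closed Y.cmp1_closed counit\<close>)
  show "cmp2 Y (fun0 (two_functor_comp Ladj U) x) (fun0 (two_functor_comp Ladj U) y)
      (fun0 two_functor_id y)
      (Id2 Y (fun0 (two_functor_comp Ladj U) y) (fun0 two_functor_id y) (counit y))
      (farr (fun12 (two_functor_comp Ladj U) x y) s) =
    cmp2 Y (fun0 (two_functor_comp Ladj U) x) (fun0 two_functor_id x) (fun0 two_functor_id y)
      (farr (fun12 two_functor_id x y) s)
      (Id2 Y (fun0 (two_functor_comp Ladj U) x) (fun0 two_functor_id x) (counit x))"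
    if "s \<in> Cell2 Y x y" for s
    unfolding two_functor_id_def two_functor_comp_def
  proof (simp, rule transp_eqI(2)[of "fun0 U x" y])
    show "farr (transp (fun0 U x) y) (cmp2 Y (L0 (fun0 U x)) (L0 (fun0 U y)) y
        (Id2 Y (L0 (fun0 U y)) y (counit y))
        (farr (fun12 Ladj (fun0 U x) (fun0 U y)) (farr (fun12 U x y) s))) =
      farr (transp (fun0 U x) y)
        (cmp2 Y (L0 (fun0 U x)) x y s (Id2 Y (L0 (fun0 U x)) x (counit x)))"
      using that by (subst transp_cmp_Ladj)
        (simp_all add: U0 L0 U_closed counit Y.id2_cell transp_cmp transp_counit transp_id2 X.cmp_id)
  qed (use that in \<open>simp_all add: U0 L0 Ladj_closed U_closed Y.cmp2_closed Y.id2_cell counit\<close>)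
qed (simp add: two_functor_id_def two_functor_comp_def counit)

theorem two_adjunction: "is_two_adjunction X Y Ladj U \<eta> counit"
  unfolding is_two_adjunction_def Ladj_fun0
proof (intro conjI ballI)
  fix x assume [simp]: "x \<in> Cell0 X"
  \<comment> \<open>Both sides transpose to \<open>\<eta> x\<close>.\<close>
  show "cmp1 Y (L0 x) (L0 (fun0 U (L0 x))) (L0 x) (counit (L0 x))
      (fobj (fun12 Ladj x (fun0 U (L0 x))) (\<eta> x)) = Id1 Y (L0 x)"
    by (rule transp_eqI(1)[of x "L0 x"])
      (simp_all add: U0 L0 \<eta> Ladj_closed Y.cmp1_closed Y.id1 counit transp_cmp_Ladj transp_counit
        transp_id X.cmp_id)
next
  fix y assume [simp]: "y \<in> Cell0 Y"
  \<comment> \<open>Read through the definition of \<open>transp\<close>, this says that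
    \<open>counit y\<close> transposes to the identity.\<close>
  show "cmp1 X (fun0 U y) (fun0 U (L0 (fun0 U y))) (fun0 U y)
      (fobj (fun12 U (L0 (fun0 U y)) y) (counit y)) (\<eta> (fun0 U y)) = Id1 X (fun0 U y)"
    using transp_counit[of y] by (simp add: transp_def functor_comp_def X.precompose_def)
qed (use Ladj_two_functor U unit_nat counit_nat in auto)

end

section \<open>The 2-categories of doctrines\<close>

lemma frame_lattice: "is_frame L \<Longrightarrow> complete_lattice L"
  by (simp add: is_frame_def)

lemma frame_partial_order: "is_frame L \<Longrightarrow> partial_order L"
  using frame_lattice complete_lattice.axioms(1) by blast

lemma frame_refl: "is_frame L \<Longrightarrow> x \<in> carrier L \<Longrightarrow> x \<sqsubseteq>\<^bsub>L\<^esub> x"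
  by (meson frame_partial_order partial_order.axioms(1) weak_partial_order.le_refl)

lemma frame_trans:
  "is_frame L \<Longrightarrow> x \<sqsubseteq>\<^bsub>L\<^esub> y \<Longrightarrow> y \<sqsubseteq>\<^bsub>L\<^esub> z \<Longrightarrow> x \<in> carrier L \<Longrightarrow> y \<in> carrier L \<Longrightarrow> z \<in> carrier L \<Longrightarrow>
   x \<sqsubseteq>\<^bsub>L\<^esub> z"
  by (meson frame_partial_order partial_order.axioms(1) weak_partial_order.le_trans)

lemma frame_antisym:
  "is_frame L \<Longrightarrow> x \<sqsubseteq>\<^bsub>L\<^esub> y \<Longrightarrow> y \<sqsubseteq>\<^bsub>L\<^esub> x \<Longrightarrow> x \<in> carrier L \<Longrightarrow> y \<in> carrier L \<Longrightarrow> x = y"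
  by (meson frame_partial_order partial_order.le_antisym)

lemma frame_hom_closed: "is_frame_hom L M h \<Longrightarrow> x \<in> carrier L \<Longrightarrow> h x \<in> carrier M"
  by (auto simp: is_frame_hom_def)

lemma frame_hom_mono:
  assumes "is_frame_hom L M h" "x \<in> carrier L" "y \<in> carrier L" "x \<sqsubseteq>\<^bsub>L\<^esub> y"
  shows "h x \<sqsubseteq>\<^bsub>M\<^esub> h y"
  using meet_pres_isotone[of h L M] assms by (auto simp: is_frame_hom_def isotone_def)

lemma frame_hom_sup:
  "is_frame_hom L M h \<Longrightarrow> A \<subseteq> carrier L \<Longrightarrow> h (\<Squnion>\<^bsub>L\<^esub> A) = \<Squnion>\<^bsub>M\<^esub> (h ` A)"
  by (auto simp: is_frame_hom_def sup_pres_def)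

lemma frame_hom_meet:
  "is_frame_hom L M h \<Longrightarrow> x \<in> carrier L \<Longrightarrow> y \<in> carrier L \<Longrightarrow> h (x \<sqinter>\<^bsub>L\<^esub> y) = h x \<sqinter>\<^bsub>M\<^esub> h y"
  by (auto simp: is_frame_hom_def meet_pres_def)

lemma frame_hom_top: "is_frame_hom L M h \<Longrightarrow> h \<top>\<^bsub>L\<^esub> = \<top>\<^bsub>M\<^esub>"
  by (auto simp: is_frame_hom_def)

text \<open>The composite is described by an equation on the carrier, so that the lemma applies to
  the extensional composites that occur in cells.\<close>

lemma frame_hom_comp:
  assumes h: "is_frame_hom L M h" and k: "is_frame_hom M N k"
    and L: "is_frame L" and e: "\<And>x. x \<in> carrier L \<Longrightarrow> hk x = k (h x)"
  shows "is_frame_hom L N hk"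
proof -
  interpret complete_lattice L
    by (rule frame_lattice[OF L])
  have "hk (\<Squnion>\<^bsub>L\<^esub> A) = \<Squnion>\<^bsub>N\<^esub> (hk ` A)" if A: "A \<subseteq> carrier L" for A
  proof -
    have "h ` A \<subseteq> carrier M" "hk ` A = k ` h ` A"
      using A h e by (auto simp: frame_hom_closed image_image intro!: image_cong)
    then show ?thesis
      using A e frame_hom_sup[OF h A] frame_hom_sup[OF k, of "h ` A"] by simp
  qed
  moreover have "hk (x \<sqinter>\<^bsub>L\<^esub> y) = hk x \<sqinter>\<^bsub>N\<^esub> hk y" if "x \<in> carrier L" "y \<in> carrier L" for x y
    using that e frame_hom_meet[OF h] frame_hom_meet[OF k] frame_hom_closed[OF h] by simp
  moreover have "hk \<top>\<^bsub>L\<^esub> = \<top>\<^bsub>N\<^esub>"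
    using e frame_hom_top[OF h] frame_hom_top[OF k] by simp
  moreover have "hk \<in> carrier L \<rightarrow> carrier N"
    using e frame_hom_closed[OF h] frame_hom_closed[OF k] by simp
  ultimately show ?thesis
    using h k by (simp add: is_frame_hom_def meet_pres_def sup_pres_def)
qed

lemma frame_hom_id:
  assumes L: "is_frame L" and e: "\<And>x. x \<in> carrier L \<Longrightarrow> i x = x"
  shows "is_frame_hom L L i"
proof -
  interpret L: complete_lattice L
    by (rule frame_lattice[OF L])
  have "i (\<Squnion>\<^bsub>L\<^esub> A) = \<Squnion>\<^bsub>L\<^esub> (i ` A)" if A: "A \<subseteq> carrier L" for A
  proof -
    have "i ` A = id ` A"
      using A e by (intro image_cong) auto
    then show ?thesis
      using A e by simp
  qed
  then have "sup_pres L L i"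
    using L.complete_lattice_axioms unfolding sup_pres_def by blast
  moreover have "lattice L"
    by unfold_locales
  ultimately show ?thesis
    using e by (simp add: is_frame_hom_def meet_pres_def)
qed

section \<open>Morphisms of doctrines and their 2-cells\<close>

lemma doctrineD:
  assumes "is_doctrine P"
  shows "is_category (base P)" "has_finite_products (base P)"
    and "c \<in> Obj (base P) \<Longrightarrow> is_frame (fib P c)"
    and "f \<in> homs (base P) a b \<Longrightarrow> is_frame_hom (fib P b) (fib P a) (reindex P f)"
    and "c \<in> Obj (base P) \<Longrightarrow> x \<in> carrier (fib P c) \<Longrightarrow> reindex P (Ident (base P) c) x = x"
    and "g \<in> homs (base P) b c \<Longrightarrow> f \<in> homs (base P) a b \<Longrightarrow> x \<in> carrier (fib P c) \<Longrightarrow>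
      reindex P (Cmp (base P) g f) x = reindex P f (reindex P g x)"
  using assms by (auto simp: is_doctrine_def homs_iff)

lemma doc_morsD:
  assumes "m \<in> doc_mors P Q"
  shows "is_functor (base P) (base Q) (ftr m)"
    and "preserves_finite_products (base P) (base Q) (ftr m)"
    and "c \<in> Obj (base P) \<Longrightarrow> is_frame_hom (fib P c) (fib Q (fobj (ftr m) c)) (fibmap m c)"
    and "f \<in> homs (base P) a b \<Longrightarrow> x \<in> carrier (fib P b) \<Longrightarrow>
      fibmap m a (reindex P f x) = reindex Q (farr (ftr m) f) (fibmap m b x)"
    and "fobj (ftr m) \<in> extensional (Obj (base P))" "farr (ftr m) \<in> extensional (Arr (base P))"
    and "fibmap m \<in> extensional (Obj (base P))"
    and "c \<in> Obj (base P) \<Longrightarrow> fibmap m c \<in> extensional (carrier (fib P c))"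
  using assms by (auto simp: doc_mors_def homs_iff)

lemma doc_mors_fibmap_closed:
  "m \<in> doc_mors P Q \<Longrightarrow> c \<in> Obj (base P) \<Longrightarrow> x \<in> carrier (fib P c) \<Longrightarrow>
   fibmap m c x \<in> carrier (fib Q (fobj (ftr m) c))"
  by (meson doc_morsD(3) frame_hom_closed)

lemma doc_mor_eqI:
  assumes m: "m \<in> doc_mors P Q" and n: "n \<in> doc_mors P Q'"
    and "\<And>c. c \<in> Obj (base P) \<Longrightarrow> fobj (ftr m) c = fobj (ftr n) c"
    and "\<And>f. f \<in> Arr (base P) \<Longrightarrow> farr (ftr m) f = farr (ftr n) f"
    and "\<And>c x. c \<in> Obj (base P) \<Longrightarrow> x \<in> carrier (fib P c) \<Longrightarrow> fibmap m c x = fibmap n c x"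
  shows "m = n"
proof -
  have "fobj (ftr m) = fobj (ftr n)"
    by (rule extensionalityI[OF doc_morsD(5)[OF m] doc_morsD(5)[OF n] assms(3)])
  moreover have "farr (ftr m) = farr (ftr n)"
    by (rule extensionalityI[OF doc_morsD(6)[OF m] doc_morsD(6)[OF n] assms(4)])
  moreover have "fibmap m c = fibmap n c" if "c \<in> Obj (base P)" for c
    by (rule extensionalityI[OF doc_morsD(8)[OF m that] doc_morsD(8)[OF n that] assms(5)[OF that]])
  then have "fibmap m = fibmap n"
    by (rule extensionalityI[OF doc_morsD(7)[OF m] doc_morsD(7)[OF n]])
  ultimately show ?thesis
    by simp
qed

lemma doc_id_mor:
  assumes P: "is_doctrine P"
  shows "doc_id P \<in> doc_mors P P"
proof -
  note D = doctrineD[OF P]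
  have "is_functor (base P) (base P) (ftr (doc_id P))"
    using D(1) by (auto simp: doc_id_def is_functor_def is_category_def homs_iff)
  moreover have "preserves_finite_products (base P) (base P) (ftr (doc_id P))"
    using D(1) category_obj[OF D(1)]
    by (auto simp: doc_id_def preserves_finite_products_def is_terminal_def is_product_def homs_iff
        category_dom_cod)
  moreover have "is_frame_hom (fib P c) (fib P (fobj (ftr (doc_id P)) c)) (fibmap (doc_id P) c)"
    if "c \<in> Obj (base P)" for c
    using frame_hom_id[OF D(3)[OF that], of "fibmap (doc_id P) c"] that by (simp add: doc_id_def)
  moreover have "reindex P f x \<in> carrier (fib P (Dom (base P) f))"
    if "f \<in> Arr (base P)" "x \<in> carrier (fib P (Cod (base P) f))" for f x
    using frame_hom_closed[OF D(4)] that by (auto simp: homs_iff)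
  ultimately show ?thesis
    using category_dom_cod[OF D(1)] by (auto simp: doc_mors_def doc_id_def)
qed

lemma doc_comp1_mor:
  assumes P: "is_doctrine P" and m: "m \<in> doc_mors P Q" and n: "n \<in> doc_mors Q R"
  shows "doc_comp1 P n m \<in> doc_mors P R"
proof -
  note D = doctrineD[OF P] and M = doc_morsD[OF m] and N = doc_morsD[OF n]
  note MF = is_functorD[OF M(1)] and NF = is_functorD[OF N(1)]
  have 1: "is_functor (base P) (base R) (ftr (doc_comp1 P n m))"
  proof (rule is_functorI)
    show "farr (ftr (doc_comp1 P n m)) (Cmp (base P) g f) =
        Cmp (base R) (farr (ftr (doc_comp1 P n m)) g) (farr (ftr (doc_comp1 P n m)) f)"
      if "g \<in> homs (base P) b c" "f \<in> homs (base P) a b" for f g a b c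
      using category_cmp[OF D(1) that] that MF(6)[OF that] NF(6)[OF MF(4)[OF that(1)] MF(4)[OF that(2)]]
      by (auto simp: doc_comp1_def homs_iff)
    show "farr (ftr (doc_comp1 P n m)) f
        \<in> homs (base R) (fobj (ftr (doc_comp1 P n m)) a) (fobj (ftr (doc_comp1 P n m)) b)"
      if "f \<in> homs (base P) a b" for f a b
      using category_obj[OF D(1) that] that NF(4)[OF MF(4)[OF that]]
      by (auto simp: doc_comp1_def homs_iff)
    show "farr (ftr (doc_comp1 P n m)) (Ident (base P) a) =
        Ident (base R) (fobj (ftr (doc_comp1 P n m)) a)"
      if "a \<in> Obj (base P)" for a
      using category_ident[OF D(1) that] that MF(5)[OF that] NF(5)[OF MF(3)[OF that]]
      by (auto simp: doc_comp1_def homs_iff)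
  qed (use MF NF in \<open>auto simp: doc_comp1_def\<close>)
  have 2: "preserves_finite_products (base P) (base R) (ftr (doc_comp1 P n m))"
    unfolding preserves_finite_products_def
  proof (intro conjI allI impI)
    fix t assume "is_terminal (base P) t"
    then show "is_terminal (base R) (fobj (ftr (doc_comp1 P n m)) t)"
      using M(2) N(2)
      by (auto simp: preserves_finite_products_def doc_comp1_def) (auto simp: is_terminal_def)
  next
    fix a b p p1 p2 assume p: "is_product (base P) a b p p1 p2"
    then have "p1 \<in> homs (base P) p a" "p2 \<in> homs (base P) p b"
      by (auto simp: is_product_def)
    moreover from this have "a \<in> Obj (base P)" "b \<in> Obj (base P)" "p \<in> Obj (base P)"
      using category_obj[OF D(1)] by blast+
    ultimately show "is_product (base R) (fobj (ftr (doc_comp1 P n m)) a)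
        (fobj (ftr (doc_comp1 P n m)) b) (fobj (ftr (doc_comp1 P n m)) p)
        (farr (ftr (doc_comp1 P n m)) p1) (farr (ftr (doc_comp1 P n m)) p2)"
      using M(2) N(2) p by (auto simp: preserves_finite_products_def doc_comp1_def homs_iff)
  qed
  have 3: "is_frame_hom (fib P c) (fib R (fobj (ftr (doc_comp1 P n m)) c)) (fibmap (doc_comp1 P n m) c)"
    if "c \<in> Obj (base P)" for c
    using frame_hom_comp[OF M(3)[OF that] N(3)[OF MF(3)[OF that]] D(3)[OF that]] that
    by (simp add: doc_comp1_def)
  have 4: "fibmap (doc_comp1 P n m) (Dom (base P) f) (reindex P f x) =
      reindex R (farr (ftr (doc_comp1 P n m)) f) (fibmap (doc_comp1 P n m) (Cod (base P) f) x)"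
    if f: "f \<in> Arr (base P)" and x: "x \<in> carrier (fib P (Cod (base P) f))" for f x
  proof -
    have h: "f \<in> homs (base P) (Dom (base P) f) (Cod (base P) f)"
      using f by (simp add: homs_iff)
    note o = category_obj[OF D(1) h]
    show ?thesis
      using M(4)[OF h x] N(4)[OF MF(4)[OF h] frame_hom_closed[OF M(3)[OF o(2)] x]]
        frame_hom_closed[OF D(4)[OF h] x] o f x
      by (simp add: doc_comp1_def)
  qed
  show ?thesis
    using 1 2 3 4 by (auto simp: doc_mors_def) (auto simp: doc_comp1_def)
qed

lemma doc_comp1_id:
  assumes P: "is_doctrine P" and m: "m \<in> doc_mors P Q" and Q: "is_doctrine Q"
  shows "doc_comp1 P m (doc_id P) = m" "doc_comp1 P (doc_id Q) m = m"
proof -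
  show "doc_comp1 P m (doc_id P) = m"
    by (rule doc_mor_eqI[OF doc_comp1_mor[OF P doc_id_mor[OF P] m] m])
      (auto simp: doc_comp1_def doc_id_def)
  show "doc_comp1 P (doc_id Q) m = m"
    using is_functorD(3,4)[OF doc_morsD(1)[OF m]] doc_mors_fibmap_closed[OF m]
    by (intro doc_mor_eqI[OF doc_comp1_mor[OF P m doc_id_mor[OF Q]] m])
      (auto simp: doc_comp1_def doc_id_def homs_iff)
qed

lemma doc_comp1_assoc:
  assumes m: "m \<in> doc_mors P Q" and n: "n \<in> doc_mors Q R"
  shows "doc_comp1 P k (doc_comp1 P n m) = doc_comp1 P (doc_comp1 Q k n) m"
  using is_functorD(3,4)[OF doc_morsD(1)[OF m]] doc_mors_fibmap_closed[OF m]
  by (auto simp: doc_comp1_def fun_eq_iff restrict_def homs_iff)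

lemma doc_2cellD:
  assumes "is_doc_2cell P Q t"
  shows "c \<in> Obj (base P) \<Longrightarrow>
      nat_tr t c \<in> homs (base Q) (fobj (ftr (source1 t)) c) (fobj (ftr (target1 t)) c)"
    and "f \<in> homs (base P) a b \<Longrightarrow> Cmp (base Q) (nat_tr t b) (farr (ftr (source1 t)) f) =
      Cmp (base Q) (farr (ftr (target1 t)) f) (nat_tr t a)"
    and "c \<in> Obj (base P) \<Longrightarrow> x \<in> carrier (fib P c) \<Longrightarrow> fibmap (source1 t) c x
      \<sqsubseteq>\<^bsub>fib Q (fobj (ftr (source1 t)) c)\<^esub> reindex Q (nat_tr t c) (fibmap (target1 t) c x)"
    and "nat_tr t \<in> extensional (Obj (base P))"
  using assms by (auto simp: is_doc_2cell_def is_nat_trans_def homs_iff)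

lemma doc_2cellI:
  assumes "source1 t \<in> doc_mors P Q" "target1 t \<in> doc_mors P Q"
    and "\<And>c. c \<in> Obj (base P) \<Longrightarrow>
      nat_tr t c \<in> homs (base Q) (fobj (ftr (source1 t)) c) (fobj (ftr (target1 t)) c)"
    and "\<And>f a b. f \<in> homs (base P) a b \<Longrightarrow> Cmp (base Q) (nat_tr t b) (farr (ftr (source1 t)) f) =
      Cmp (base Q) (farr (ftr (target1 t)) f) (nat_tr t a)"
    and "\<And>c x. c \<in> Obj (base P) \<Longrightarrow> x \<in> carrier (fib P c) \<Longrightarrow> fibmap (source1 t) c x
      \<sqsubseteq>\<^bsub>fib Q (fobj (ftr (source1 t)) c)\<^esub> reindex Q (nat_tr t c) (fibmap (target1 t) c x)"
    and "nat_tr t \<in> extensional (Obj (base P))"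
  shows "is_doc_2cell P Q t"
  using assms doc_morsD(1) by (auto simp: is_doc_2cell_def is_nat_trans_def homs_iff)

lemma doc_2cell_eqI:
  fixes s t :: "('o, 'm, 'p) doc_2cell"
  assumes "is_doc_2cell P Q s" "is_doc_2cell P Q' t" "source1 s = source1 t" "target1 s = target1 t"
    and "\<And>c. c \<in> Obj (base P) \<Longrightarrow> nat_tr s c = nat_tr t c"
  shows "s = t"
proof -
  have "nat_tr s = nat_tr t"
    using assms doc_2cellD(4) by (intro extensionalityI[of _ "Obj (base P)"]) blast+
  then show ?thesis
    using assms by simp
qed

lemma doc_hom_simps [simp]:
  "Obj (doc_hom P Q M) = M" "Dom (doc_hom P Q M) = source1" "Cod (doc_hom P Q M) = target1"
  "t \<in> Arr (doc_hom P Q M) \<longleftrightarrow> source1 t \<in> M \<and> target1 t \<in> M \<and> is_doc_2cell P Q t"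
  by (auto simp: doc_hom_def)

lemma doc_hom_ident:
  "source1 (Ident (doc_hom P Q M) m) = m" "target1 (Ident (doc_hom P Q M) m) = m"
  "nat_tr (Ident (doc_hom P Q M) m) = (\<lambda>c \<in> Obj (base P). Ident (base Q) (fobj (ftr m) c))"
  by (auto simp: doc_hom_def)

lemma doc_hom_cmp:
  "source1 (Cmp (doc_hom P Q M) t s) = source1 s" "target1 (Cmp (doc_hom P Q M) t s) = target1 t"
  "nat_tr (Cmp (doc_hom P Q M) t s) = (\<lambda>c \<in> Obj (base P). Cmp (base Q) (nat_tr t c) (nat_tr s c))"
  by (auto simp: doc_hom_def)

lemma doc_ident_2cell:
  assumes Q: "is_doctrine Q" and m: "m \<in> doc_mors P Q"
  shows "is_doc_2cell P Q (Ident (doc_hom P Q M) m)"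
proof -
  note F = is_functorD[OF doc_morsD(1)[OF m]] and QD = doctrineD[OF Q]
  show ?thesis
  proof (rule doc_2cellI)
    show "Cmp (base Q) (nat_tr (Ident (doc_hom P Q M) m) b)
        (farr (ftr (source1 (Ident (doc_hom P Q M) m))) f) =
      Cmp (base Q) (farr (ftr (target1 (Ident (doc_hom P Q M) m))) f)
        (nat_tr (Ident (doc_hom P Q M) m) a)" if "f \<in> homs (base P) a b" for f a b
      using category_cmp_ident[OF F(2) F(4)[OF that]] category_obj[OF F(1) that]
      by (simp add: doc_hom_ident)
    show "fibmap (source1 (Ident (doc_hom P Q M) m)) c x
        \<sqsubseteq>\<^bsub>fib Q (fobj (ftr (source1 (Ident (doc_hom P Q M) m))) c)\<^esub>
        reindex Q (nat_tr (Ident (doc_hom P Q M) m) c) (fibmap (target1 (Ident (doc_hom P Q M) m)) c x)"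
      if "c \<in> Obj (base P)" "x \<in> carrier (fib P c)" for c x
      using frame_refl[OF QD(3)[OF F(3)[OF that(1)]] doc_mors_fibmap_closed[OF m that]]
        QD(5)[OF F(3)[OF that(1)] doc_mors_fibmap_closed[OF m that]] that
      by (simp add: doc_hom_ident)
  qed (use m F(3) category_ident[OF F(2)] in \<open>auto simp: doc_hom_ident\<close>)
qed

text \<open>The inequalities compose as \<open>\<alpha> \<le> s\<^sup>* \<beta> \<le> s\<^sup>*
  (t\<^sup>* \<gamma>)\<close>, by monotonicity of reindexing, and functoriality of reindexing
  identifies the last term with the pullback along the composite.\<close>

lemma doc_cmp_2cell:
  assumes Q: "is_doctrine Q" and s: "is_doc_2cell P Q s" and t: "is_doc_2cell P Q t"
    and m: "source1 s \<in> doc_mors P Q" "target1 s \<in> doc_mors P Q" "target1 t \<in> doc_mors P Q"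
    and e: "source1 t = target1 s"
  shows "is_doc_2cell P Q (Cmp (doc_hom P Q M) t s)"
proof -
  note S = doc_2cellD[OF s] and T = doc_2cellD[OF t] and QD = doctrineD[OF Q]
  note F = is_functorD[OF doc_morsD(1)[OF m(1)]] and G = is_functorD[OF doc_morsD(1)[OF m(2)]]
    and H = is_functorD[OF doc_morsD(1)[OF m(3)]]
  show ?thesis
  proof (rule doc_2cellI; (unfold doc_hom_cmp)?)
    fix f a b assume f: "f \<in> homs (base P) a b"
    note o = category_obj[OF F(1) f]
    note sa = S(1)[OF o(1)] and sb = S(1)[OF o(2)] and ta = T(1)[OF o(1), unfolded e]
      and tb = T(1)[OF o(2), unfolded e]
    have "Cmp (base Q) (Cmp (base Q) (nat_tr t b) (nat_tr s b)) (farr (ftr (source1 s)) f)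
      = Cmp (base Q) (nat_tr t b) (Cmp (base Q) (farr (ftr (target1 s)) f) (nat_tr s a))"
      using category_assoc[OF F(2) tb sb F(4)[OF f]] S(2)[OF f] by simp
    also have "\<dots> = Cmp (base Q) (Cmp (base Q) (farr (ftr (target1 t)) f) (nat_tr t a)) (nat_tr s a)"
      using category_assoc[OF F(2) tb G(4)[OF f] sa] T(2)[OF f] e by simp
    also have "\<dots> = Cmp (base Q) (farr (ftr (target1 t)) f) (Cmp (base Q) (nat_tr t a) (nat_tr s a))"
      using category_assoc[OF F(2) H(4)[OF f] ta sa] by simp
    finally show "Cmp (base Q) ((\<lambda>c \<in> Obj (base P). Cmp (base Q) (nat_tr t c) (nat_tr s c)) b)
        (farr (ftr (source1 s)) f) = Cmp (base Q) (farr (ftr (target1 t)) f)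
        ((\<lambda>c \<in> Obj (base P). Cmp (base Q) (nat_tr t c) (nat_tr s c)) a)"
      using o by simp
  next
    fix c x assume c: "c \<in> Obj (base P)" and x: "x \<in> carrier (fib P c)"
    note sc = S(1)[OF c] and tc = T(1)[OF c, unfolded e]
    note mx = doc_mors_fibmap_closed[OF m(1) c x] doc_mors_fibmap_closed[OF m(2) c x]
      doc_mors_fibmap_closed[OF m(3) c x]
    have tx: "reindex Q (nat_tr t c) (fibmap (target1 t) c x) \<in> carrier (fib Q (fobj (ftr (target1 s)) c))"
      using frame_hom_closed[OF QD(4)[OF tc] mx(3)] .
    have "reindex Q (nat_tr s c) (fibmap (target1 s) c x) \<sqsubseteq>\<^bsub>fib Q (fobj (ftr (source1 s)) c)\<^esub>
        reindex Q (nat_tr s c) (reindex Q (nat_tr t c) (fibmap (target1 t) c x))"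
      using frame_hom_mono[OF QD(4)[OF sc] mx(2) tx] T(3)[OF c x] e by simp
    then show "fibmap (source1 s) c x \<sqsubseteq>\<^bsub>fib Q (fobj (ftr (source1 s)) c)\<^esub>
        reindex Q ((\<lambda>c \<in> Obj (base P). Cmp (base Q) (nat_tr t c) (nat_tr s c)) c) (fibmap (target1 t) c x)"
      using frame_trans[OF QD(3)[OF F(3)[OF c]] S(3)[OF c x]] mx(1) frame_hom_closed[OF QD(4)[OF sc]]
        mx(2) tx QD(6)[OF tc sc mx(3)] c by simp
  next
    fix c assume c: "c \<in> Obj (base P)"
    show "(\<lambda>c \<in> Obj (base P). Cmp (base Q) (nat_tr t c) (nat_tr s c)) c
        \<in> homs (base Q) (fobj (ftr (source1 s)) c) (fobj (ftr (target1 t)) c)"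
      using category_cmp[OF F(2) T(1)[OF c, unfolded e] S(1)[OF c]] c by simp
  qed (use m in auto)
qed

lemma doc_hom_category:
  assumes Q: "is_doctrine Q" and M: "M \<subseteq> doc_mors P Q"
  shows "is_category (doc_hom P Q M)"
  unfolding is_category_def
proof (intro conjI ballI impI)
  have C: "is_category (base Q)"
    using Q by (rule doctrineD)
  show "Ident (doc_hom P Q M) a \<in> homs (doc_hom P Q M) a a" if "a \<in> Obj (doc_hom P Q M)" for a
    using that M doc_ident_2cell[OF Q] by (auto simp: homs_iff doc_hom_ident)
  show cmp: "Cmp (doc_hom P Q M) g f \<in> homs (doc_hom P Q M) (Dom (doc_hom P Q M) f) (Cod (doc_hom P Q M) g)"
    if "f \<in> Arr (doc_hom P Q M)" "g \<in> Arr (doc_hom P Q M)" "Dom (doc_hom P Q M) g = Cod (doc_hom P Q M) f"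
    for f g
    using that M doc_cmp_2cell[OF Q, of P f g M] by (auto simp: homs_iff doc_hom_cmp)
  fix f assume f: "f \<in> Arr (doc_hom P Q M)"
  then have f': "is_doc_2cell P Q f"
    by simp
  note i = category_cmp_ident[OF C doc_2cellD(1)[OF f']]
  show "Cmp (doc_hom P Q M) f (Ident (doc_hom P Q M) (Dom (doc_hom P Q M) f)) = f"
    using f M i doc_ident_2cell[OF Q]
    by (intro doc_2cell_eqI[OF doc_cmp_2cell[OF Q] f']) (auto simp: doc_hom_cmp doc_hom_ident)
  show "Cmp (doc_hom P Q M) (Ident (doc_hom P Q M) (Cod (doc_hom P Q M) f)) f = f"
    using f M i doc_ident_2cell[OF Q]
    by (intro doc_2cell_eqI[OF doc_cmp_2cell[OF Q] f']) (auto simp: doc_hom_cmp doc_hom_ident)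
  fix g h assume g: "g \<in> Arr (doc_hom P Q M)" and h: "h \<in> Arr (doc_hom P Q M)"
    and e: "Dom (doc_hom P Q M) g = Cod (doc_hom P Q M) f \<and> Dom (doc_hom P Q M) h = Cod (doc_hom P Q M) g"
  have "Cmp (base Q) (nat_tr h c) (Cmp (base Q) (nat_tr g c) (nat_tr f c)) =
      Cmp (base Q) (Cmp (base Q) (nat_tr h c) (nat_tr g c)) (nat_tr f c)" if "c \<in> Obj (base P)" for c
    using category_assoc[OF C] doc_2cellD(1)[of P Q f, OF _ that] doc_2cellD(1)[of P Q g, OF _ that]
      doc_2cellD(1)[of P Q h, OF _ that] f g h e by auto
  then show "Cmp (doc_hom P Q M) h (Cmp (doc_hom P Q M) g f) =
      Cmp (doc_hom P Q M) (Cmp (doc_hom P Q M) h g) f"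
    by (auto simp: doc_hom_def fun_eq_iff restrict_def)
qed auto

section \<open>Horizontal composition and the 2-categories of doctrines\<close>

lemma doc_comp2_simps:
  "source1 (doc_comp2 P R t s) = doc_comp1 P (source1 t) (source1 s)"
  "target1 (doc_comp2 P R t s) = doc_comp1 P (target1 t) (target1 s)"
  "nat_tr (doc_comp2 P R t s) = (\<lambda>c \<in> Obj (base P).
     Cmp (base R) (nat_tr t (fobj (ftr (target1 s)) c)) (farr (ftr (source1 t)) (nat_tr s c)))"
  by (simp_all add: doc_comp2_def)

lemma doc_comp1_simps:
  "c \<in> Obj (base P) \<Longrightarrow> fobj (ftr (doc_comp1 P n m)) c = fobj (ftr n) (fobj (ftr m) c)"
  "f \<in> Arr (base P) \<Longrightarrow> farr (ftr (doc_comp1 P n m)) f = farr (ftr n) (farr (ftr m) f)"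
  "c \<in> Obj (base P) \<Longrightarrow> x \<in> carrier (fib P c) \<Longrightarrow>
   fibmap (doc_comp1 P n m) c x = fibmap n (fobj (ftr m) c) (fibmap m c x)"
  by (simp_all add: doc_comp1_def)

text \<open>Naturality pastes the square of \<open>s\<close>, transported by the functor of
  \<open>source1 t\<close>, with a square of \<open>t\<close>. The inequality has two links: the
  fibre maps of \<open>source1 t\<close> are monotone and natural along the components of
  \<open>s\<close>; then the inequality of \<open>t\<close> is pulled back along the images of these
  components.\<close>

lemma doc_comp2_2cell:
  assumes P: "is_doctrine P" and Q: "is_doctrine Q" and R: "is_doctrine R"
    and s: "is_doc_2cell P Q s" "source1 s \<in> doc_mors P Q" "target1 s \<in> doc_mors P Q"
    and t: "is_doc_2cell Q R t" "source1 t \<in> doc_mors Q R" "target1 t \<in> doc_mors Q R"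
  shows "is_doc_2cell P R (doc_comp2 P R t s)"
proof -
  note S = doc_2cellD[OF s(1)] and T = doc_2cellD[OF t(1)] and QD = doctrineD[OF Q]
    and RD = doctrineD[OF R] and PC = doctrineD(1)[OF P]
  note F = is_functorD[OF doc_morsD(1)[OF s(2)]] and G = is_functorD[OF doc_morsD(1)[OF s(3)]]
    and H = is_functorD[OF doc_morsD(1)[OF t(2)]] and K = is_functorD[OF doc_morsD(1)[OF t(3)]]
  show ?thesis
  proof (rule doc_2cellI; (unfold doc_comp2_simps)?)
    fix f a b assume f: "f \<in> homs (base P) a b"
    note o = category_obj[OF F(1) f]
    note sa = S(1)[OF o(1)] and sb = S(1)[OF o(2)] and ta = T(1)[OF G(3)[OF o(1)]]
      and tb = T(1)[OF G(3)[OF o(2)]]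
    let ?n = "farr (ftr (source1 t))"
    have "Cmp (base R) (Cmp (base R) (nat_tr t (fobj (ftr (target1 s)) b)) (?n (nat_tr s b)))
        (?n (farr (ftr (source1 s)) f)) =
      Cmp (base R) (nat_tr t (fobj (ftr (target1 s)) b))
        (?n (Cmp (base Q) (farr (ftr (target1 s)) f) (nat_tr s a)))"
      using category_assoc[OF RD(1) tb H(4)[OF sb] H(4)[OF F(4)[OF f]]] S(2)[OF f]
        H(6)[OF sb F(4)[OF f]] by simp
    also have "\<dots> = Cmp (base R) (Cmp (base R) (nat_tr t (fobj (ftr (target1 s)) b))
        (?n (farr (ftr (target1 s)) f))) (?n (nat_tr s a))"
      using category_assoc[OF RD(1) tb H(4)[OF G(4)[OF f]] H(4)[OF sa]] H(6)[OF G(4)[OF f] sa] by simp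
    also have "\<dots> = Cmp (base R) (farr (ftr (target1 t)) (farr (ftr (target1 s)) f))
        (Cmp (base R) (nat_tr t (fobj (ftr (target1 s)) a)) (?n (nat_tr s a)))"
      using category_assoc[OF RD(1) K(4)[OF G(4)[OF f]] ta H(4)[OF sa]] T(2)[OF G(4)[OF f]] by simp
    finally show "Cmp (base R) ((\<lambda>c \<in> Obj (base P). Cmp (base R) (nat_tr t (fobj (ftr (target1 s)) c))
          (?n (nat_tr s c))) b) (farr (ftr (doc_comp1 P (source1 t) (source1 s))) f) =
      Cmp (base R) (farr (ftr (doc_comp1 P (target1 t) (target1 s))) f)
        ((\<lambda>c \<in> Obj (base P). Cmp (base R) (nat_tr t (fobj (ftr (target1 s)) c)) (?n (nat_tr s c))) a)"
      using o f by (simp add: doc_comp1_simps homs_iff)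
  next
    fix c x assume c: "c \<in> Obj (base P)" and x: "x \<in> carrier (fib P c)"
    let ?n = "source1 t" and ?n' = "target1 t" and ?m = "source1 s" and ?m' = "target1 s"
    let ?L = "fib R (fobj (ftr ?n) (fobj (ftr ?m) c))"
    note sc = S(1)[OF c] and tc = T(1)[OF G(3)[OF c]]
    note mx = doc_mors_fibmap_closed[OF s(2) c x] and mx' = doc_mors_fibmap_closed[OF s(3) c x]
    note ih = frame_hom_closed
    note L = RD(3)[OF H(3)[OF F(3)[OF c]]]
    note nh = doc_morsD(3)[OF t(2) F(3)[OF c]] and rh = RD(4)[OF H(4)[OF sc]]
    note n1 = doc_mors_fibmap_closed[OF t(2) F(3)[OF c] mx]
      and n2 = doc_mors_fibmap_closed[OF t(2) G(3)[OF c] mx']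
      and n3 = doc_mors_fibmap_closed[OF t(3) G(3)[OF c] mx']
    note rs = ih[OF QD(4)[OF sc] mx'] and rt = ih[OF RD(4)[OF tc] n3]
    have 1: "fibmap ?n (fobj (ftr ?m) c) (fibmap ?m c x) \<sqsubseteq>\<^bsub>?L\<^esub>
        reindex R (farr (ftr ?n) (nat_tr s c)) (fibmap ?n (fobj (ftr ?m') c) (fibmap ?m' c x))"
      using frame_hom_mono[OF nh mx rs S(3)[OF c x]] doc_morsD(4)[OF t(2) sc mx'] by simp
    have 2: "reindex R (farr (ftr ?n) (nat_tr s c)) (fibmap ?n (fobj (ftr ?m') c) (fibmap ?m' c x)) \<sqsubseteq>\<^bsub>?L\<^esub>
        reindex R (farr (ftr ?n) (nat_tr s c)) (reindex R (nat_tr t (fobj (ftr ?m') c))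
          (fibmap ?n' (fobj (ftr ?m') c) (fibmap ?m' c x)))"
      using frame_hom_mono[OF rh n2 rt T(3)[OF G(3)[OF c] mx']] .
    have "fibmap ?n (fobj (ftr ?m) c) (fibmap ?m c x) \<sqsubseteq>\<^bsub>?L\<^esub>
        reindex R (Cmp (base R) (nat_tr t (fobj (ftr ?m') c)) (farr (ftr ?n) (nat_tr s c)))
          (fibmap ?n' (fobj (ftr ?m') c) (fibmap ?m' c x))"
      using frame_trans[OF L 1 2 n1 ih[OF rh n2] ih[OF rh rt]] RD(6)[OF tc H(4)[OF sc] n3] by simp
    then show "fibmap (doc_comp1 P ?n ?m) c x \<sqsubseteq>\<^bsub>fib R (fobj (ftr (doc_comp1 P ?n ?m)) c)\<^esub>
        reindex R ((\<lambda>c \<in> Obj (base P). Cmp (base R) (nat_tr t (fobj (ftr ?m') c))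
          (farr (ftr ?n) (nat_tr s c))) c) (fibmap (doc_comp1 P ?n' ?m') c x)"
      using c x by (simp add: doc_comp1_simps)
  next
    fix c assume c: "c \<in> Obj (base P)"
    show "(\<lambda>c \<in> Obj (base P). Cmp (base R) (nat_tr t (fobj (ftr (target1 s)) c))
        (farr (ftr (source1 t)) (nat_tr s c))) c
      \<in> homs (base R) (fobj (ftr (doc_comp1 P (source1 t) (source1 s))) c)
        (fobj (ftr (doc_comp1 P (target1 t) (target1 s))) c)"
      using category_cmp[OF RD(1) T(1)[OF G(3)[OF c]] H(4)[OF S(1)[OF c]]] c
      by (simp add: doc_comp1_simps)
  qed (use doc_comp1_mor[OF P s(2) t(2)] doc_comp1_mor[OF P s(3) t(3)] in auto)
qed

lemma doc_comp2_functor: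
  assumes P: "is_doctrine P" and Q: "is_doctrine Q" and R: "is_doctrine R"
    and M: "M \<subseteq> doc_mors P Q" and N: "N \<subseteq> doc_mors Q R" and K: "K \<subseteq> doc_mors P R"
    and closed: "\<And>m n. m \<in> M \<Longrightarrow> n \<in> N \<Longrightarrow> doc_comp1 P n m \<in> K"
  shows "is_functor (prod_category (doc_hom Q R N) (doc_hom P Q M)) (doc_hom P R K)
    \<lparr>fobj = (\<lambda>(n, m). doc_comp1 P n m), farr = (\<lambda>(t, s). doc_comp2 P R t s)\<rparr>"
proof -
  note RC = doctrineD(1)[OF R]
  have prod: "is_category (prod_category C D)" if "is_category C" "is_category D" for C D
    using that unfolding is_category_def prod_category_def homs_def by (auto simp: Pi_iff)
  have cell: "is_doc_2cell P R (doc_comp2 P R t s)"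
    if "s \<in> Arr (doc_hom P Q M)" "t \<in> Arr (doc_hom Q R N)" for s t
    using that M N by (intro doc_comp2_2cell[OF P Q R]) auto
  have id: "doc_comp2 P R (Ident (doc_hom Q R N) n) (Ident (doc_hom P Q M) m) =
      Ident (doc_hom P R K) (doc_comp1 P n m)" if "n \<in> N" "m \<in> M" for n m
  proof -
    have nm: "n \<in> doc_mors Q R" "m \<in> doc_mors P Q"
      using that M N by auto
    note F = is_functorD[OF doc_morsD(1)[OF nm(1)]] and G = is_functorD[OF doc_morsD(1)[OF nm(2)]]
    show ?thesis
    proof (rule doc_2cell_eqI)
      show "is_doc_2cell P R (doc_comp2 P R (Ident (doc_hom Q R N) n) (Ident (doc_hom P Q M) m))"
        using that nm doc_ident_2cell[OF Q] doc_ident_2cell[OF R] by (intro cell) (auto simp: doc_hom_ident)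
      show "is_doc_2cell P R (Ident (doc_hom P R K) (doc_comp1 P n m))"
        by (rule doc_ident_2cell[OF R doc_comp1_mor[OF P nm(2,1)]])
      fix c assume c: "c \<in> Obj (base P)"
      show "nat_tr (doc_comp2 P R (Ident (doc_hom Q R N) n) (Ident (doc_hom P Q M) m)) c =
          nat_tr (Ident (doc_hom P R K) (doc_comp1 P n m)) c"
        using c G(3)[OF c] F(5)[OF G(3)[OF c]]
          category_cmp_ident[OF RC category_ident[OF RC F(3)[OF G(3)[OF c]]]]
        by (simp add: doc_comp2_simps doc_hom_ident doc_comp1_simps)
    qed (simp_all add: doc_comp2_simps doc_hom_ident)
  qed
  have cmp: "doc_comp2 P R (Cmp (doc_hom Q R N) t' t) (Cmp (doc_hom P Q M) s' s) =
      Cmp (doc_hom P R K) (doc_comp2 P R t' s') (doc_comp2 P R t s)"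
    if "s \<in> Arr (doc_hom P Q M)" "s' \<in> Arr (doc_hom P Q M)" "source1 s' = target1 s"
      "t \<in> Arr (doc_hom Q R N)" "t' \<in> Arr (doc_hom Q R N)" "source1 t' = target1 t" for s s' t t'
  proof (rule doc_2cell_eqI)
    have s: "is_doc_2cell P Q s" "source1 s \<in> doc_mors P Q" "target1 s \<in> doc_mors P Q"
      and s': "is_doc_2cell P Q s'" "target1 s' \<in> doc_mors P Q"
      and t: "is_doc_2cell Q R t" "source1 t \<in> doc_mors Q R" "target1 t \<in> doc_mors Q R"
      and t': "is_doc_2cell Q R t'" "target1 t' \<in> doc_mors Q R"
      using that M N by auto
    show "is_doc_2cell P R (doc_comp2 P R (Cmp (doc_hom Q R N) t' t) (Cmp (doc_hom P Q M) s' s))"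
      using that s t s' t' doc_cmp_2cell[OF Q] doc_cmp_2cell[OF R]
      by (intro cell) (auto simp: doc_hom_cmp)
    show "is_doc_2cell P R (Cmp (doc_hom P R K) (doc_comp2 P R t' s') (doc_comp2 P R t s))"
      using that s t s' t' cell doc_comp1_mor[OF P]
      by (intro doc_cmp_2cell[OF R]) (auto simp: doc_comp2_simps)
    fix c assume c: "c \<in> Obj (base P)"
    note F = is_functorD[OF doc_morsD(1)[OF s(2)]] and G = is_functorD[OF doc_morsD(1)[OF s(3)]]
      and G' = is_functorD[OF doc_morsD(1)[OF s'(2)]]
      and H = is_functorD[OF doc_morsD(1)[OF t(2)]] and H' = is_functorD[OF doc_morsD(1)[OF t(3)]]
    let ?c' = "fobj (ftr (target1 s)) c" and ?c'' = "fobj (ftr (target1 s')) c"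
    note S = doc_2cellD(1)[OF s(1) c] and S' = doc_2cellD(1)[OF s'(1) c, unfolded that]
      and T = doc_2cellD(1)[OF t(1)] and T' = doc_2cellD(1)[OF t'(1), unfolded that]
    let ?n = "farr (ftr (source1 t))" and ?n' = "farr (ftr (target1 t))"
    note c' = G(3)[OF c] and c'' = G'(3)[OF c]
    have "Cmp (base R) (Cmp (base R) (nat_tr t' ?c'') (nat_tr t ?c''))
        (?n (Cmp (base Q) (nat_tr s' c) (nat_tr s c))) =
      Cmp (base R) (nat_tr t' ?c'') (Cmp (base R) (Cmp (base R) (nat_tr t ?c'') (?n (nat_tr s' c)))
        (?n (nat_tr s c)))"
      using H(6)[OF S' S] category_assoc[OF RC T'[OF c''] T[OF c''] category_cmp[OF RC H(4)[OF S'] H(4)[OF S]]]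
        category_assoc[OF RC T[OF c''] H(4)[OF S'] H(4)[OF S]] by simp
    \<comment> \<open>Naturality of \<open>t\<close> at the component of \<open>s'\<close> is the
      exchange behind the interchange law; the surrounding steps use functoriality and associativity
      only.\<close>
    also have "Cmp (base R) (nat_tr t ?c'') (?n (nat_tr s' c)) =
        Cmp (base R) (?n' (nat_tr s' c)) (nat_tr t ?c')"
      by (rule doc_2cellD(2)[OF t(1) S'])
    also have "Cmp (base R) (nat_tr t' ?c'') (Cmp (base R) (Cmp (base R) (?n' (nat_tr s' c)) (nat_tr t ?c'))
        (?n (nat_tr s c))) =
      Cmp (base R) (Cmp (base R) (nat_tr t' ?c'') (?n' (nat_tr s' c)))
        (Cmp (base R) (nat_tr t ?c') (?n (nat_tr s c)))"
      using category_assoc[OF RC H'(4)[OF S'] T[OF c'] H(4)[OF S]]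
        category_assoc[OF RC T'[OF c''] H'(4)[OF S'] category_cmp[OF RC T[OF c'] H(4)[OF S]]] by simp
    finally show "nat_tr (doc_comp2 P R (Cmp (doc_hom Q R N) t' t) (Cmp (doc_hom P Q M) s' s)) c =
        nat_tr (Cmp (doc_hom P R K) (doc_comp2 P R t' s') (doc_comp2 P R t s)) c"
      using c c'' that by (simp add: doc_comp2_simps doc_hom_cmp)
  qed (simp_all add: doc_comp2_simps doc_hom_cmp)
  show ?thesis
  proof (rule is_functorI)
    show "is_category (prod_category (doc_hom Q R N) (doc_hom P Q M))"
      using doc_hom_category[OF Q M] doc_hom_category[OF R N] by (rule prod[rotated])
    show "is_category (doc_hom P R K)"
      by (rule doc_hom_category[OF R K])
  qed (auto simp: prod_category_def homs_iff closed doc_comp2_simps id cmp intro!: cell)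
qed

lemma doc_comp2_id:
  assumes P: "is_doctrine P" and Q: "is_doctrine Q" and s: "is_doc_2cell P Q s"
    and m: "source1 s \<in> doc_mors P Q" "target1 s \<in> doc_mors P Q"
  shows "doc_comp2 P Q s (Ident (doc_hom P P M) (doc_id P)) = s"
    and "doc_comp2 P Q (Ident (doc_hom Q Q N) (doc_id Q)) s = s"
proof -
  note S = doc_2cellD(1)[OF s] and F = is_functorD[OF doc_morsD(1)[OF m(1)]]
    and G = is_functorD[OF doc_morsD(1)[OF m(2)]]
  note dP = doc_ident_2cell[OF P doc_id_mor[OF P]] and dQ = doc_ident_2cell[OF Q doc_id_mor[OF Q]]
  note iP = category_ident[OF doctrineD(1)[OF P]]
  show "doc_comp2 P Q s (Ident (doc_hom P P M) (doc_id P)) = s"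
  proof (rule doc_2cell_eqI[OF doc_comp2_2cell[OF P P Q dP] s])
    fix c assume c: "c \<in> Obj (base P)"
    show "nat_tr (doc_comp2 P Q s (Ident (doc_hom P P M) (doc_id P))) c = nat_tr s c"
      using c F(5)[OF c] category_cmp_ident[OF F(2) S[OF c]]
      by (simp add: doc_comp2_simps doc_hom_ident) (simp add: doc_id_def)
  qed (use m s doc_id_mor[OF P] doc_comp1_id[OF P _ Q] in \<open>auto simp: doc_hom_ident doc_comp2_simps\<close>)
  show "doc_comp2 P Q (Ident (doc_hom Q Q N) (doc_id Q)) s = s"
  proof (rule doc_2cell_eqI[OF doc_comp2_2cell[OF P Q Q s m dQ] s])
    fix c assume c: "c \<in> Obj (base P)"
    show "nat_tr (doc_comp2 P Q (Ident (doc_hom Q Q N) (doc_id Q)) s) c = nat_tr s c"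
      using c G(3)[OF c] S[OF c] category_cmp_ident[OF F(2) S[OF c]]
      by (simp add: doc_comp2_simps doc_hom_ident) (simp add: doc_id_def homs_iff)
  qed (use m s doc_id_mor[OF Q] doc_comp1_id[OF P _ Q] in \<open>auto simp: doc_hom_ident doc_comp2_simps\<close>)
qed

lemma doc_comp2_assoc:
  assumes P: "is_doctrine P" and Q: "is_doctrine Q" and R: "is_doctrine R" and W: "is_doctrine W"
    and r: "is_doc_2cell P Q r" "source1 r \<in> doc_mors P Q" "target1 r \<in> doc_mors P Q"
    and s: "is_doc_2cell Q R s" "source1 s \<in> doc_mors Q R" "target1 s \<in> doc_mors Q R"
    and t: "is_doc_2cell R W t" "source1 t \<in> doc_mors R W" "target1 t \<in> doc_mors R W"
  shows "doc_comp2 P W t (doc_comp2 P R s r) = doc_comp2 P W (doc_comp2 Q W t s) r"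
proof -
  note F = is_functorD[OF doc_morsD(1)[OF r(3)]] and G = is_functorD[OF doc_morsD(1)[OF s(2)]]
    and G' = is_functorD[OF doc_morsD(1)[OF s(3)]] and H = is_functorD[OF doc_morsD(1)[OF t(2)]]
  have "Cmp (base W) (nat_tr t (fobj (ftr (target1 s)) (fobj (ftr (target1 r)) c)))
      (farr (ftr (source1 t)) (Cmp (base R) (nat_tr s (fobj (ftr (target1 r)) c))
        (farr (ftr (source1 s)) (nat_tr r c)))) =
    Cmp (base W) (Cmp (base W) (nat_tr t (fobj (ftr (target1 s)) (fobj (ftr (target1 r)) c)))
      (farr (ftr (source1 t)) (nat_tr s (fobj (ftr (target1 r)) c))))
      (farr (ftr (source1 t)) (farr (ftr (source1 s)) (nat_tr r c)))"
    if c: "c \<in> Obj (base P)" for c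
  proof -
    note rc = doc_2cellD(1)[OF r(1) c]
    note sc = doc_2cellD(1)[OF s(1) F(3)[OF c]]
    note tc = doc_2cellD(1)[OF t(1) G'(3)[OF F(3)[OF c]]]
    show ?thesis
      using H(6)[OF sc G(4)[OF rc]] category_assoc[OF H(2) tc H(4)[OF sc] H(4)[OF G(4)[OF rc]]] by simp
  qed
  moreover have "nat_tr r c \<in> Arr (base Q)" if "c \<in> Obj (base P)" for c
    using doc_2cellD(1)[OF r(1) that] by (simp add: homs_iff)
  ultimately show ?thesis
    using F(3)
    by (auto simp: doc_comp2_def doc_comp1_assoc[OF r(2) s(2)] doc_comp1_assoc[OF r(3) s(3)]
        doc_comp1_simps fun_eq_iff restrict_def)
qed

text \<open>\<open>Mor\<close> is a parameter so that \<open>Doc\<close> and \<open>ExDoc\<close>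
  are both instances: they differ in their objects and 1-cells, while a 2-cell carries no condition
  about existentials.\<close>

lemma doc_two_category:
  assumes K: "\<And>P. P \<in> K \<Longrightarrow> is_doctrine P"
    and Mor: "\<And>P Q. P \<in> K \<Longrightarrow> Q \<in> K \<Longrightarrow> Mor P Q \<subseteq> doc_mors P Q"
    and id: "\<And>P. P \<in> K \<Longrightarrow> doc_id P \<in> Mor P P"
    and cmp: "\<And>P Q R m n. P \<in> K \<Longrightarrow> Q \<in> K \<Longrightarrow> R \<in> K \<Longrightarrow> m \<in> Mor P Q \<Longrightarrow> n \<in> Mor Q R \<Longrightarrow>
      doc_comp1 P n m \<in> Mor P R"
  shows "is_two_category \<lparr>Cell0 = K, Hom2 = (\<lambda>P Q. doc_hom P Q (Mor P Q)), Id1 = doc_id,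
    Comp2 = (\<lambda>P Q R. \<lparr>fobj = (\<lambda>(n, m). doc_comp1 P n m), farr = (\<lambda>(t, s). doc_comp2 P R t s)\<rparr>)\<rparr>"
proof -
  have mor: "m \<in> doc_mors P Q" if "P \<in> K" "Q \<in> K" "m \<in> Mor P Q" for P Q m
    using Mor that by blast
  show ?thesis
    unfolding is_two_category_def two_category.simps
  proof (intro conjI ballI)
    show "is_category (doc_hom P Q (Mor P Q))" if "P \<in> K" "Q \<in> K" for P Q
      using that by (intro doc_hom_category K Mor)
    show "is_functor (prod_category (doc_hom Q R (Mor Q R)) (doc_hom P Q (Mor P Q)))
        (doc_hom P R (Mor P R))
        \<lparr>fobj = (\<lambda>(n, m). doc_comp1 P n m), farr = (\<lambda>(t, s). doc_comp2 P R t s)\<rparr>"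
      if "P \<in> K" "Q \<in> K" "R \<in> K" for P Q R
      using that by (intro doc_comp2_functor[of P Q R] K Mor cmp)
    show "fobj \<lparr>fobj = (\<lambda>(n, m). doc_comp1 P n m), farr = (\<lambda>(t, s). doc_comp2 P Q t s)\<rparr>
          (m, doc_id P) = m"
      "fobj \<lparr>fobj = (\<lambda>(n, m). doc_comp1 P n m), farr = (\<lambda>(t, s). doc_comp2 P Q t s)\<rparr>
          (doc_id Q, m) = m"
      if "P \<in> K" "Q \<in> K" "m \<in> Obj (doc_hom P Q (Mor P Q))" for P Q m
      using that doc_comp1_id[OF K mor K] by auto
    show "fobj \<lparr>fobj = (\<lambda>(n, m). doc_comp1 P n m), farr = (\<lambda>(t, s). doc_comp2 P W t s)\<rparr>
        (k, fobj \<lparr>fobj = (\<lambda>(n, m). doc_comp1 P n m), farr = (\<lambda>(t, s). doc_comp2 P R t s)\<rparr> (n, m)) =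
      fobj \<lparr>fobj = (\<lambda>(n, m). doc_comp1 P n m), farr = (\<lambda>(t, s). doc_comp2 P W t s)\<rparr>
        (fobj \<lparr>fobj = (\<lambda>(n, m). doc_comp1 Q n m), farr = (\<lambda>(t, s). doc_comp2 Q W t s)\<rparr> (k, n), m)"
      if "P \<in> K" "Q \<in> K" "R \<in> K" "W \<in> K" "m \<in> Obj (doc_hom P Q (Mor P Q))"
        "n \<in> Obj (doc_hom Q R (Mor Q R))" "k \<in> Obj (doc_hom R W (Mor R W))" for P Q R W m n k
      using that doc_comp1_assoc[OF mor mor] by auto
  qed (auto simp: id doc_comp2_id K mor intro!: doc_comp2_assoc)
qed

section \<open>Left adjoints to reindexing and existential doctrines\<close>

lemma is_left_adjoint_iff:
  assumes P: "is_doctrine P" and f: "f \<in> homs (base P) a b"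
  shows "is_left_adjoint P f s \<longleftrightarrow> s \<in> carrier (fib P a) \<rightarrow> carrier (fib P b) \<and>
    (\<forall>y \<in> carrier (fib P a). \<forall>x \<in> carrier (fib P b). s y \<sqsubseteq>\<^bsub>fib P b\<^esub> x \<longleftrightarrow> y \<sqsubseteq>\<^bsub>fib P a\<^esub> reindex P f x)"
proof -
  note D = doctrineD[OF P]
  have "a \<in> Obj (base P)" "b \<in> Obj (base P)"
    using category_obj[OF D(1) f] by auto
  then have "partial_order (fib P a)" "partial_order (fib P b)"
    using D(3) frame_partial_order by blast+
  moreover have "reindex P f \<in> carrier (fib P b) \<rightarrow> carrier (fib P a)"
    using frame_hom_closed[OF D(4)[OF f]] by blast
  ultimately show ?thesis
    using f by (auto simp: is_left_adjoint_def galois_connection_def connection_def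
        galois_connection_axioms_def homs_iff)
qed

text \<open>\<open>Sig\<close> is a definite description, so uniqueness has to be supplied: left
  adjoints agree on the carrier by antisymmetry, and extensionality fixes the remaining values. Any
  witness can thus be traded for \<open>Sig\<close>.\<close>

lemma Sig_left_adjoint:
  assumes P: "is_doctrine P" and f: "f \<in> homs (base P) a b" and s: "is_left_adjoint P f s"
  shows "is_left_adjoint P f (Sig P f)"
proof -
  note iff = is_left_adjoint_iff[OF P f] and D = doctrineD[OF P]
  have b: "b \<in> Obj (base P)" and dom: "Dom (base P) f = a"
    using category_obj[OF D(1) f] f by (auto simp: homs_iff)
  let ?A = "carrier (fib P a)"
  have "\<exists>!s. s \<in> extensional ?A \<and> is_left_adjoint P f s"
  proof (rule ex1I[of _ "restrict s ?A"])
    show "restrict s ?A \<in> extensional ?A \<and> is_left_adjoint P f (restrict s ?A)"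
      using s by (auto simp: iff)
    fix t assume t: "t \<in> extensional ?A \<and> is_left_adjoint P f t"
    show "t = restrict s ?A"
    proof (rule extensionalityI[of _ ?A])
      fix y assume y: "y \<in> ?A"
      have "t y \<in> carrier (fib P b)" "s y \<in> carrier (fib P b)"
        using s t y by (auto simp: iff)
      moreover from this have "t y \<sqsubseteq>\<^bsub>fib P b\<^esub> s y" "s y \<sqsubseteq>\<^bsub>fib P b\<^esub> t y"
        using s t y frame_refl[OF D(3)[OF b]] unfolding iff by blast+
      ultimately show "t y = restrict s ?A y"
        using y frame_antisym[OF D(3)[OF b]] by simp
    qed (use t in auto)
  qed
  then show ?thesis
    using theI'[of "\<lambda>s. s \<in> extensional ?A \<and> is_left_adjoint P f s"] by (simp add: Sig_def dom)
qed

lemma is_productD: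
  assumes "is_product C d c p p1 p2"
  shows "p1 \<in> homs C p d" "p2 \<in> homs C p c"
  using assms by (auto simp: is_product_def)

lemma ex_doctrine_is_doctrine: "is_ex_doctrine P \<Longrightarrow> is_doctrine P"
  by (simp add: is_ex_doctrine_def)

lemma ex_doctrine_Sig:
  assumes P: "is_ex_doctrine P" and p: "is_product (base P) d c p \<pi>' \<pi>"
    and y: "y \<in> carrier (fib P p)"
  shows "Sig P \<pi> y \<in> carrier (fib P c)"
    and "x \<in> carrier (fib P c) \<Longrightarrow> Sig P \<pi> y \<sqsubseteq>\<^bsub>fib P c\<^esub> x \<longleftrightarrow> y \<sqsubseteq>\<^bsub>fib P p\<^esub> reindex P \<pi> x"
proof -
  note D = ex_doctrine_is_doctrine[OF P]
  obtain s where "is_left_adjoint P \<pi> s"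
    using P p unfolding is_ex_doctrine_def by blast
  then have "is_left_adjoint P \<pi> (Sig P \<pi>)"
    by (rule Sig_left_adjoint[OF D is_productD(2)[OF p]])
  then show "Sig P \<pi> y \<in> carrier (fib P c)"
    and "x \<in> carrier (fib P c) \<Longrightarrow> Sig P \<pi> y \<sqsubseteq>\<^bsub>fib P c\<^esub> x \<longleftrightarrow> y \<sqsubseteq>\<^bsub>fib P p\<^esub> reindex P \<pi> x"
    using y by (auto simp: is_left_adjoint_iff[OF D is_productD(2)[OF p]])
qed

lemma ex_doctrine_frobenius:
  assumes "is_ex_doctrine P" "is_product (base P) d c p \<pi>' \<pi>"
    and "x \<in> carrier (fib P c)" "y \<in> carrier (fib P p)"
  shows "x \<sqinter>\<^bsub>fib P c\<^esub> Sig P \<pi> y = Sig P \<pi> (reindex P \<pi> x \<sqinter>\<^bsub>fib P p\<^esub> y)"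
  using assms unfolding is_ex_doctrine_def by blast

lemma ex_doctrine_beck_chevalley:
  assumes "is_ex_doctrine P" "is_product (base P) d c p \<pi>' \<pi>"
    and "is_product (base P) d c' q \<rho>' \<rho>" "f \<in> homs (base P) c' c" "h \<in> homs (base P) q p"
    and "Cmp (base P) \<pi>' h = \<rho>'" "Cmp (base P) \<pi> h = Cmp (base P) f \<rho>" "y \<in> carrier (fib P p)"
  shows "reindex P f (Sig P \<pi> y) = Sig P \<rho> (reindex P h y)"
  using assms unfolding is_ex_doctrine_def by blast

lemma ex_doc_mors_doc_mors: "m \<in> ex_doc_mors P Q \<Longrightarrow> m \<in> doc_mors P Q"
  by (simp add: ex_doc_mors_def)

lemma ex_doc_id_mor:
  assumes P: "is_ex_doctrine P"
  shows "doc_id P \<in> ex_doc_mors P P"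
proof -
  note D = ex_doctrine_is_doctrine[OF P]
  have "fibmap (doc_id P) c (Sig P \<pi> y) = Sig P (farr (ftr (doc_id P)) \<pi>) (fibmap (doc_id P) p y)"
    if p: "is_product (base P) d c p \<pi>' \<pi>" and y: "y \<in> carrier (fib P p)" for d c p \<pi>' \<pi> y
    using ex_doctrine_Sig(1)[OF P p y] is_productD(2)[OF p] y
      category_obj[OF doctrineD(1)[OF D] is_productD(2)[OF p]]
    by (simp add: doc_id_def homs_iff)
  then show ?thesis
    using doc_id_mor[OF D] by (auto simp: ex_doc_mors_def)
qed

text \<open>The condition on \<open>n\<close> applies to the image of a projection under
  \<open>m\<close> because \<open>m\<close> preserves product cones.\<close>

lemma ex_doc_comp1_mor:
  assumes P: "is_ex_doctrine P" and m: "m \<in> ex_doc_mors P Q" and n: "n \<in> ex_doc_mors Q R"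
  shows "doc_comp1 P n m \<in> ex_doc_mors P R"
proof -
  note D = ex_doctrine_is_doctrine[OF P]
  have m': "m \<in> doc_mors P Q" and n': "n \<in> doc_mors Q R"
    using m n by (auto simp: ex_doc_mors_def)
  have "fibmap (doc_comp1 P n m) c (Sig P \<pi> y) =
      Sig R (farr (ftr (doc_comp1 P n m)) \<pi>) (fibmap (doc_comp1 P n m) p y)"
    if p: "is_product (base P) d c p \<pi>' \<pi>" and y: "y \<in> carrier (fib P p)" for d c p \<pi>' \<pi> y
  proof -
    note o = category_obj[OF doctrineD(1)[OF D] is_productD(2)[OF p]]
    have Fp: "is_product (base Q) (fobj (ftr m) d) (fobj (ftr m) c) (fobj (ftr m) p)
        (farr (ftr m) \<pi>') (farr (ftr m) \<pi>)"
      using doc_morsD(2)[OF m'] p by (auto simp: preserves_finite_products_def)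
    have "fibmap m c (Sig P \<pi> y) = Sig Q (farr (ftr m) \<pi>) (fibmap m p y)"
      using m p y unfolding ex_doc_mors_def by blast
    moreover have "fibmap n (fobj (ftr m) c) (Sig Q (farr (ftr m) \<pi>) (fibmap m p y)) =
        Sig R (farr (ftr n) (farr (ftr m) \<pi>)) (fibmap n (fobj (ftr m) p) (fibmap m p y))"
      using n Fp doc_mors_fibmap_closed[OF m' o(1) y] unfolding ex_doc_mors_def by blast
    ultimately show ?thesis
      using o y ex_doctrine_Sig(1)[OF P p y] is_productD(2)[OF p]
      by (simp add: doc_comp1_simps homs_iff)
  qed
  then show ?thesis
    using doc_comp1_mor[OF D m' n'] by (auto simp: ex_doc_mors_def)
qed

lemma Doc_two_category: "is_two_category (Doc S)"
  unfolding Doc_def by (rule doc_two_category) (auto intro: doc_id_mor doc_comp1_mor)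

lemma ExDoc_two_category: "is_two_category (ExDoc S)"
  unfolding ExDoc_def
  by (rule doc_two_category)
    (auto intro: ex_doc_id_mor ex_doc_comp1_mor ex_doctrine_is_doctrine dest: ex_doc_mors_doc_mors)

lemma forget_two_functor: "is_two_functor (ExDoc S) (Doc S) forget"
proof -
  have F: "is_functor (doc_hom P Q (ex_doc_mors P Q)) (doc_hom P Q (doc_mors P Q))
      \<lparr>fobj = (\<lambda>m. m), farr = (\<lambda>t. t)\<rparr>" if Q: "is_doctrine Q" for P Q
  proof (rule is_functorI)
    show "is_category (doc_hom P Q (ex_doc_mors P Q))"
      by (rule doc_hom_category[OF Q]) (auto simp: ex_doc_mors_def)
    show "is_category (doc_hom P Q (doc_mors P Q))"
      by (rule doc_hom_category[OF Q]) auto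
  qed (auto simp: ex_doc_mors_def doc_hom_def homs_iff)
  show ?thesis
    using Doc_two_category ExDoc_two_category
    by (auto simp: is_two_functor_def forget_def)
      (auto simp: Doc_def ExDoc_def intro: ex_doctrine_is_doctrine F)
qed

section \<open>Frames and projections\<close>

lemma lattice_sup_eqI:
  assumes "complete_lattice L" "A \<subseteq> carrier L" "s \<in> carrier L"
    and "\<And>a. a \<in> A \<Longrightarrow> a \<sqsubseteq>\<^bsub>L\<^esub> s"
    and "\<And>t. t \<in> carrier L \<Longrightarrow> (\<And>a. a \<in> A \<Longrightarrow> a \<sqsubseteq>\<^bsub>L\<^esub> t) \<Longrightarrow> s \<sqsubseteq>\<^bsub>L\<^esub> t"
  shows "\<Squnion>\<^bsub>L\<^esub> A = s"
proof -
  interpret L: complete_lattice L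
    by fact
  have "\<Squnion>\<^bsub>L\<^esub> A \<sqsubseteq>\<^bsub>L\<^esub> s"
    by (rule L.sup_least) (use assms in auto)
  moreover have "s \<sqsubseteq>\<^bsub>L\<^esub> \<Squnion>\<^bsub>L\<^esub> A"
    by (rule assms(5)) (use assms(2) in \<open>auto intro: L.sup_upper\<close>)
  ultimately show ?thesis
    using assms(2,3) by (intro L.le_antisym) auto
qed

lemma lattice_meet_eqI:
  assumes "complete_lattice L" "x \<in> carrier L" "y \<in> carrier L" "m \<in> carrier L"
    and "m \<sqsubseteq>\<^bsub>L\<^esub> x" "m \<sqsubseteq>\<^bsub>L\<^esub> y"
    and "\<And>t. t \<in> carrier L \<Longrightarrow> t \<sqsubseteq>\<^bsub>L\<^esub> x \<Longrightarrow> t \<sqsubseteq>\<^bsub>L\<^esub> y \<Longrightarrow> t \<sqsubseteq>\<^bsub>L\<^esub> m"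
  shows "x \<sqinter>\<^bsub>L\<^esub> y = m"
proof -
  interpret L: complete_lattice L
    by fact
  have "m \<sqsubseteq>\<^bsub>L\<^esub> x \<sqinter>\<^bsub>L\<^esub> y"
    using assms by (intro L.meet_le) auto
  moreover have "x \<sqinter>\<^bsub>L\<^esub> y \<sqsubseteq>\<^bsub>L\<^esub> m"
    using assms(2,3) by (intro assms(7)) (auto intro: L.meet_left L.meet_right)
  ultimately show ?thesis
    using assms(2-4) by (intro L.le_antisym) auto
qed

lemma frame_sup:
  assumes "is_frame L" "A \<subseteq> carrier L"
  shows "\<Squnion>\<^bsub>L\<^esub> A \<in> carrier L"
    and "a \<in> A \<Longrightarrow> a \<sqsubseteq>\<^bsub>L\<^esub> \<Squnion>\<^bsub>L\<^esub> A"
    and "t \<in> carrier L \<Longrightarrow> (\<And>a. a \<in> A \<Longrightarrow> a \<sqsubseteq>\<^bsub>L\<^esub> t) \<Longrightarrow> \<Squnion>\<^bsub>L\<^esub> A \<sqsubseteq>\<^bsub>L\<^esub> t"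
proof -
  interpret L: complete_lattice L
    using frame_lattice assms(1) .
  show "\<Squnion>\<^bsub>L\<^esub> A \<in> carrier L"
    and "a \<in> A \<Longrightarrow> a \<sqsubseteq>\<^bsub>L\<^esub> \<Squnion>\<^bsub>L\<^esub> A"
    and "t \<in> carrier L \<Longrightarrow> (\<And>a. a \<in> A \<Longrightarrow> a \<sqsubseteq>\<^bsub>L\<^esub> t) \<Longrightarrow> \<Squnion>\<^bsub>L\<^esub> A \<sqsubseteq>\<^bsub>L\<^esub> t"
    using assms(2) by (auto intro: L.sup_upper L.sup_least)
qed

lemma frame_meet:
  assumes "is_frame L" "x \<in> carrier L" "y \<in> carrier L"
  shows "x \<sqinter>\<^bsub>L\<^esub> y \<in> carrier L" "x \<sqinter>\<^bsub>L\<^esub> y \<sqsubseteq>\<^bsub>L\<^esub> x" "x \<sqinter>\<^bsub>L\<^esub> y \<sqsubseteq>\<^bsub>L\<^esub> y"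
    and "t \<in> carrier L \<Longrightarrow> t \<sqsubseteq>\<^bsub>L\<^esub> x \<Longrightarrow> t \<sqsubseteq>\<^bsub>L\<^esub> y \<Longrightarrow> t \<sqsubseteq>\<^bsub>L\<^esub> x \<sqinter>\<^bsub>L\<^esub> y"
proof -
  interpret L: complete_lattice L
    using frame_lattice assms(1) .
  show "x \<sqinter>\<^bsub>L\<^esub> y \<in> carrier L" "x \<sqinter>\<^bsub>L\<^esub> y \<sqsubseteq>\<^bsub>L\<^esub> x" "x \<sqinter>\<^bsub>L\<^esub> y \<sqsubseteq>\<^bsub>L\<^esub> y"
    and "t \<in> carrier L \<Longrightarrow> t \<sqsubseteq>\<^bsub>L\<^esub> x \<Longrightarrow> t \<sqsubseteq>\<^bsub>L\<^esub> y \<Longrightarrow> t \<sqsubseteq>\<^bsub>L\<^esub> x \<sqinter>\<^bsub>L\<^esub> y"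
    using assms(2,3) by (auto intro: L.meet_left L.meet_right L.meet_le)
qed

lemma frame_top:
  assumes "is_frame L"
  shows "\<top>\<^bsub>L\<^esub> \<in> carrier L" "x \<in> carrier L \<Longrightarrow> x \<sqsubseteq>\<^bsub>L\<^esub> \<top>\<^bsub>L\<^esub>"
proof -
  interpret L: complete_lattice L
    using frame_lattice assms .
  show "\<top>\<^bsub>L\<^esub> \<in> carrier L" "x \<in> carrier L \<Longrightarrow> x \<sqsubseteq>\<^bsub>L\<^esub> \<top>\<^bsub>L\<^esub>"
    by (auto intro: L.top_higher)
qed

text \<open>Distributivity cuts an element below a join into pieces below the members of the family.
  This is what makes covers by joins stable under passing to smaller elements.\<close>

lemma frame_sup_pieces:
  assumes L: "is_frame L" and A: "A \<subseteq> carrier L" and y: "y \<in> carrier L" "y \<sqsubseteq>\<^bsub>L\<^esub> \<Squnion>\<^bsub>L\<^esub> A"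
  shows "\<Squnion>\<^bsub>L\<^esub> ((\<lambda>a. y \<sqinter>\<^bsub>L\<^esub> a) ` A) = y"
proof -
  have "y \<sqinter>\<^bsub>L\<^esub> \<Squnion>\<^bsub>L\<^esub> A = y"
    by (rule lattice_meet_eqI[OF frame_lattice[OF L] y(1) frame_sup(1)[OF L A] y(1) frame_refl[OF L y(1)] y(2)])
  then show ?thesis
    using assms by (auto simp: is_frame_def)
qed

lemma frame_homI:
  assumes "is_frame L" "is_frame M" "\<And>x. x \<in> carrier L \<Longrightarrow> h x \<in> carrier M" "h \<top>\<^bsub>L\<^esub> = \<top>\<^bsub>M\<^esub>"
    and "\<And>x y. x \<in> carrier L \<Longrightarrow> y \<in> carrier L \<Longrightarrow> h (x \<sqinter>\<^bsub>L\<^esub> y) = h x \<sqinter>\<^bsub>M\<^esub> h y"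
    and "\<And>A. A \<subseteq> carrier L \<Longrightarrow> h (\<Squnion>\<^bsub>L\<^esub> A) = \<Squnion>\<^bsub>M\<^esub> (h ` A)"
  shows "is_frame_hom L M h"
  using assms frame_lattice[OF assms(1)] frame_lattice[OF assms(2)]
  by (auto simp: is_frame_hom_def meet_pres_def sup_pres_def intro: complete_lattice_lattice)

lemma frame_meet_sup_le:
  assumes L: "is_frame L" and A: "A \<subseteq> carrier L" and x: "x \<in> carrier L" and w: "w \<in> carrier L"
    and le: "\<And>a. a \<in> A \<Longrightarrow> x \<sqinter>\<^bsub>L\<^esub> a \<sqsubseteq>\<^bsub>L\<^esub> w"
  shows "x \<sqinter>\<^bsub>L\<^esub> \<Squnion>\<^bsub>L\<^esub> A \<sqsubseteq>\<^bsub>L\<^esub> w"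
proof -
  have "x \<sqinter>\<^bsub>L\<^esub> \<Squnion>\<^bsub>L\<^esub> A = \<Squnion>\<^bsub>L\<^esub> ((\<lambda>a. x \<sqinter>\<^bsub>L\<^esub> a) ` A)"
    using L A x by (simp add: is_frame_def)
  then show ?thesis
    using A le frame_meet(1)[OF L x] frame_sup(3)[OF L _ w, of "(\<lambda>a. x \<sqinter>\<^bsub>L\<^esub> a) ` A"] by auto
qed

lemma meet_commute: "x \<sqinter>\<^bsub>L\<^esub> y = y \<sqinter>\<^bsub>L\<^esub> x"
  by (simp add: meet_def insert_commute)

section \<open>Product projections and their pullback squares\<close>

lemma product_factor:
  assumes "is_product C a b p p1 p2" "f \<in> homs C x a" "g \<in> homs C x b"
  obtains h where "h \<in> homs C x p" "Cmp C p1 h = f" "Cmp C p2 h = g"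
  using assms unfolding is_product_def by blast

lemma product_unique:
  assumes C: "is_category C" and p: "is_product C a b p p1 p2"
    and h: "h \<in> homs C x p" and h': "h' \<in> homs C x p"
    and e: "Cmp C p1 h = Cmp C p1 h'" "Cmp C p2 h = Cmp C p2 h'"
  shows "h = h'"
proof -
  have "\<exists>!k. k \<in> homs C x p \<and> Cmp C p1 k = Cmp C p1 h' \<and> Cmp C p2 k = Cmp C p2 h'"
    using p category_cmp[OF C is_productD(1)[OF p] h'] category_cmp[OF C is_productD(2)[OF p] h']
    unfolding is_product_def by blast
  then show ?thesis
    using h h' e by blast
qed

lemma product_obj:
  assumes "is_category C" "is_product C a b p p1 p2"
  shows "a \<in> Obj C" "b \<in> Obj C" "p \<in> Obj C"
  using category_obj[OF assms(1) is_productD(1)[OF assms(2)]]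
    category_obj[OF assms(1) is_productD(2)[OF assms(2)]] by auto

lemma product_exists:
  assumes "has_finite_products C" "a \<in> Obj C" "b \<in> Obj C"
  obtains p p1 p2 where "is_product C a b p p1 p2"
  using assms unfolding has_finite_products_def by blast

definition projs :: "('o, 'm) category \<Rightarrow> 'o \<Rightarrow> 'm set" where
  "projs C c = {\<pi>. \<exists>d p \<pi>'. is_product C d c p \<pi>' \<pi>}"

lemma projs_homs: "\<pi> \<in> projs C c \<Longrightarrow> \<pi> \<in> homs C (Dom C \<pi>) c"
  unfolding projs_def by (auto simp: is_product_def homs_iff)

text \<open>\<open>c\<close> is itself a product of a terminal object and \<open>c\<close>, so the
  identity forgets a terminal factor.\<close>

lemma ident_proj:
  assumes C: "is_category C" and fp: "has_finite_products C" and c: "c \<in> Obj C"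
  shows "Ident C c \<in> projs C c"
proof -
  obtain t where t: "is_terminal C t"
    using fp by (auto simp: has_finite_products_def)
  then obtain e where e: "e \<in> homs C c t"
    using c by (auto simp: is_terminal_def)
  have "\<exists>!h. h \<in> homs C x c \<and> Cmp C e h = f \<and> Cmp C (Ident C c) h = g"
    if f: "f \<in> homs C x t" and g: "g \<in> homs C x c" for x f g
  proof (rule ex1I[of _ g])
    have "Cmp C e g \<in> homs C x t"
      using category_cmp[OF C e g] .
    moreover have "\<exists>!k. k \<in> homs C x t"
      using t category_obj(1)[OF C g] by (auto simp: is_terminal_def)
    ultimately have "Cmp C e g = f"
      using f by blast
    then show "g \<in> homs C x c \<and> Cmp C e g = f \<and> Cmp C (Ident C c) g = g"
      using g category_cmp_ident[OF C g] by simp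
    show "h = g" if "h \<in> homs C x c \<and> Cmp C e h = f \<and> Cmp C (Ident C c) h = g" for h
      using that category_cmp_ident(2)[OF C, of h x c] by simp
  qed
  then have "is_product C t c c e (Ident C c)"
    using e category_ident[OF C c] by (auto simp: is_product_def)
  then show ?thesis
    by (auto simp: projs_def)
qed

text \<open>Forgetting \<open>d'\<close> and then \<open>d\<close> amounts to forgetting their
  product \<open>e\<close>: the object \<open>q\<close> is a product of \<open>e\<close> and
  \<open>c\<close>.\<close>

lemma proj_comp:
  assumes C: "is_category C" and fp: "has_finite_products C"
    and \<pi>: "\<pi> \<in> projs C c" and \<rho>: "\<rho> \<in> projs C (Dom C \<pi>)"
  shows "Cmp C \<pi> \<rho> \<in> projs C c"
proof -
  obtain d p \<pi>' where p: "is_product C d c p \<pi>' \<pi>"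
    using \<pi> by (auto simp: projs_def)
  have Dp: "Dom C \<pi> = p"
    using is_productD(2)[OF p] by (simp add: homs_iff)
  obtain d' q \<rho>' where q: "is_product C d' p q \<rho>' \<rho>"
    using \<rho> Dp by (auto simp: projs_def)
  note ph = is_productD[OF p] and qh = is_productD[OF q] and cmp = category_cmp[OF C]
    and assoc = category_assoc[OF C]
  obtain e e1 e2 where e: "is_product C d d' e e1 e2"
    using product_exists[OF fp product_obj(1)[OF C p] product_obj(1)[OF C q]] .
  note eh = is_productD[OF e]
  \<comment> \<open>The projection of \<open>q\<close> to the combined factor
    \<open>e\<close>.\<close>
  obtain \<tau> where \<tau>: "\<tau> \<in> homs C q e" "Cmp C e1 \<tau> = Cmp C \<pi>' \<rho>" "Cmp C e2 \<tau> = \<rho>'"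
    using product_factor[OF e cmp[OF ph(1) qh(2)] qh(1)] .
  have "\<exists>!h. h \<in> homs C x q \<and> Cmp C \<tau> h = f \<and> Cmp C (Cmp C \<pi> \<rho>) h = g"
    if f: "f \<in> homs C x e" and g: "g \<in> homs C x c" for x f g
  proof -
    obtain k where k: "k \<in> homs C x p" "Cmp C \<pi>' k = Cmp C e1 f" "Cmp C \<pi> k = g"
      using product_factor[OF p cmp[OF eh(1) f] g] .
    obtain h where h: "h \<in> homs C x q" "Cmp C \<rho>' h = Cmp C e2 f" "Cmp C \<rho> h = k"
      using product_factor[OF q cmp[OF eh(2) f] k(1)] .
    have t1: "Cmp C e1 (Cmp C \<tau> h') = Cmp C \<pi>' (Cmp C \<rho> h')"
      and t2: "Cmp C e2 (Cmp C \<tau> h') = Cmp C \<rho>' h'"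
      and t3: "Cmp C (Cmp C \<pi> \<rho>) h' = Cmp C \<pi> (Cmp C \<rho> h')" if h': "h' \<in> homs C x q" for h'
      using assoc[OF eh(1) \<tau>(1) h'] assoc[OF eh(2) \<tau>(1) h'] assoc[OF ph(1) qh(2) h']
        assoc[OF ph(2) qh(2) h'] \<tau> by simp_all
    show ?thesis
    proof (rule ex1I[of _ h])
      have "Cmp C \<tau> h = f"
        using t1[OF h(1)] t2[OF h(1)] h k by (intro product_unique[OF C e cmp[OF \<tau>(1) h(1)] f]) simp_all
      then show "h \<in> homs C x q \<and> Cmp C \<tau> h = f \<and> Cmp C (Cmp C \<pi> \<rho>) h = g"
        using h k t3[OF h(1)] by simp
      show "h' = h" if "h' \<in> homs C x q \<and> Cmp C \<tau> h' = f \<and> Cmp C (Cmp C \<pi> \<rho>) h' = g" for h'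
      proof -
        have h': "h' \<in> homs C x q" "Cmp C \<tau> h' = f" "Cmp C (Cmp C \<pi> \<rho>) h' = g"
          using that by auto
        have "Cmp C \<rho> h' = k"
          using t1[OF h'(1)] t3[OF h'(1)] h' k
          by (intro product_unique[OF C p cmp[OF qh(2) h'(1)] k(1)]) simp_all
        then show ?thesis
          using t2[OF h'(1)] h'(2) h by (intro product_unique[OF C q h'(1) h(1)]) simp_all
      qed
    qed
  qed
  then have "is_product C e c q \<tau> (Cmp C \<pi> \<rho>)"
    using \<tau>(1) cmp[OF ph(2) qh(2)] by (auto simp: is_product_def)
  then show ?thesis
    by (auto simp: projs_def)
qed

text \<open>The squares of the Beck-Chevalley condition: \<open>h\<close> plays the role of
  \<open>1\<^sub>d \<times> f\<close>, and both cones forget the same factor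
  \<open>d\<close>.\<close>

definition bc_square ::
  "('o, 'm) category \<Rightarrow> 'o \<Rightarrow> 'o \<Rightarrow> 'o \<Rightarrow> 'm \<Rightarrow> 'm \<Rightarrow> 'o \<Rightarrow> 'o \<Rightarrow> 'm \<Rightarrow> 'm \<Rightarrow> 'm \<Rightarrow> 'm \<Rightarrow> bool" where
  "bc_square C d c p \<pi>' \<pi> c' q \<rho>' \<rho> f h \<longleftrightarrow>
     is_product C d c p \<pi>' \<pi> \<and> is_product C d c' q \<rho>' \<rho> \<and> f \<in> homs C c' c \<and> h \<in> homs C q p \<and>
     Cmp C \<pi>' h = \<rho>' \<and> Cmp C \<pi> h = Cmp C f \<rho>"

lemma bc_square_exists:
  assumes C: "is_category C" and fp: "has_finite_products C"
    and p: "is_product C d c p \<pi>' \<pi>" and f: "f \<in> homs C c' c"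
  obtains q \<rho>' \<rho> h where "bc_square C d c p \<pi>' \<pi> c' q \<rho>' \<rho> f h"
proof -
  obtain q \<rho>' \<rho> where q: "is_product C d c' q \<rho>' \<rho>"
    using product_exists[OF fp product_obj(1)[OF C p] category_obj(1)[OF C f]] .
  obtain h where "h \<in> homs C q p" "Cmp C \<pi>' h = \<rho>'" "Cmp C \<pi> h = Cmp C f \<rho>"
    using product_factor[OF p is_productD(1)[OF q] category_cmp[OF C f is_productD(2)[OF q]]] .
  then show ?thesis
    using that p q f by (auto simp: bc_square_def)
qed

text \<open>The existence half of the pullback property: \<open>u\<close> takes its
  \<open>d\<close>-coordinate from \<open>k\<close> and its other coordinate from
  \<open>l\<close>.\<close>

lemma bc_square_pullback:
  assumes C: "is_category C" and sq: "bc_square C d c p \<pi>' \<pi> c' q \<rho>' \<rho> f h"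
    and k: "k \<in> homs C e p" and l: "l \<in> homs C e c'" and kl: "Cmp C \<pi> k = Cmp C f l"
  obtains u where "u \<in> homs C e q" "Cmp C \<rho> u = l" "Cmp C h u = k"
proof -
  have p: "is_product C d c p \<pi>' \<pi>" and q: "is_product C d c' q \<rho>' \<rho>" and f: "f \<in> homs C c' c"
    and h: "h \<in> homs C q p" "Cmp C \<pi>' h = \<rho>'" "Cmp C \<pi> h = Cmp C f \<rho>"
    using sq by (auto simp: bc_square_def)
  note ph = is_productD[OF p] and qh = is_productD[OF q] and cmp = category_cmp[OF C]
    and assoc = category_assoc[OF C]
  obtain u where u: "u \<in> homs C e q" "Cmp C \<rho>' u = Cmp C \<pi>' k" "Cmp C \<rho> u = l"
    using product_factor[OF q cmp[OF ph(1) k] l] .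
  have "Cmp C h u = k"
    using assoc[OF ph(1) h(1) u(1)] assoc[OF ph(2) h(1) u(1)] assoc[OF f qh(2) u(1)] h u kl
    by (intro product_unique[OF C p cmp[OF h(1) u(1)] k]) simp_all
  then show ?thesis
    using that u by blast
qed

section \<open>Closed sieves\<close>

text \<open>An element of the fibre of the existential completion over \<open>c\<close> is represented by a set of pairs
  \<open>(g, y)\<close> with \<open>g : e \<rightarrow> c\<close> and \<open>y \<in> P e\<close>, read as the assertions "\<open>y \<le> g\<^sup>* I\<close>".
  These are the closed sieves on \<open>(c, \<top>)\<close> in the category of elements of \<open>P\<close>, for the
  Grothendieck topology in which \<open>(e, \<Squnion>Y)\<close> is covered by the \<open>(e, y)\<close> with \<open>y \<in> Y\<close>.\<close>

definition presieves :: "('o, 'm, 'p) doctrine \<Rightarrow> 'o \<Rightarrow> ('m \<times> 'p) set set" where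
  "presieves P c = {I.
     (\<forall>(g, y) \<in> I. g \<in> Arr (base P) \<and> Cod (base P) g = c \<and> y \<in> carrier (fib P (Dom (base P) g))) \<and>
     (\<forall>(g, y) \<in> I. \<forall>h \<in> Arr (base P). \<forall>x \<in> carrier (fib P (Dom (base P) h)).
        Cod (base P) h = Dom (base P) g \<and> x \<sqsubseteq>\<^bsub>fib P (Dom (base P) h)\<^esub> reindex P h y \<longrightarrow>
        (Cmp (base P) g h, x) \<in> I)}"

text \<open>\<open>Y\<close> may be empty: every closed sieve contains the empty join over each
  arrow into \<open>c\<close>.\<close>

definition closed_sieves :: "('o, 'm, 'p) doctrine \<Rightarrow> 'o \<Rightarrow> ('m \<times> 'p) set set" where
  "closed_sieves P c = {I \<in> presieves P c.
     \<forall>g \<in> Arr (base P). Cod (base P) g = c \<longrightarrow> (\<forall>Y \<subseteq> carrier (fib P (Dom (base P) g)).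
        (\<forall>y \<in> Y. (g, y) \<in> I) \<longrightarrow> (g, \<Squnion>\<^bsub>fib P (Dom (base P) g)\<^esub> Y) \<in> I)}"

text \<open>The joins of formal existentials. Generation is phrased as a test against all closed
  \<open>K\<close>, and not as equality with a generated sieve, because in this form
  \<open>univ_sieve\<close> and \<open>imp_sieve\<close> can be substituted for
  \<open>K\<close>.\<close>

definition ex_sieves :: "('o, 'm, 'p) doctrine \<Rightarrow> 'o \<Rightarrow> ('m \<times> 'p) set set" where
  "ex_sieves P c = {I \<in> closed_sieves P c. \<forall>K \<in> closed_sieves P c.
     (\<forall>(\<pi>, x) \<in> I. \<pi> \<in> projs (base P) c \<longrightarrow> (\<pi>, x) \<in> K) \<longrightarrow> I \<subseteq> K}"

definition gen_sieve :: "('o, 'm, 'p) doctrine \<Rightarrow> 'o \<Rightarrow> ('m \<times> 'p) set \<Rightarrow> ('m \<times> 'p) set" where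
  "gen_sieve P c G = \<Inter> {I \<in> closed_sieves P c. G \<subseteq> I}"

definition principal_sieve :: "('o, 'm, 'p) doctrine \<Rightarrow> 'o \<Rightarrow> 'p \<Rightarrow> ('m \<times> 'p) set" where
  "principal_sieve P c x = {(g, y). g \<in> Arr (base P) \<and> Cod (base P) g = c \<and>
     y \<in> carrier (fib P (Dom (base P) g)) \<and> y \<sqsubseteq>\<^bsub>fib P (Dom (base P) g)\<^esub> reindex P g x}"

definition pull_sieve :: "('o, 'm, 'p) doctrine \<Rightarrow> 'm \<Rightarrow> ('m \<times> 'p) set \<Rightarrow> ('m \<times> 'p) set" where
  "pull_sieve P f I = {(g, y). g \<in> Arr (base P) \<and> Cod (base P) g = Dom (base P) f \<and>
     (Cmp (base P) f g, y) \<in> I}"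

text \<open>Left adjoint of \<open>pull_sieve P f\<close> on closed sieves, for arbitrary
  \<open>f\<close>. Along a projection it also preserves generation by projections
  (\<open>ex_sigma\<close>).\<close>

definition sigma_sieve :: "('o, 'm, 'p) doctrine \<Rightarrow> 'm \<Rightarrow> ('m \<times> 'p) set \<Rightarrow> ('m \<times> 'p) set" where
  "sigma_sieve P f I = gen_sieve P (Cod (base P) f) ((\<lambda>(g, y). (Cmp (base P) f g, y)) ` I)"

text \<open>Right adjoints of \<open>pull_sieve P f\<close> and of \<open>(\<inter>) J\<close>. They preserve closedness, but not
  generation by projections; their only purpose is to reduce inclusions to generators.\<close>

definition univ_sieve :: "('o, 'm, 'p) doctrine \<Rightarrow> 'm \<Rightarrow> ('m \<times> 'p) set \<Rightarrow> ('m \<times> 'p) set" where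
  "univ_sieve P f K = {(g, y). g \<in> Arr (base P) \<and> Cod (base P) g = Cod (base P) f \<and>
     y \<in> carrier (fib P (Dom (base P) g)) \<and>
     (\<forall>e h l z. h \<in> homs (base P) e (Dom (base P) g) \<and> l \<in> homs (base P) e (Dom (base P) f) \<and>
        Cmp (base P) g h = Cmp (base P) f l \<and> z \<in> carrier (fib P e) \<and>
        z \<sqsubseteq>\<^bsub>fib P e\<^esub> reindex P h y \<longrightarrow> (l, z) \<in> K)}"

definition imp_sieve ::
  "('o, 'm, 'p) doctrine \<Rightarrow> 'o \<Rightarrow> ('m \<times> 'p) set \<Rightarrow> ('m \<times> 'p) set \<Rightarrow> ('m \<times> 'p) set" where
  "imp_sieve P c J K = {(g, y). g \<in> Arr (base P) \<and> Cod (base P) g = c \<and>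
     y \<in> carrier (fib P (Dom (base P) g)) \<and>
     (\<forall>e h z. h \<in> homs (base P) e (Dom (base P) g) \<and> z \<in> carrier (fib P e) \<and>
        z \<sqsubseteq>\<^bsub>fib P e\<^esub> reindex P h y \<and> (Cmp (base P) g h, z) \<in> J \<longrightarrow> (Cmp (base P) g h, z) \<in> K)}"

section \<open>Presieves and closed sieves over a doctrine\<close>

locale doctrine =
  fixes P :: "('o, 'm, 'p) doctrine"
  assumes P: "is_doctrine P"
begin

abbreviation C where "C \<equiv> base P"
abbreviation cmp (infixr "\<cdot>" 75) where "g \<cdot> f \<equiv> Cmp C g f"
abbreviation le ("(_/ \<sqsubseteq>[_] _)" [51, 0, 51] 50) where "x \<sqsubseteq>[c] y \<equiv> x \<sqsubseteq>\<^bsub>fib P c\<^esub> y"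

lemmas D = doctrineD[OF P]
lemmas cmp_homs = category_cmp[OF D(1)] and cmp_assoc = category_assoc[OF D(1)]
  and cmp_ident = category_cmp_ident[OF D(1)] and ident_homs = category_ident[OF D(1)]
  and homs_obj = category_obj[OF D(1)]

lemma frame: "f \<in> homs C a b \<Longrightarrow> is_frame (fib P a)" "f \<in> homs C a b \<Longrightarrow> is_frame (fib P b)"
  using D(3) homs_obj by blast+

lemma reindex_closed: "f \<in> homs C a b \<Longrightarrow> x \<in> carrier (fib P b) \<Longrightarrow> reindex P f x \<in> carrier (fib P a)"
  using frame_hom_closed[OF D(4)] by blast

lemma reindex_mono:
  "f \<in> homs C a b \<Longrightarrow> x \<in> carrier (fib P b) \<Longrightarrow> y \<in> carrier (fib P b) \<Longrightarrow> x \<sqsubseteq>[b] y \<Longrightarrow>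
   reindex P f x \<sqsubseteq>[a] reindex P f y"
  using frame_hom_mono[OF D(4)] by blast

lemma le_reindex_cmp:
  assumes "g \<in> homs C b c" "f \<in> homs C a b" "z \<in> carrier (fib P c)" "y \<in> carrier (fib P b)"
    and "y \<sqsubseteq>[b] reindex P g z" "x \<in> carrier (fib P a)" "x \<sqsubseteq>[a] reindex P f y"
  shows "x \<sqsubseteq>[a] reindex P (g \<cdot> f) z"
  using frame_trans[OF frame(1)[OF assms(2)] assms(7)
      reindex_mono[OF assms(2,4) reindex_closed[OF assms(1,3)] assms(5)]]
    reindex_closed[OF assms(2,4)] reindex_closed[OF assms(2) reindex_closed[OF assms(1,3)]]
    D(6)[OF assms(1,2,3)] assms(6) by simp

text \<open>Stability of covers: the family \<open>Y\<close> is reindexed along \<open>f\<close> and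
  cut down below \<open>x\<close>, as reindexing preserves joins and meets distribute over
  them.\<close>

lemma le_reindex_sup_pieces:
  assumes f: "f \<in> homs C a b" and Y: "Y \<subseteq> carrier (fib P b)" and x: "x \<in> carrier (fib P a)"
    and le: "x \<sqsubseteq>[a] reindex P f (\<Squnion>\<^bsub>fib P b\<^esub> Y)"
  obtains Z where "Z \<subseteq> carrier (fib P a)" "\<Squnion>\<^bsub>fib P a\<^esub> Z = x"
    "\<And>z. z \<in> Z \<Longrightarrow> z \<sqsubseteq>[a] x \<and> (\<exists>y \<in> Y. z \<sqsubseteq>[a] reindex P f y)"
proof -
  let ?Z = "(\<lambda>a'. x \<sqinter>\<^bsub>fib P a\<^esub> a') ` reindex P f ` Y"
  have r: "reindex P f ` Y \<subseteq> carrier (fib P a)"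
    using reindex_closed[OF f] Y by auto
  have "\<Squnion>\<^bsub>fib P a\<^esub> ?Z = x"
    using le frame_hom_sup[OF D(4)[OF f] Y] by (intro frame_sup_pieces[OF frame(1)[OF f] r x]) simp
  then show ?thesis
    using that[of ?Z] frame_meet[OF frame(1)[OF f] x] r by blast
qed

lemma presievesI:
  assumes "\<And>g y. (g, y) \<in> I \<Longrightarrow> \<exists>e. g \<in> homs C e c \<and> y \<in> carrier (fib P e)"
    and "\<And>g y e h x a. (g, y) \<in> I \<Longrightarrow> g \<in> homs C e c \<Longrightarrow> y \<in> carrier (fib P e) \<Longrightarrow>
      h \<in> homs C a e \<Longrightarrow> x \<in> carrier (fib P a) \<Longrightarrow> x \<sqsubseteq>[a] reindex P h y \<Longrightarrow> (g \<cdot> h, x) \<in> I"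
  shows "I \<in> presieves P c"
  unfolding presieves_def using assms unfolding homs_iff by fastforce

lemma presieve_elem:
  assumes "I \<in> presieves P c" "(g, y) \<in> I"
  shows "g \<in> homs C (Dom C g) c" "y \<in> carrier (fib P (Dom C g))"
  using assms by (auto simp: presieves_def homs_iff)

lemma presieve_down:
  assumes "I \<in> presieves P c" "(g, y) \<in> I" "g \<in> homs C e c" "h \<in> homs C a e"
    and "x \<in> carrier (fib P a)" "x \<sqsubseteq>[a] reindex P h y"
  shows "(g \<cdot> h, x) \<in> I"
  using assms by (auto simp: presieves_def homs_iff)

lemma presieve_le:
  assumes I: "I \<in> presieves P c" "(g, y) \<in> I" "g \<in> homs C e c" "x \<in> carrier (fib P e)" "x \<sqsubseteq>[e] y"
  shows "(g, x) \<in> I"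
proof -
  have e: "e \<in> Obj C"
    using homs_obj[OF I(3)] by blast
  have "y \<in> carrier (fib P e)"
    using presieve_elem[OF I(1,2)] I(3) by (simp add: homs_iff)
  then show ?thesis
    using presieve_down[OF I(1,2,3) ident_homs[OF e] I(4)] I(5) D(5)[OF e] cmp_ident(1)[OF I(3)] by simp
qed

lemma closed_presieve: "I \<in> closed_sieves P c \<Longrightarrow> I \<in> presieves P c"
  by (simp add: closed_sieves_def)

lemma closed_sup:
  assumes "I \<in> closed_sieves P c" "g \<in> homs C e c" "Y \<subseteq> carrier (fib P e)" "\<And>y. y \<in> Y \<Longrightarrow> (g, y) \<in> I"
  shows "(g, \<Squnion>\<^bsub>fib P e\<^esub> Y) \<in> I"
  using assms by (auto simp: closed_sieves_def homs_iff)

lemma closed_sievesI: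
  assumes "I \<in> presieves P c"
    and "\<And>g e Y. g \<in> homs C e c \<Longrightarrow> Y \<subseteq> carrier (fib P e) \<Longrightarrow> (\<And>y. y \<in> Y \<Longrightarrow> (g, y) \<in> I) \<Longrightarrow>
      (g, \<Squnion>\<^bsub>fib P e\<^esub> Y) \<in> I"
  shows "I \<in> closed_sieves P c"
  using assms by (auto simp: closed_sieves_def homs_iff)

section \<open>Principal, total and generated sieves\<close>

lemma principal_iff:
  "g \<in> homs C e c \<Longrightarrow>
   (g, y) \<in> principal_sieve P c x \<longleftrightarrow> y \<in> carrier (fib P e) \<and> y \<sqsubseteq>[e] reindex P g x"
  by (auto simp: principal_sieve_def homs_iff)

lemma principal_elem:
  assumes "(g, y) \<in> principal_sieve P c x"
  shows "g \<in> homs C (Dom C g) c" "y \<in> carrier (fib P (Dom C g))" "y \<sqsubseteq>[Dom C g] reindex P g x"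
  using assms by (auto simp: principal_sieve_def homs_iff)

lemma principal_closed:
  assumes "x \<in> carrier (fib P c)"
  shows "principal_sieve P c x \<in> closed_sieves P c"
proof (intro closed_sievesI presievesI)
  show "(g \<cdot> h, z) \<in> principal_sieve P c x"
    if "(g, y) \<in> principal_sieve P c x" "g \<in> homs C e c" "y \<in> carrier (fib P e)" "h \<in> homs C a e"
      "z \<in> carrier (fib P a)" "z \<sqsubseteq>[a] reindex P h y" for g y e h z a
    using that principal_iff[OF that(2)] principal_iff[OF cmp_homs[OF that(2,4)]]
      le_reindex_cmp[OF that(2,4) assms that(3) _ that(5,6)] by simp
  show "(g, \<Squnion>\<^bsub>fib P e\<^esub> Y) \<in> principal_sieve P c x"
    if "g \<in> homs C e c" "Y \<subseteq> carrier (fib P e)" "\<And>y. y \<in> Y \<Longrightarrow> (g, y) \<in> principal_sieve P c x" for g e Y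
    using that frame_sup[OF frame(1)[OF that(1)] that(2)] reindex_closed[OF that(1) assms]
    by (simp add: principal_iff)
qed (use principal_elem in blast)

text \<open>The Yoneda lemma for \<open>(c, x)\<close>: a principal sieve is generated by its pair
  over the identity.\<close>

lemma principal_subset:
  assumes x: "x \<in> carrier (fib P c)" and c: "c \<in> Obj C" and K: "K \<in> presieves P c"
  shows "principal_sieve P c x \<subseteq> K \<longleftrightarrow> (Ident C c, x) \<in> K"
proof
  note i = ident_homs[OF c]
  show "(Ident C c, x) \<in> K" if "principal_sieve P c x \<subseteq> K"
    using that principal_iff[OF i] x D(5)[OF c] frame_refl[OF D(3)[OF c]] by auto
  show "principal_sieve P c x \<subseteq> K" if "(Ident C c, x) \<in> K"
  proof (rule subrelI)
    fix g y assume "(g, y) \<in> principal_sieve P c x"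
    note g = principal_elem[OF this]
    show "(g, y) \<in> K"
      using presieve_down[OF K that i g] cmp_ident(2)[OF g(1)] by simp
  qed
qed

text \<open>Reindexing preserves the top element. The total sieve serves below as the bound under
  which sets of pairs generate closed sieves.\<close>

lemma total_eq:
  assumes c: "c \<in> Obj C"
  shows "principal_sieve P c \<top>\<^bsub>fib P c\<^esub> = {(g, y). g \<in> homs C (Dom C g) c \<and> y \<in> carrier (fib P (Dom C g))}"
proof -
  have "y \<sqsubseteq>[e] reindex P g \<top>\<^bsub>fib P c\<^esub>" if "g \<in> homs C e c" "y \<in> carrier (fib P e)" for g y e
    using frame_hom_top[OF D(4)[OF that(1)]] frame_top[OF frame(1)[OF that(1)]] that(2) by simp
  then show ?thesis
    using principal_elem by (auto simp: principal_iff)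
qed

lemma presieve_total: "c \<in> Obj C \<Longrightarrow> I \<in> presieves P c \<Longrightarrow> I \<subseteq> principal_sieve P c \<top>\<^bsub>fib P c\<^esub>"
  using presieve_elem by (auto simp: total_eq)

lemma closed_Inter:
  assumes ne: "\<I> \<noteq> {}" and \<I>: "\<And>I. I \<in> \<I> \<Longrightarrow> I \<in> closed_sieves P c"
  shows "\<Inter> \<I> \<in> closed_sieves P c"
proof (intro closed_sievesI presievesI)
  show "\<exists>e. g \<in> homs C e c \<and> y \<in> carrier (fib P e)" if "(g, y) \<in> \<Inter> \<I>" for g y
    using that ne presieve_elem[OF closed_presieve[OF \<I>]] by blast
  show "(g \<cdot> h, z) \<in> \<Inter> \<I>"
    if "(g, y) \<in> \<Inter> \<I>" "g \<in> homs C e c" "y \<in> carrier (fib P e)" "h \<in> homs C a e"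
      "z \<in> carrier (fib P a)" "z \<sqsubseteq>[a] reindex P h y" for g y e h z a
    using that presieve_down[OF closed_presieve[OF \<I>]] by blast
  show "(g, \<Squnion>\<^bsub>fib P e\<^esub> Y) \<in> \<Inter> \<I>"
    if "g \<in> homs C e c" "Y \<subseteq> carrier (fib P e)" "\<And>y. y \<in> Y \<Longrightarrow> (g, y) \<in> \<Inter> \<I>" for g e Y
    using that closed_sup[OF \<I>] by blast
qed

lemma closed_Int: "I \<in> closed_sieves P c \<Longrightarrow> J \<in> closed_sieves P c \<Longrightarrow> I \<inter> J \<in> closed_sieves P c"
  using closed_Inter[of "{I, J}" c] by auto

lemma gen_least: "K \<in> closed_sieves P c \<Longrightarrow> G \<subseteq> K \<Longrightarrow> gen_sieve P c G \<subseteq> K"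
  by (auto simp: gen_sieve_def)

lemma gen_upper: "G \<subseteq> gen_sieve P c G"
  by (auto simp: gen_sieve_def)

text \<open>The total sieve is a member of the intersected family, which must not be empty since
  \<open>\<Inter> {}\<close> is the whole type.\<close>

lemma gen_closed:
  assumes c: "c \<in> Obj C" and G: "G \<subseteq> principal_sieve P c \<top>\<^bsub>fib P c\<^esub>"
  shows "gen_sieve P c G \<in> closed_sieves P c"
  unfolding gen_sieve_def
  using G principal_closed frame_top(1)[OF D(3)[OF c]] by (intro closed_Inter) auto

section \<open>Pullback of sieves and its right adjoint\<close>

lemma pull_iff: "f \<in> homs C a b \<Longrightarrow> g \<in> homs C e a \<Longrightarrow> (g, y) \<in> pull_sieve P f I \<longleftrightarrow> (f \<cdot> g, y) \<in> I"
  by (auto simp: pull_sieve_def homs_iff)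

lemma pull_elem:
  assumes f: "f \<in> homs C a b" and "I \<in> presieves P b" "(g, y) \<in> pull_sieve P f I"
  shows "g \<in> homs C (Dom C g) a" "y \<in> carrier (fib P (Dom C g))" "(f \<cdot> g, y) \<in> I"
proof -
  show g: "g \<in> homs C (Dom C g) a" and I: "(f \<cdot> g, y) \<in> I"
    using assms by (auto simp: pull_sieve_def homs_iff)
  show "y \<in> carrier (fib P (Dom C g))"
    using presieve_elem(2)[OF assms(2) I] cmp_homs[OF f g] by (simp add: homs_iff)
qed

lemma pull_closed:
  assumes f: "f \<in> homs C a b" and I: "I \<in> closed_sieves P b"
  shows "pull_sieve P f I \<in> closed_sieves P a"
proof (intro closed_sievesI presievesI)
  note I' = closed_presieve[OF I]
  show "\<exists>e. g \<in> homs C e a \<and> y \<in> carrier (fib P e)" if "(g, y) \<in> pull_sieve P f I" for g y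
    using pull_elem[OF f I' that] by blast
  show "(g \<cdot> h, z) \<in> pull_sieve P f I"
    if "(g, y) \<in> pull_sieve P f I" "g \<in> homs C e a" "y \<in> carrier (fib P e)" "h \<in> homs C i e"
      "z \<in> carrier (fib P i)" "z \<sqsubseteq>[i] reindex P h y" for g y e h z i
    using presieve_down[OF I' _ cmp_homs[OF f that(2)] that(4,5,6)] that(1) cmp_assoc[OF f that(2,4)]
    by (simp add: pull_iff[OF f that(2)] pull_iff[OF f cmp_homs[OF that(2,4)]])
  show "(g, \<Squnion>\<^bsub>fib P e\<^esub> Y) \<in> pull_sieve P f I"
    if "g \<in> homs C e a" "Y \<subseteq> carrier (fib P e)" "\<And>y. y \<in> Y \<Longrightarrow> (g, y) \<in> pull_sieve P f I" for g e Y
    using closed_sup[OF I cmp_homs[OF f that(1)] that(2)] that(3) by (simp add: pull_iff[OF f that(1)])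
qed

lemma univ_iff:
  "f \<in> homs C a b \<Longrightarrow> g \<in> homs C e b \<Longrightarrow> (g, y) \<in> univ_sieve P f K \<longleftrightarrow> y \<in> carrier (fib P e) \<and>
   (\<forall>i h l z. h \<in> homs C i e \<and> l \<in> homs C i a \<and> g \<cdot> h = f \<cdot> l \<and> z \<in> carrier (fib P i) \<and>
      z \<sqsubseteq>[i] reindex P h y \<longrightarrow> (l, z) \<in> K)"
  by (auto simp: univ_sieve_def homs_iff)

lemma univ_elem:
  assumes "f \<in> homs C a b" "(g, y) \<in> univ_sieve P f K"
  shows "g \<in> homs C (Dom C g) b" "y \<in> carrier (fib P (Dom C g))"
  using assms by (auto simp: univ_sieve_def homs_iff)

text \<open>Membership quantifies over all squares from \<open>g\<close> to \<open>f\<close>, so it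
  is stable under precomposition. For a join over \<open>g\<close>, an element below the reindexed
  join is cut into pieces below reindexed members, and closedness of \<open>K\<close> puts the
  pieces together again.\<close>

lemma univ_closed:
  assumes f: "f \<in> homs C a b" and K: "K \<in> closed_sieves P a"
  shows "univ_sieve P f K \<in> closed_sieves P b"
proof (intro closed_sievesI presievesI)
  show "\<exists>e. g \<in> homs C e b \<and> y \<in> carrier (fib P e)" if "(g, y) \<in> univ_sieve P f K" for g y
    using univ_elem[OF f that] by blast
  show "(g \<cdot> k, x) \<in> univ_sieve P f K"
    if gy: "(g, y) \<in> univ_sieve P f K" and g: "g \<in> homs C e b" and y: "y \<in> carrier (fib P e)"
      and k: "k \<in> homs C j e" and x: "x \<in> carrier (fib P j)" "x \<sqsubseteq>[j] reindex P k y" for g y e k x j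
    unfolding univ_iff[OF f cmp_homs[OF g k]]
  proof (intro conjI allI impI; (elim conjE)?)
    fix i h l z assume h: "h \<in> homs C i j" and l: "l \<in> homs C i a" and e: "(g \<cdot> k) \<cdot> h = f \<cdot> l"
      and z: "z \<in> carrier (fib P i)" "z \<sqsubseteq>[i] reindex P h x"
    have "g \<cdot> (k \<cdot> h) = f \<cdot> l"
      using e cmp_assoc[OF g k h] by simp
    moreover have "z \<sqsubseteq>[i] reindex P (k \<cdot> h) y"
      by (rule le_reindex_cmp[OF k h y x z])
    ultimately show "(l, z) \<in> K"
      using gy cmp_homs[OF k h] l z(1) unfolding univ_iff[OF f g] by blast
  qed (rule x(1))
  show "(g, \<Squnion>\<^bsub>fib P e\<^esub> Y) \<in> univ_sieve P f K"
    if g: "g \<in> homs C e b" and Y: "Y \<subseteq> carrier (fib P e)"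
      and gY: "\<And>y. y \<in> Y \<Longrightarrow> (g, y) \<in> univ_sieve P f K" for g e Y
    unfolding univ_iff[OF f g]
  proof (intro conjI allI impI; (elim conjE)?)
    fix i h l z assume h: "h \<in> homs C i e" and l: "l \<in> homs C i a" and e: "g \<cdot> h = f \<cdot> l"
      and z: "z \<in> carrier (fib P i)" "z \<sqsubseteq>[i] reindex P h (\<Squnion>\<^bsub>fib P e\<^esub> Y)"
    obtain Z where Z: "Z \<subseteq> carrier (fib P i)" "\<Squnion>\<^bsub>fib P i\<^esub> Z = z"
      "\<And>z'. z' \<in> Z \<Longrightarrow> z' \<sqsubseteq>[i] z \<and> (\<exists>y \<in> Y. z' \<sqsubseteq>[i] reindex P h y)"
      by (rule le_reindex_sup_pieces[OF h Y z]) blast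
    have "(l, z') \<in> K" if "z' \<in> Z" for z'
      using Z(1) Z(3)[OF that] that gY h l e unfolding univ_iff[OF f g] by blast
    then show "(l, z) \<in> K"
      using closed_sup[OF K l Z(1)] Z(2) by simp
  qed (rule frame_sup(1)[OF frame(1)[OF g] Y])
qed

text \<open>From left to right, \<open>(f \<cdot> g, y)\<close> is tested on the square with an
  identity side. Conversely, a square \<open>g \<cdot> h = f \<cdot> l\<close> over a pair
  \<open>(g, y)\<close> of \<open>I\<close> places \<open>(l, z)\<close> in the pullback.\<close>

lemma univ_adjoint:
  assumes f: "f \<in> homs C a b" and I: "I \<in> presieves P b"
  shows "I \<subseteq> univ_sieve P f K \<longleftrightarrow> pull_sieve P f I \<subseteq> K"
proof
  assume u: "I \<subseteq> univ_sieve P f K"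
  show "pull_sieve P f I \<subseteq> K"
  proof (rule subrelI)
    fix g y assume gy: "(g, y) \<in> pull_sieve P f I"
    note g = pull_elem[OF f I gy]
    have e: "Dom C g \<in> Obj C"
      using homs_obj[OF g(1)] by blast
    have "(f \<cdot> g, y) \<in> univ_sieve P f K"
      using u g(3) by blast
    moreover have "y \<sqsubseteq>[Dom C g] reindex P (Ident C (Dom C g)) y"
      using D(5)[OF e g(2)] frame_refl[OF D(3)[OF e] g(2)] by simp
    moreover have "(f \<cdot> g) \<cdot> Ident C (Dom C g) = f \<cdot> g"
      using cmp_ident(1)[OF cmp_homs[OF f g(1)]] .
    ultimately show "(g, y) \<in> K"
      using g(1,2) ident_homs[OF e] unfolding univ_iff[OF f cmp_homs[OF f g(1)]] by blast
  qed
next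
  assume p: "pull_sieve P f I \<subseteq> K"
  show "I \<subseteq> univ_sieve P f K"
  proof (rule subrelI)
    fix g y assume gy: "(g, y) \<in> I"
    note g = presieve_elem[OF I gy]
    have "(l, z) \<in> K"
      if "h \<in> homs C i (Dom C g)" "l \<in> homs C i a" "g \<cdot> h = f \<cdot> l" "z \<in> carrier (fib P i)"
        "z \<sqsubseteq>[i] reindex P h y" for i h l z
      using presieve_down[OF I gy g(1) that(1,4,5)] that(3) p pull_iff[OF f that(2)] by auto
    then show "(g, y) \<in> univ_sieve P f K"
      using g(2) unfolding univ_iff[OF f g(1)] by blast
  qed
qed

section \<open>Implication between sieves\<close>

lemma imp_iff:
  "g \<in> homs C e c \<Longrightarrow> (g, y) \<in> imp_sieve P c J K \<longleftrightarrow> y \<in> carrier (fib P e) \<and>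
   (\<forall>i h z. h \<in> homs C i e \<and> z \<in> carrier (fib P i) \<and> z \<sqsubseteq>[i] reindex P h y \<and> (g \<cdot> h, z) \<in> J \<longrightarrow>
      (g \<cdot> h, z) \<in> K)"
  by (auto simp: imp_sieve_def homs_iff)

lemma imp_elem:
  assumes "(g, y) \<in> imp_sieve P c J K"
  shows "g \<in> homs C (Dom C g) c" "y \<in> carrier (fib P (Dom C g))"
  using assms by (auto simp: imp_sieve_def homs_iff)

lemma imp_closed:
  assumes J: "J \<in> presieves P c" and K: "K \<in> closed_sieves P c"
  shows "imp_sieve P c J K \<in> closed_sieves P c"
proof (intro closed_sievesI presievesI)
  show "\<exists>e. g \<in> homs C e c \<and> y \<in> carrier (fib P e)" if "(g, y) \<in> imp_sieve P c J K" for g y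
    using imp_elem[OF that] by blast
  show "(g \<cdot> k, x) \<in> imp_sieve P c J K"
    if gy: "(g, y) \<in> imp_sieve P c J K" and g: "g \<in> homs C e c" and y: "y \<in> carrier (fib P e)"
      and k: "k \<in> homs C j e" and x: "x \<in> carrier (fib P j)" "x \<sqsubseteq>[j] reindex P k y" for g y e k x j
    unfolding imp_iff[OF cmp_homs[OF g k]]
  proof (intro conjI allI impI; (elim conjE)?)
    fix i h z assume h: "h \<in> homs C i j" and e: "((g \<cdot> k) \<cdot> h, z) \<in> J"
      and z: "z \<in> carrier (fib P i)" "z \<sqsubseteq>[i] reindex P h x"
    have "z \<sqsubseteq>[i] reindex P (k \<cdot> h) y"
      by (rule le_reindex_cmp[OF k h y x z])
    then show "((g \<cdot> k) \<cdot> h, z) \<in> K"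
      using gy cmp_homs[OF k h] z(1) e cmp_assoc[OF g k h] unfolding imp_iff[OF g] by metis
  qed (rule x(1))
  show "(g, \<Squnion>\<^bsub>fib P e\<^esub> Y) \<in> imp_sieve P c J K"
    if g: "g \<in> homs C e c" and Y: "Y \<subseteq> carrier (fib P e)"
      and gY: "\<And>y. y \<in> Y \<Longrightarrow> (g, y) \<in> imp_sieve P c J K" for g e Y
    unfolding imp_iff[OF g]
  proof (intro conjI allI impI; (elim conjE)?)
    fix i h z assume h: "h \<in> homs C i e" and e: "(g \<cdot> h, z) \<in> J"
      and z: "z \<in> carrier (fib P i)" "z \<sqsubseteq>[i] reindex P h (\<Squnion>\<^bsub>fib P e\<^esub> Y)"
    note gh = cmp_homs[OF g h]
    obtain Z where Z: "Z \<subseteq> carrier (fib P i)" "\<Squnion>\<^bsub>fib P i\<^esub> Z = z"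
      "\<And>z'. z' \<in> Z \<Longrightarrow> z' \<sqsubseteq>[i] z \<and> (\<exists>y \<in> Y. z' \<sqsubseteq>[i] reindex P h y)"
      by (rule le_reindex_sup_pieces[OF h Y z]) blast
    have "(g \<cdot> h, z') \<in> K" if z': "z' \<in> Z" for z'
    proof -
      \<comment> \<open>The pieces stay in the antecedent because they lie below
        \<open>z\<close>.\<close>
      have "(g \<cdot> h, z') \<in> J"
        using presieve_le[OF J e gh] Z(1) Z(3)[OF z'] z' by blast
      then show ?thesis
        using Z(1) Z(3)[OF z'] z' gY h unfolding imp_iff[OF g] by blast
    qed
    then show "(g \<cdot> h, z) \<in> K"
      using closed_sup[OF K gh Z(1)] Z(2) by simp
  qed (rule frame_sup(1)[OF frame(1)[OF g] Y])
qed

lemma imp_adjoint: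
  assumes I: "I \<in> presieves P c" and J: "J \<in> presieves P c"
  shows "I \<subseteq> imp_sieve P c J K \<longleftrightarrow> I \<inter> J \<subseteq> K"
proof
  assume u: "I \<subseteq> imp_sieve P c J K"
  show "I \<inter> J \<subseteq> K"
  proof (rule subrelI)
    fix g y assume gy: "(g, y) \<in> I \<inter> J"
    then have gI: "(g, y) \<in> I" and gJ: "(g, y) \<in> J"
      by auto
    note g = presieve_elem[OF I gI]
    have e: "Dom C g \<in> Obj C"
      using homs_obj[OF g(1)] by blast
    have "y \<sqsubseteq>[Dom C g] reindex P (Ident C (Dom C g)) y"
      using D(5)[OF e g(2)] frame_refl[OF D(3)[OF e] g(2)] by simp
    moreover have "(g, y) \<in> imp_sieve P c J K"
      using u gI by blast
    ultimately show "(g, y) \<in> K"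
      using gJ g(2) ident_homs[OF e] cmp_ident(1)[OF g(1)] unfolding imp_iff[OF g(1)] by metis
  qed
next
  assume p: "I \<inter> J \<subseteq> K"
  show "I \<subseteq> imp_sieve P c J K"
  proof (rule subrelI)
    fix g y assume gy: "(g, y) \<in> I"
    note g = presieve_elem[OF I gy]
    have "(g \<cdot> h, z) \<in> K"
      if "h \<in> homs C i (Dom C g)" "z \<in> carrier (fib P i)" "z \<sqsubseteq>[i] reindex P h y" "(g \<cdot> h, z) \<in> J"
      for i h z
      using presieve_down[OF I gy g(1) that(1-3)] that(4) p by blast
    then show "(g, y) \<in> imp_sieve P c J K"
      using g(2) unfolding imp_iff[OF g(1)] by blast
  qed
qed

section \<open>Sieves generated by projections\<close>

lemma ex_closed: "I \<in> ex_sieves P c \<Longrightarrow> I \<in> closed_sieves P c"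
  by (simp add: ex_sieves_def)

lemma ex_presieve: "I \<in> ex_sieves P c \<Longrightarrow> I \<in> presieves P c"
  using ex_closed closed_presieve by blast

lemma ex_subsetI:
  assumes "I \<in> ex_sieves P c" "K \<in> closed_sieves P c"
    and "\<And>\<pi> x. (\<pi>, x) \<in> I \<Longrightarrow> \<pi> \<in> projs C c \<Longrightarrow> (\<pi>, x) \<in> K"
  shows "I \<subseteq> K"
  using assms unfolding ex_sieves_def by blast

lemma ex_sievesI:
  assumes "I \<in> closed_sieves P c"
    and "\<And>K. K \<in> closed_sieves P c \<Longrightarrow> (\<And>\<pi> x. (\<pi>, x) \<in> I \<Longrightarrow> \<pi> \<in> projs C c \<Longrightarrow> (\<pi>, x) \<in> K) \<Longrightarrow> I \<subseteq> K"
  shows "I \<in> ex_sieves P c"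
  using assms unfolding ex_sieves_def by blast

text \<open>The identity is a projection, and the pair over it already generates the principal
  sieve.\<close>

lemma ex_principal:
  assumes c: "c \<in> Obj C" and x: "x \<in> carrier (fib P c)"
  shows "principal_sieve P c x \<in> ex_sieves P c"
proof (rule ex_sievesI[OF principal_closed[OF x]])
  fix K assume K: "K \<in> closed_sieves P c"
    "\<And>\<pi> y. (\<pi>, y) \<in> principal_sieve P c x \<Longrightarrow> \<pi> \<in> projs C c \<Longrightarrow> (\<pi>, y) \<in> K"
  then have "(Ident C c, x) \<in> K"
    using principal_subset[OF x c closed_presieve[OF principal_closed[OF x]]]
      ident_proj[OF D(1,2) c] by blast
  then show "principal_sieve P c x \<subseteq> K"
    using principal_subset[OF x c closed_presieve[OF K(1)]] by blast
qed

lemma ex_gen_Union: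
  assumes c: "c \<in> Obj C" and \<I>: "\<I> \<subseteq> ex_sieves P c"
  shows "gen_sieve P c (\<Union> \<I>) \<in> ex_sieves P c"
proof (rule ex_sievesI)
  show "gen_sieve P c (\<Union> \<I>) \<in> closed_sieves P c"
    using \<I> presieve_total[OF c ex_presieve] by (intro gen_closed[OF c]) blast
  fix K assume K: "K \<in> closed_sieves P c"
    "\<And>\<pi> x. (\<pi>, x) \<in> gen_sieve P c (\<Union> \<I>) \<Longrightarrow> \<pi> \<in> projs C c \<Longrightarrow> (\<pi>, x) \<in> K"
  have "I \<subseteq> K" if "I \<in> \<I>" for I
    using that \<I> K(2) gen_upper[of "\<Union> \<I>" c] by (intro ex_subsetI[OF _ K(1)]) blast+
  then show "gen_sieve P c (\<Union> \<I>) \<subseteq> K"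
    by (intro gen_least[OF K(1)]) blast
qed

text \<open>The claim is transposed to \<open>I \<subseteq> univ_sieve P f K\<close> and tested on a
  generator \<open>(\<pi>, x)\<close>. The Beck-Chevalley square of \<open>\<pi>\<close> and
  \<open>f\<close> provides a projection \<open>\<rho>\<close> with
  \<open>(\<rho>, h\<^sup>* x)\<close> in the pullback, and every other square over
  \<open>\<pi>\<close> and \<open>f\<close> factors through this one.\<close>

lemma ex_pull:
  assumes f: "f \<in> homs C a b" and I: "I \<in> ex_sieves P b"
  shows "pull_sieve P f I \<in> ex_sieves P a"
proof (rule ex_sievesI[OF pull_closed[OF f ex_closed[OF I]]])
  note I' = ex_presieve[OF I]
  fix K assume K: "K \<in> closed_sieves P a"
    "\<And>\<pi> x. (\<pi>, x) \<in> pull_sieve P f I \<Longrightarrow> \<pi> \<in> projs C a \<Longrightarrow> (\<pi>, x) \<in> K"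
  have "I \<subseteq> univ_sieve P f K"
  proof (rule ex_subsetI[OF I univ_closed[OF f K(1)]])
    fix \<pi> x assume \<pi>x: "(\<pi>, x) \<in> I" and "\<pi> \<in> projs C b"
    then obtain d p \<pi>' where p: "is_product C d b p \<pi>' \<pi>"
      by (auto simp: projs_def)
    note \<pi> = is_productD(2)[OF p]
    have x: "x \<in> carrier (fib P p)"
      using presieve_elem(2)[OF I' \<pi>x] \<pi> by (simp add: homs_iff)
    obtain q \<rho>' \<rho> h where sq: "bc_square C d b p \<pi>' \<pi> a q \<rho>' \<rho> f h"
      using bc_square_exists[OF D(1,2) p f] .
    have q: "is_product C d a q \<rho>' \<rho>" and h: "h \<in> homs C q p" and e: "\<pi> \<cdot> h = f \<cdot> \<rho>"
      using sq by (auto simp: bc_square_def)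
    note \<rho> = is_productD(2)[OF q]
    have hx: "reindex P h x \<in> carrier (fib P q)"
      using reindex_closed[OF h x] .
    have "(\<pi> \<cdot> h, reindex P h x) \<in> I"
      using presieve_down[OF I' \<pi>x \<pi> h hx] frame_refl[OF frame(1)[OF h] hx] by simp
    moreover have "\<rho> \<in> projs C a"
      using q by (auto simp: projs_def)
    ultimately have \<rho>K: "(\<rho>, reindex P h x) \<in> K"
      using K(2) e pull_iff[OF f \<rho>] by simp
    have "(l, z) \<in> K"
      if k: "k \<in> homs C i p" and l: "l \<in> homs C i a" and kl: "\<pi> \<cdot> k = f \<cdot> l"
        and z: "z \<in> carrier (fib P i)" "z \<sqsubseteq>[i] reindex P k x" for i k l z
    proof -
      obtain u where u: "u \<in> homs C i q" "\<rho> \<cdot> u = l" "h \<cdot> u = k"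
        using bc_square_pullback[OF D(1) sq k l kl] .
      then have "z \<sqsubseteq>[i] reindex P u (reindex P h x)"
        using z(2) D(6)[OF h u(1) x] by simp
      then show ?thesis
        using presieve_down[OF closed_presieve[OF K(1)] \<rho>K \<rho> u(1) z(1)] u(2) by simp
    qed
    then show "(\<pi>, x) \<in> univ_sieve P f K"
      using x unfolding univ_iff[OF f \<pi>] by blast
  qed
  then show "pull_sieve P f I \<subseteq> K"
    using univ_adjoint[OF f I'] by blast
qed

text \<open>Two projections to \<open>c\<close> have a pullback whose diagonal is again a
  projection, by \<open>proj_comp\<close>. Implication is used twice, to reduce first
  \<open>I\<close> and then \<open>J\<close> to generators.\<close>

lemma ex_Int:
  assumes I: "I \<in> ex_sieves P c" and J: "J \<in> ex_sieves P c"
  shows "I \<inter> J \<in> ex_sieves P c"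
proof (rule ex_sievesI[OF closed_Int[OF ex_closed[OF I] ex_closed[OF J]]])
  note I' = ex_presieve[OF I] and J' = ex_presieve[OF J]
  fix K assume K: "K \<in> closed_sieves P c"
    "\<And>\<pi> x. (\<pi>, x) \<in> I \<inter> J \<Longrightarrow> \<pi> \<in> projs C c \<Longrightarrow> (\<pi>, x) \<in> K"
  have "I \<subseteq> imp_sieve P c J K"
  proof (rule ex_subsetI[OF I imp_closed[OF J' K(1)]])
    fix \<pi> x assume \<pi>x: "(\<pi>, x) \<in> I" and \<pi>p: "\<pi> \<in> projs C c"
    then obtain d p \<pi>' where p: "is_product C d c p \<pi>' \<pi>"
      by (auto simp: projs_def)
    note \<pi> = is_productD(2)[OF p]
    have x: "x \<in> carrier (fib P p)"
      using presieve_elem(2)[OF I' \<pi>x] \<pi> by (simp add: homs_iff)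
    \<comment> \<open>The presieve generated by \<open>(\<pi>, x)\<close>. It replaces
      \<open>I\<close> in the second use of implication, where the antecedent may be any
      presieve.\<close>
    let ?G = "{(\<pi> \<cdot> k, z) | k z i. k \<in> homs C i p \<and> z \<in> carrier (fib P i) \<and> z \<sqsubseteq>[i] reindex P k x}"
    have G: "?G \<in> presieves P c"
    proof (rule presievesI)
      show "\<exists>e. g \<in> homs C e c \<and> y \<in> carrier (fib P e)" if "(g, y) \<in> ?G" for g y
        using that cmp_homs[OF \<pi>] by blast
      fix g y e h z a assume gy: "(g, y) \<in> ?G" and g: "g \<in> homs C e c" and h: "h \<in> homs C a e"
        and z: "z \<in> carrier (fib P a)" "z \<sqsubseteq>[a] reindex P h y"
      obtain k i where k: "g = \<pi> \<cdot> k" "k \<in> homs C i p" "y \<in> carrier (fib P i)" "y \<sqsubseteq>[i] reindex P k x"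
        using gy by blast
      have [simp]: "i = e"
        using g cmp_homs[OF \<pi> k(2)] k(1) by (simp add: homs_iff)
      note k = k(1) k(2-)[unfolded \<open>i = e\<close>]
      show "(g \<cdot> h, z) \<in> ?G"
        using cmp_assoc[OF \<pi> k(2) h] cmp_homs[OF k(2) h] le_reindex_cmp[OF k(2) h x k(3,4) z] z(1) k(1)
        by (intro CollectI exI[of _ "k \<cdot> h"] exI[of _ z] exI[of _ a]) simp
    qed
    have "J \<subseteq> imp_sieve P c ?G K"
    proof (rule ex_subsetI[OF J imp_closed[OF G K(1)]])
      fix \<rho> y assume \<rho>y: "(\<rho>, y) \<in> J" and \<rho>p: "\<rho> \<in> projs C c"
      then obtain q where \<rho>: "\<rho> \<in> homs C q c" and y: "y \<in> carrier (fib P q)"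
        using presieve_elem[OF J' \<rho>y] by blast
      obtain w b' b a where sq: "bc_square C d c p \<pi>' \<pi> q w b' b \<rho> a"
        using bc_square_exists[OF D(1,2) p \<rho>] .
      have w: "is_product C d q w b' b" and a: "a \<in> homs C w p" and e: "\<pi> \<cdot> a = \<rho> \<cdot> b"
        using sq by (auto simp: bc_square_def)
      note b = is_productD(2)[OF w]
      \<comment> \<open>Over the pullback \<open>w\<close>, the pair
        \<open>(\<rho> \<cdot> b, ?v)\<close> stands for the meet of
        \<open>\<Sigma>\<^sub>\<pi> x\<close> and \<open>\<Sigma>\<^sub>\<rho> y\<close>, as
        Frobenius and Beck-Chevalley predict.\<close>
      let ?v = "reindex P a x \<sqinter>\<^bsub>fib P w\<^esub> reindex P b y"
      note v = frame_meet[OF frame(1)[OF a] reindex_closed[OF a x] reindex_closed[OF b y]]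
      have "(\<pi> \<cdot> a, ?v) \<in> I"
        using presieve_down[OF I' \<pi>x \<pi> a v(1,2)] .
      moreover have "(\<rho> \<cdot> b, ?v) \<in> J"
        using presieve_down[OF J' \<rho>y \<rho> b v(1,3)] .
      moreover have "b \<in> projs C (Dom C \<rho>)"
        using w \<rho> by (auto simp: projs_def homs_iff)
      then have "\<rho> \<cdot> b \<in> projs C c"
        by (rule proj_comp[OF D(1,2) \<rho>p])
      ultimately have vK: "(\<rho> \<cdot> b, ?v) \<in> K"
        using K(2) e by simp
      have "(\<rho> \<cdot> h, z) \<in> K"
        if h: "h \<in> homs C i q" and z: "z \<in> carrier (fib P i)" "z \<sqsubseteq>[i] reindex P h y" and G: "(\<rho> \<cdot> h, z) \<in> ?G"
        for i h z
      proof -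
        obtain k i' where k: "\<rho> \<cdot> h = \<pi> \<cdot> k" "k \<in> homs C i' p" "z \<sqsubseteq>[i'] reindex P k x"
          using G by blast
        have "i' = i"
          using cmp_homs[OF \<rho> h] cmp_homs[OF \<pi> k(2)] k(1) by (simp add: homs_iff)
        note k = k[unfolded this]
        obtain u where u: "u \<in> homs C i w" "b \<cdot> u = h" "a \<cdot> u = k"
          using bc_square_pullback[OF D(1) sq k(2) h k(1)[symmetric]] .
        have "reindex P u ?v = reindex P k x \<sqinter>\<^bsub>fib P i\<^esub> reindex P h y"
          using frame_hom_meet[OF D(4)[OF u(1)] reindex_closed[OF a x] reindex_closed[OF b y]]
            D(6)[OF a u(1) x] D(6)[OF b u(1) y] u by simp
        then have "z \<sqsubseteq>[i] reindex P u ?v"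
          using frame_meet(4)[OF frame(1)[OF h] reindex_closed[OF k(2) x] reindex_closed[OF h y] z(1) k(3) z(2)]
          by simp
        then show ?thesis
          using presieve_down[OF closed_presieve[OF K(1)] vK cmp_homs[OF \<rho> b] u(1) z(1)]
            cmp_assoc[OF \<rho> b u(1)] u(2) by simp
      qed
      then show "(\<rho>, y) \<in> imp_sieve P c ?G K"
        using y unfolding imp_iff[OF \<rho>] by blast
    qed
    then have "J \<inter> ?G \<subseteq> K"
      using imp_adjoint[OF J' G] by blast
    then have "(\<pi> \<cdot> h, z) \<in> K"
      if "h \<in> homs C i p" "z \<in> carrier (fib P i)" "z \<sqsubseteq>[i] reindex P h x" "(\<pi> \<cdot> h, z) \<in> J" for i h z
      using that by blast
    then show "(\<pi>, x) \<in> imp_sieve P c J K"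
      using x unfolding imp_iff[OF \<pi>] by blast
  qed
  then show "I \<inter> J \<subseteq> K"
    using imp_adjoint[OF I' J'] by blast
qed

section \<open>Direct images of sieves\<close>

lemma sigma_subset:
  assumes f: "f \<in> homs C a b" and I: "I \<in> presieves P a" and K: "K \<in> closed_sieves P b"
  shows "sigma_sieve P f I \<subseteq> K \<longleftrightarrow> I \<subseteq> pull_sieve P f K"
proof -
  have cod: "Cod C f = b"
    using f by (simp add: homs_iff)
  have "sigma_sieve P f I \<subseteq> K \<longleftrightarrow> (\<lambda>(g, y). (f \<cdot> g, y)) ` I \<subseteq> K"
    using gen_least[OF K] gen_upper[of "(\<lambda>(g, y). (f \<cdot> g, y)) ` I" b]
    by (auto simp: sigma_sieve_def cod)
  also have "\<dots> \<longleftrightarrow> I \<subseteq> pull_sieve P f K"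
    using pull_iff[OF f presieve_elem(1)[OF I]] by (auto simp: image_subset_iff)
  finally show ?thesis .
qed

lemma sigma_closed:
  assumes f: "f \<in> homs C a b" and I: "I \<in> presieves P a"
  shows "sigma_sieve P f I \<in> closed_sieves P b"
proof -
  have b: "b \<in> Obj C" and cod: "Cod C f = b"
    using f homs_obj[OF f] by (auto simp: homs_iff)
  have "(f \<cdot> g, y) \<in> principal_sieve P b \<top>\<^bsub>fib P b\<^esub>" if "(g, y) \<in> I" for g y
    using presieve_elem[OF I that] cmp_homs[OF f, of g] by (auto simp: total_eq[OF b] homs_iff)
  then show ?thesis
    unfolding sigma_sieve_def cod by (intro gen_closed[OF b]) auto
qed

lemma sigma_unit:
  assumes f: "f \<in> homs C a b" and I: "I \<in> presieves P a"
  shows "I \<subseteq> pull_sieve P f (sigma_sieve P f I)"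
  using sigma_subset[OF f I sigma_closed[OF f I]] by simp

text \<open>Composition with \<open>\<pi>\<close> sends generators to generators, since composites
  of projections are projections.\<close>

lemma ex_sigma:
  assumes \<pi>: "\<pi> \<in> projs C c" and p: "\<pi> \<in> homs C p c" and I: "I \<in> ex_sieves P p"
  shows "sigma_sieve P \<pi> I \<in> ex_sieves P c"
proof (rule ex_sievesI[OF sigma_closed[OF p ex_presieve[OF I]]])
  fix K assume K: "K \<in> closed_sieves P c"
    "\<And>\<rho> x. (\<rho>, x) \<in> sigma_sieve P \<pi> I \<Longrightarrow> \<rho> \<in> projs C c \<Longrightarrow> (\<rho>, x) \<in> K"
  have "I \<subseteq> pull_sieve P \<pi> K"
  proof (rule ex_subsetI[OF I pull_closed[OF p K(1)]])
    fix \<rho> x assume \<rho>x: "(\<rho>, x) \<in> I" and \<rho>: "\<rho> \<in> projs C p"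
    have h: "\<rho> \<in> homs C (Dom C \<rho>) p"
      using projs_homs[OF \<rho>] .
    have "(\<pi> \<cdot> \<rho>, x) \<in> sigma_sieve P \<pi> I"
      using sigma_unit[OF p ex_presieve[OF I]] \<rho>x pull_iff[OF p h] by blast
    moreover have "\<pi> \<cdot> \<rho> \<in> projs C c"
      using \<rho> p by (intro proj_comp[OF D(1,2) \<pi>]) (simp add: homs_iff)
    ultimately show "(\<rho>, x) \<in> pull_sieve P \<pi> K"
      using K(2) pull_iff[OF p h] by blast
  qed
  then show "sigma_sieve P \<pi> I \<subseteq> K"
    using sigma_subset[OF p ex_presieve[OF I] K(1)] by blast
qed

text \<open>One inclusion is formal. For the other, transposing along \<open>sigma_sieve\<close> and
  \<open>imp_sieve\<close> leaves a check on single pairs of \<open>I\<close>, where both sides only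
  compose with \<open>f\<close>. The arrow \<open>f\<close> is arbitrary.\<close>

lemma sigma_frobenius:
  assumes f: "f \<in> homs C a b" and I: "I \<in> closed_sieves P a" and J: "J \<in> closed_sieves P b"
  shows "J \<inter> sigma_sieve P f I = sigma_sieve P f (pull_sieve P f J \<inter> I)"
proof
  note I' = closed_presieve[OF I] and J' = closed_presieve[OF J]
  have JI: "pull_sieve P f J \<inter> I \<in> presieves P a"
    using closed_presieve[OF closed_Int[OF pull_closed[OF f J] I]] .
  note S = sigma_closed[OF f I'] and S' = sigma_closed[OF f JI]
  show "sigma_sieve P f (pull_sieve P f J \<inter> I) \<subseteq> J \<inter> sigma_sieve P f I"
    using sigma_unit[OF f I'] sigma_subset[OF f JI J] sigma_subset[OF f JI S] by blast
  have "I \<subseteq> pull_sieve P f (imp_sieve P b J (sigma_sieve P f (pull_sieve P f J \<inter> I)))"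
  proof (rule subrelI)
    fix g y assume gy: "(g, y) \<in> I"
    note g = presieve_elem[OF I' gy]
    have "((f \<cdot> g) \<cdot> h, z) \<in> sigma_sieve P f (pull_sieve P f J \<inter> I)"
      if h: "h \<in> homs C i (Dom C g)" and z: "z \<in> carrier (fib P i)" "z \<sqsubseteq>[i] reindex P h y"
        and zJ: "((f \<cdot> g) \<cdot> h, z) \<in> J" for i h z
    proof -
      note gh = cmp_homs[OF g(1) h]
      have "(g \<cdot> h, z) \<in> pull_sieve P f J \<inter> I"
        using presieve_down[OF I' gy g(1) h z] zJ cmp_assoc[OF f g(1) h] pull_iff[OF f gh] by simp
      then have "(g \<cdot> h, z) \<in> pull_sieve P f (sigma_sieve P f (pull_sieve P f J \<inter> I))"
        using sigma_unit[OF f JI] by blast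
      then show ?thesis
        using pull_iff[OF f gh] cmp_assoc[OF f g(1) h] by simp
    qed
    then show "(g, y) \<in> pull_sieve P f (imp_sieve P b J (sigma_sieve P f (pull_sieve P f J \<inter> I)))"
      using g(2) unfolding pull_iff[OF f g(1)] imp_iff[OF cmp_homs[OF f g(1)]] by blast
  qed
  then have "sigma_sieve P f I \<subseteq> imp_sieve P b J (sigma_sieve P f (pull_sieve P f J \<inter> I))"
    using sigma_subset[OF f I' imp_closed[OF J' S']] by blast
  then show "J \<inter> sigma_sieve P f I \<subseteq> sigma_sieve P f (pull_sieve P f J \<inter> I)"
    using imp_adjoint[OF closed_presieve[OF S] J'] by blast
qed

text \<open>The first inclusion is the pullback property: after transposing along
  \<open>\<pi>\<close> and \<open>f\<close>, a pair \<open>(g, y)\<close> of \<open>I\<close> and a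
  square over \<open>\<pi> \<cdot> g\<close> and \<open>f\<close> yield an arrow into
  \<open>q\<close>. The reverse inclusion follows from commutativity of the square.\<close>

lemma sigma_beck_chevalley:
  assumes sq: "bc_square C d c p \<pi>' \<pi> c' q \<rho>' \<rho> f h" and I: "I \<in> closed_sieves P p"
  shows "pull_sieve P f (sigma_sieve P \<pi> I) = sigma_sieve P \<rho> (pull_sieve P h I)"
proof
  have f: "f \<in> homs C c' c" and h: "h \<in> homs C q p" and \<pi>: "\<pi> \<in> homs C p c" and \<rho>: "\<rho> \<in> homs C q c'"
    and e: "\<pi> \<cdot> h = f \<cdot> \<rho>"
    using sq by (auto simp: bc_square_def is_product_def)
  note I' = closed_presieve[OF I] and hI = pull_closed[OF h I]
  note S = sigma_closed[OF \<pi> I'] and S' = sigma_closed[OF \<rho> closed_presieve[OF hI]]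
  have "I \<subseteq> pull_sieve P \<pi> (univ_sieve P f (sigma_sieve P \<rho> (pull_sieve P h I)))"
  proof (rule subrelI)
    fix g y assume gy: "(g, y) \<in> I"
    note g = presieve_elem[OF I' gy]
    have "(l, z) \<in> sigma_sieve P \<rho> (pull_sieve P h I)"
      if k: "k \<in> homs C i (Dom C g)" and l: "l \<in> homs C i c'" and kl: "(\<pi> \<cdot> g) \<cdot> k = f \<cdot> l"
        and z: "z \<in> carrier (fib P i)" "z \<sqsubseteq>[i] reindex P k y" for i k l z
    proof -
      obtain u where u: "u \<in> homs C i q" "\<rho> \<cdot> u = l" "h \<cdot> u = g \<cdot> k"
        using bc_square_pullback[OF D(1) sq cmp_homs[OF g(1) k] l] kl cmp_assoc[OF \<pi> g(1) k] by metis
      have "(u, z) \<in> pull_sieve P h I"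
        using presieve_down[OF I' gy g(1) k z] u(3) pull_iff[OF h u(1)] by simp
      then have "(u, z) \<in> pull_sieve P \<rho> (sigma_sieve P \<rho> (pull_sieve P h I))"
        using sigma_unit[OF \<rho> closed_presieve[OF hI]] by blast
      then show ?thesis
        using pull_iff[OF \<rho> u(1)] u(2) by simp
    qed
    then show "(g, y) \<in> pull_sieve P \<pi> (univ_sieve P f (sigma_sieve P \<rho> (pull_sieve P h I)))"
      using g(2) unfolding pull_iff[OF \<pi> g(1)] univ_iff[OF f cmp_homs[OF \<pi> g(1)]] by blast
  qed
  then have "sigma_sieve P \<pi> I \<subseteq> univ_sieve P f (sigma_sieve P \<rho> (pull_sieve P h I))"
    using sigma_subset[OF \<pi> I' univ_closed[OF f S']] by blast
  then show "pull_sieve P f (sigma_sieve P \<pi> I) \<subseteq> sigma_sieve P \<rho> (pull_sieve P h I)"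
    using univ_adjoint[OF f closed_presieve[OF S]] by blast
  have "pull_sieve P h I \<subseteq> pull_sieve P \<rho> (pull_sieve P f (sigma_sieve P \<pi> I))"
  proof (rule subrelI)
    fix g y assume gy: "(g, y) \<in> pull_sieve P h I"
    note g = pull_elem[OF h I' gy]
    note hg = cmp_homs[OF h g(1)]
    have "(\<pi> \<cdot> h \<cdot> g, y) \<in> sigma_sieve P \<pi> I"
      using sigma_unit[OF \<pi> I'] g(3) pull_iff[OF \<pi> hg] by blast
    then show "(g, y) \<in> pull_sieve P \<rho> (pull_sieve P f (sigma_sieve P \<pi> I))"
      using cmp_assoc[OF \<pi> h g(1)] cmp_assoc[OF f \<rho> g(1)] e
      by (simp add: pull_iff[OF \<rho> g(1)] pull_iff[OF f cmp_homs[OF \<rho> g(1)]])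
  qed
  then show "sigma_sieve P \<rho> (pull_sieve P h I) \<subseteq> pull_sieve P f (sigma_sieve P \<pi> I)"
    using sigma_subset[OF \<rho> closed_presieve[OF hI] pull_closed[OF f S]] by blast
qed

section \<open>Distributivity, and functoriality of pullback\<close>

lemma pull_gen:
  assumes f: "f \<in> homs C a b" and \<I>: "\<I> \<subseteq> closed_sieves P b"
  shows "pull_sieve P f (gen_sieve P b (\<Union> \<I>)) = gen_sieve P a (\<Union> (pull_sieve P f ` \<I>))"
proof
  have a: "a \<in> Obj C" and b: "b \<in> Obj C"
    using homs_obj[OF f] by auto
  have "\<Union> \<I> \<subseteq> principal_sieve P b \<top>\<^bsub>fib P b\<^esub>"
    using \<I> presieve_total[OF b closed_presieve] by blast
  note G = gen_closed[OF b this]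
  have "\<Union> (pull_sieve P f ` \<I>) \<subseteq> principal_sieve P a \<top>\<^bsub>fib P a\<^esub>"
    using \<I> presieve_total[OF a closed_presieve[OF pull_closed[OF f]]] by blast
  note H = gen_closed[OF a this]
  \<comment> \<open>Pullback preserves joins because it has a right adjoint: the claim for the
    generated sieve follows from the claim for each member of the family.\<close>
  have "I \<subseteq> univ_sieve P f (gen_sieve P a (\<Union> (pull_sieve P f ` \<I>)))" if "I \<in> \<I>" for I
    using that \<I> univ_adjoint[OF f closed_presieve] gen_upper[of "\<Union> (pull_sieve P f ` \<I>)" a] by blast
  then have "gen_sieve P b (\<Union> \<I>) \<subseteq> univ_sieve P f (gen_sieve P a (\<Union> (pull_sieve P f ` \<I>)))"
    by (intro gen_least[OF univ_closed[OF f H]]) blast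
  then show "pull_sieve P f (gen_sieve P b (\<Union> \<I>)) \<subseteq> gen_sieve P a (\<Union> (pull_sieve P f ` \<I>))"
    using univ_adjoint[OF f closed_presieve[OF G]] by blast
  have "pull_sieve P f I \<subseteq> pull_sieve P f (gen_sieve P b (\<Union> \<I>))" if "I \<in> \<I>" for I
    using that gen_upper[of "\<Union> \<I>" b] by (auto simp: pull_sieve_def)
  then show "gen_sieve P a (\<Union> (pull_sieve P f ` \<I>)) \<subseteq> pull_sieve P f (gen_sieve P b (\<Union> \<I>))"
    by (intro gen_least[OF pull_closed[OF f G]]) blast
qed

text \<open>The same argument with \<open>imp_sieve\<close>, the right adjoint of intersection. It
  becomes the distributive law of the completed fibres.\<close>

lemma Int_gen:
  assumes c: "c \<in> Obj C" and J: "J \<in> closed_sieves P c" and \<I>: "\<I> \<subseteq> closed_sieves P c"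
  shows "J \<inter> gen_sieve P c (\<Union> \<I>) = gen_sieve P c (\<Union> ((\<inter>) J ` \<I>))"
proof
  note J' = closed_presieve[OF J]
  have t: "\<Union> \<I> \<subseteq> principal_sieve P c \<top>\<^bsub>fib P c\<^esub>"
    using \<I> presieve_total[OF c closed_presieve] by blast
  note G = gen_closed[OF c t]
  have "\<Union> ((\<inter>) J ` \<I>) \<subseteq> principal_sieve P c \<top>\<^bsub>fib P c\<^esub>"
    using t by blast
  note H = gen_closed[OF c this]
  have "I \<subseteq> imp_sieve P c J (gen_sieve P c (\<Union> ((\<inter>) J ` \<I>)))" if "I \<in> \<I>" for I
    using that \<I> imp_adjoint[OF closed_presieve J'] gen_upper[of "\<Union> ((\<inter>) J ` \<I>)" c] by blast
  then have "gen_sieve P c (\<Union> \<I>) \<subseteq> imp_sieve P c J (gen_sieve P c (\<Union> ((\<inter>) J ` \<I>)))"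
    by (intro gen_least[OF imp_closed[OF J' H]]) blast
  then show "J \<inter> gen_sieve P c (\<Union> \<I>) \<subseteq> gen_sieve P c (\<Union> ((\<inter>) J ` \<I>))"
    using imp_adjoint[OF closed_presieve[OF G] J'] by blast
  show "gen_sieve P c (\<Union> ((\<inter>) J ` \<I>)) \<subseteq> J \<inter> gen_sieve P c (\<Union> \<I>)"
    using gen_upper[of "\<Union> \<I>" c] by (intro gen_least[OF closed_Int[OF J G]]) blast
qed

lemma pull_ident:
  assumes c: "c \<in> Obj C" and I: "I \<in> presieves P c"
  shows "pull_sieve P (Ident C c) I = I"
proof -
  note i = ident_homs[OF c]
  have "(g, y) \<in> pull_sieve P (Ident C c) I \<longleftrightarrow> (g, y) \<in> I" for g y
    using pull_elem[OF i I] presieve_elem(1)[OF I] pull_iff[OF i] cmp_ident(2) by metis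
  then show ?thesis
    by auto
qed

lemma pull_cmp:
  assumes g: "g \<in> homs C b c" and f: "f \<in> homs C a b" and I: "I \<in> closed_sieves P c"
  shows "pull_sieve P (g \<cdot> f) I = pull_sieve P f (pull_sieve P g I)"
proof -
  note I' = closed_presieve[OF I] and gI = closed_presieve[OF pull_closed[OF g I]]
  have "(k, y) \<in> pull_sieve P (g \<cdot> f) I \<longleftrightarrow> (k, y) \<in> pull_sieve P f (pull_sieve P g I)"
    if k: "k \<in> homs C (Dom C k) a" for k y
    using cmp_assoc[OF g f k] pull_iff[OF cmp_homs[OF g f] k] pull_iff[OF f k] pull_iff[OF g cmp_homs[OF f k]]
    by simp
  then show ?thesis
    using pull_elem(1)[OF cmp_homs[OF g f] I'] pull_elem(1)[OF f gI] by auto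
qed

lemma pull_principal:
  assumes f: "f \<in> homs C a b" and x: "x \<in> carrier (fib P b)"
  shows "pull_sieve P f (principal_sieve P b x) = principal_sieve P a (reindex P f x)"
proof -
  have "(k, y) \<in> pull_sieve P f (principal_sieve P b x) \<longleftrightarrow> (k, y) \<in> principal_sieve P a (reindex P f x)"
    if k: "k \<in> homs C (Dom C k) a" for k y
    using D(6)[OF f k x] by (simp add: pull_iff[OF f k] principal_iff[OF cmp_homs[OF f k]] principal_iff[OF k])
  then show ?thesis
    using pull_elem(1)[OF f closed_presieve[OF principal_closed[OF x]]] principal_elem(1) by auto
qed

end

section \<open>The existential completion\<close>

text \<open>The fibres of the completion have to be carried by the type \<open>'p\<close> again; smallness provides the
  encodings of closed sieves.\<close>

definition enc :: "('o, 'm, 'p) doctrine \<Rightarrow> 'o \<Rightarrow> ('m \<times> 'p) set \<Rightarrow> 'p" where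
  "enc P c = (SOME e. inj_on e (closed_sieves P c))"

definition dec :: "('o, 'm, 'p) doctrine \<Rightarrow> 'o \<Rightarrow> 'p \<Rightarrow> ('m \<times> 'p) set" where
  "dec P c = inv_into (closed_sieves P c) (enc P c)"

definition ex_fib :: "('o, 'm, 'p) doctrine \<Rightarrow> 'o \<Rightarrow> 'p gorder" where
  "ex_fib P c = \<lparr>carrier = enc P c ` ex_sieves P c, eq = (=), le = (\<lambda>u v. dec P c u \<subseteq> dec P c v)\<rparr>"

definition ex_completion :: "('o, 'm, 'p) doctrine \<Rightarrow> ('o, 'm, 'p) doctrine" where
  "ex_completion P = \<lparr>base = base P, fib = ex_fib P,
     reindex = (\<lambda>f u. enc P (Dom (base P) f) (pull_sieve P f (dec P (Cod (base P) f) u)))\<rparr>"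

definition ex_unit :: "('o, 'm, 'p) doctrine \<Rightarrow> ('o, 'm, 'p) doc_mor" where
  "ex_unit P = \<lparr>ftr = \<lparr>fobj = (\<lambda>c \<in> Obj (base P). c), farr = (\<lambda>f \<in> Arr (base P). f)\<rparr>,
     fibmap = (\<lambda>c \<in> Obj (base P). \<lambda>x \<in> carrier (fib P c). enc P c (principal_sieve P c x))\<rparr>"

lemma ex_completion_simps [simp]:
  "base (ex_completion P) = base P" "fib (ex_completion P) = ex_fib P"
  by (simp_all add: ex_completion_def)

section \<open>The fibres of the completion as frames\<close>

locale encoded_doctrine = doctrine +
  assumes enc_inj: "c \<in> Obj (base P) \<Longrightarrow> inj_on (enc P c) (closed_sieves P c)"
begin

abbreviation E where "E \<equiv> ex_completion P"

lemma dec_enc: "c \<in> Obj C \<Longrightarrow> I \<in> closed_sieves P c \<Longrightarrow> dec P c (enc P c I) = I"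
  unfolding dec_def by (rule inv_into_f_f[OF enc_inj])

lemma dec_enc_ex [simp]: "c \<in> Obj C \<Longrightarrow> I \<in> ex_sieves P c \<Longrightarrow> dec P c (enc P c I) = I"
  by (rule dec_enc[OF _ ex_closed])

lemma enc_carrier [simp]: "I \<in> ex_sieves P c \<Longrightarrow> enc P c I \<in> carrier (ex_fib P c)"
  by (simp add: ex_fib_def)

lemma carrierE:
  assumes "u \<in> carrier (ex_fib P c)" "c \<in> Obj C"
  shows "dec P c u \<in> ex_sieves P c" "enc P c (dec P c u) = u"
  using assms by (auto simp: ex_fib_def)

lemma ex_le: "u \<sqsubseteq>\<^bsub>ex_fib P c\<^esub> v \<longleftrightarrow> dec P c u \<subseteq> dec P c v"
  by (simp add: ex_fib_def)

lemma ex_partial_order: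
  assumes c: "c \<in> Obj C"
  shows "partial_order (ex_fib P c)"
proof
  show "x .=\<^bsub>ex_fib P c\<^esub> y"
    if "x \<sqsubseteq>\<^bsub>ex_fib P c\<^esub> y" "y \<sqsubseteq>\<^bsub>ex_fib P c\<^esub> x" "x \<in> carrier (ex_fib P c)" "y \<in> carrier (ex_fib P c)" for x y
  proof -
    have "dec P c x = dec P c y"
      using that(1,2) by (simp add: ex_le)
    then have "x = y"
      using carrierE(2)[OF that(3) c] carrierE(2)[OF that(4) c] by metis
    then show ?thesis
      by (simp add: ex_fib_def)
  qed
qed (simp_all add: ex_fib_def)

lemma gen_dec_ex:
  assumes "c \<in> Obj C" "A \<subseteq> carrier (ex_fib P c)"
  shows "gen_sieve P c (\<Union> (dec P c ` A)) \<in> ex_sieves P c"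
  using assms carrierE(1) by (intro ex_gen_Union) auto

lemma ex_sup_upper:
  assumes "c \<in> Obj C" "A \<subseteq> carrier (ex_fib P c)" "a \<in> A"
  shows "a \<sqsubseteq>\<^bsub>ex_fib P c\<^esub> enc P c (gen_sieve P c (\<Union> (dec P c ` A)))"
  unfolding ex_le dec_enc_ex[OF assms(1) gen_dec_ex[OF assms(1,2)]]
  using assms(3) gen_upper[of "\<Union> (dec P c ` A)" c] by blast

lemma ex_sup_least:
  assumes "c \<in> Obj C" "A \<subseteq> carrier (ex_fib P c)" "t \<in> carrier (ex_fib P c)"
    and "\<And>a. a \<in> A \<Longrightarrow> a \<sqsubseteq>\<^bsub>ex_fib P c\<^esub> t"
  shows "enc P c (gen_sieve P c (\<Union> (dec P c ` A))) \<sqsubseteq>\<^bsub>ex_fib P c\<^esub> t"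
  unfolding ex_le dec_enc_ex[OF assms(1) gen_dec_ex[OF assms(1,2)]]
  using assms(4) by (intro gen_least[OF ex_closed[OF carrierE(1)[OF assms(3,1)]]]) (auto simp: ex_le)

text \<open>Infima are formed as joins of all lower bounds, since generation by projections has been
  established for binary intersections only.\<close>

lemma ex_complete_lattice:
  assumes c: "c \<in> Obj C"
  shows "complete_lattice (ex_fib P c)"
proof (rule partial_order.complete_latticeI[OF ex_partial_order[OF c]])
  fix A assume A: "A \<subseteq> carrier (ex_fib P c)"
  show "\<exists>s. least (ex_fib P c) s (Upper (ex_fib P c) A)"
    using ex_sup_upper[OF c A] ex_sup_least[OF c A] gen_dec_ex[OF c A] A
    by (intro exI[of _ "enc P c (gen_sieve P c (\<Union> (dec P c ` A)))"])
      (auto simp: least_def Upper_def)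
  let ?B = "Lower (ex_fib P c) A"
  have B: "?B \<subseteq> carrier (ex_fib P c)"
    by simp
  show "\<exists>i. greatest (ex_fib P c) i (Lower (ex_fib P c) A)"
  proof (intro exI[of _ "enc P c (gen_sieve P c (\<Union> (dec P c ` ?B)))"] greatest_LowerI)
    show "enc P c (gen_sieve P c (\<Union> (dec P c ` ?B))) \<sqsubseteq>\<^bsub>ex_fib P c\<^esub> a" if "a \<in> A" for a
      using that A by (intro ex_sup_least[OF c B]) (auto simp: Lower_def)
  qed (use A ex_sup_upper[OF c B] gen_dec_ex[OF c B] in auto)
qed

lemma ex_sup:
  assumes "c \<in> Obj C" "A \<subseteq> carrier (ex_fib P c)"
  shows "\<Squnion>\<^bsub>ex_fib P c\<^esub> A = enc P c (gen_sieve P c (\<Union> (dec P c ` A)))"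
  using ex_sup_upper[OF assms] ex_sup_least[OF assms] gen_dec_ex[OF assms] assms
  by (intro lattice_sup_eqI[OF ex_complete_lattice]) auto

lemma ex_sup_enc:
  assumes "c \<in> Obj C" "\<I> \<subseteq> ex_sieves P c"
  shows "\<Squnion>\<^bsub>ex_fib P c\<^esub> (enc P c ` \<I>) = enc P c (gen_sieve P c (\<Union> \<I>))"
proof -
  have "dec P c ` enc P c ` \<I> = id ` \<I>"
    unfolding image_image using assms by (intro image_cong) auto
  then show ?thesis
    using assms ex_sup[of c "enc P c ` \<I>"] by (auto simp: ex_fib_def)
qed

lemma ex_meet:
  assumes "c \<in> Obj C" "I \<in> ex_sieves P c" "J \<in> ex_sieves P c"
  shows "enc P c I \<sqinter>\<^bsub>ex_fib P c\<^esub> enc P c J = enc P c (I \<inter> J)"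
  using assms ex_Int[OF assms(2,3)]
  by (intro lattice_meet_eqI[OF ex_complete_lattice]) (auto simp: ex_le)

lemma ex_top:
  assumes c: "c \<in> Obj C"
  shows "\<top>\<^bsub>ex_fib P c\<^esub> = enc P c (principal_sieve P c \<top>\<^bsub>fib P c\<^esub>)"
proof -
  interpret L: complete_lattice "ex_fib P c"
    using ex_complete_lattice[OF c] .
  note t = ex_principal[OF c frame_top(1)[OF D(3)[OF c]]]
  have "dec P c \<top>\<^bsub>ex_fib P c\<^esub> \<subseteq> principal_sieve P c \<top>\<^bsub>fib P c\<^esub>"
    using carrierE(1)[OF L.top_closed c] by (intro presieve_total[OF c ex_presieve])
  then show ?thesis
    using t c by (intro L.le_antisym L.top_higher) (auto simp: ex_le)
qed

text \<open>The distributive law is \<open>Int_gen\<close> carried through the encoding.\<close>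

lemma ex_frame:
  assumes c: "c \<in> Obj C"
  shows "is_frame (ex_fib P c)"
  unfolding is_frame_def
proof (intro conjI ballI allI impI ex_complete_lattice[OF c])
  fix x A assume x: "x \<in> carrier (ex_fib P c)" and A: "A \<subseteq> carrier (ex_fib P c)"
  let ?J = "dec P c x" and ?I = "dec P c ` A"
  note J = carrierE(1)[OF x c]
  have I: "?I \<subseteq> ex_sieves P c"
    using A carrierE(1)[OF _ c] by auto
  have A_eq: "A = enc P c ` ?I"
    unfolding image_image using A carrierE(2)[OF _ c] by force
  have "x \<sqinter>\<^bsub>ex_fib P c\<^esub> (\<Squnion>\<^bsub>ex_fib P c\<^esub> A) = enc P c (?J \<inter> gen_sieve P c (\<Union> ?I))"
    using ex_meet[OF c J gen_dec_ex[OF c A]] carrierE(2)[OF x c] by (simp add: ex_sup[OF c A])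
  also have "\<dots> = enc P c (gen_sieve P c (\<Union> ((\<inter>) ?J ` ?I)))"
    using I ex_closed by (subst Int_gen[OF c ex_closed[OF J]]) auto
  also have "\<dots> = \<Squnion>\<^bsub>ex_fib P c\<^esub> (enc P c ` (\<inter>) ?J ` ?I)"
    using I ex_Int[OF J] by (intro ex_sup_enc[OF c, symmetric]) auto
  also have "enc P c ` (\<inter>) ?J ` ?I = (\<lambda>a. x \<sqinter>\<^bsub>ex_fib P c\<^esub> a) ` A"
  proof -
    have "enc P c ` (\<inter>) ?J ` ?I = (\<lambda>a. enc P c (?J \<inter> dec P c a)) ` A"
      by (simp add: image_image)
    also have "\<dots> = (\<lambda>a. x \<sqinter>\<^bsub>ex_fib P c\<^esub> a) ` A"
    proof (intro image_cong refl)
      fix a assume "a \<in> A"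
      then have a: "a \<in> carrier (ex_fib P c)"
        using A by auto
      show "enc P c (?J \<inter> dec P c a) = x \<sqinter>\<^bsub>ex_fib P c\<^esub> a"
        using ex_meet[OF c J carrierE(1)[OF a c]] carrierE(2)[OF x c] carrierE(2)[OF a c] by simp
    qed
    finally show ?thesis .
  qed
  finally show "x \<sqinter>\<^bsub>ex_fib P c\<^esub> (\<Squnion>\<^bsub>ex_fib P c\<^esub> A) = \<Squnion>\<^bsub>ex_fib P c\<^esub> ((\<lambda>a. x \<sqinter>\<^bsub>ex_fib P c\<^esub> a) ` A)" .
qed

section \<open>Reindexing in the completion\<close>

lemma ex_reindex: "f \<in> homs C a b \<Longrightarrow> reindex E f u = enc P a (pull_sieve P f (dec P b u))"
  by (simp add: ex_completion_def homs_iff)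

lemma ex_reindex_enc:
  "f \<in> homs C a b \<Longrightarrow> I \<in> ex_sieves P b \<Longrightarrow> reindex E f (enc P b I) = enc P a (pull_sieve P f I)"
  using homs_obj by (simp add: ex_reindex)

text \<open>Joins are preserved by \<open>pull_gen\<close>, binary meets because pullback is a
  preimage, and the top element because it is principal and preserved by reindexing in
  \<open>P\<close>.\<close>

lemma ex_reindex_frame_hom:
  assumes f: "f \<in> homs C a b"
  shows "is_frame_hom (ex_fib P b) (ex_fib P a) (reindex E f)"
proof (rule frame_homI)
  have a: "a \<in> Obj C" and b: "b \<in> Obj C"
    using homs_obj[OF f] by auto
  show "is_frame (ex_fib P b)" "is_frame (ex_fib P a)"
    using ex_frame a b by auto
  show "reindex E f x \<in> carrier (ex_fib P a)" if "x \<in> carrier (ex_fib P b)" for x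
    using ex_pull[OF f carrierE(1)[OF that b]] by (simp add: ex_reindex[OF f])
  show "reindex E f \<top>\<^bsub>ex_fib P b\<^esub> = \<top>\<^bsub>ex_fib P a\<^esub>"
    using ex_principal[OF b] frame_top(1)[OF D(3)[OF b]] pull_principal[OF f] frame_hom_top[OF D(4)[OF f]]
    by (simp add: ex_top a b ex_reindex_enc[OF f])
  show "reindex E f (x \<sqinter>\<^bsub>ex_fib P b\<^esub> y) = reindex E f x \<sqinter>\<^bsub>ex_fib P a\<^esub> reindex E f y"
    if x: "x \<in> carrier (ex_fib P b)" and y: "y \<in> carrier (ex_fib P b)" for x y
  proof -
    note I = carrierE(1)[OF x b] and J = carrierE(1)[OF y b]
    have "reindex E f (x \<sqinter>\<^bsub>ex_fib P b\<^esub> y) = enc P a (pull_sieve P f (dec P b x \<inter> dec P b y))"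
      using ex_meet[OF b I J] carrierE(2)[OF x b] carrierE(2)[OF y b] ex_reindex_enc[OF f ex_Int[OF I J]]
      by simp
    also have "pull_sieve P f (dec P b x \<inter> dec P b y) =
        pull_sieve P f (dec P b x) \<inter> pull_sieve P f (dec P b y)"
      by (auto simp: pull_sieve_def)
    finally show ?thesis
      using ex_meet[OF a ex_pull[OF f I] ex_pull[OF f J]] by (simp add: ex_reindex[OF f])
  qed
  show "reindex E f (\<Squnion>\<^bsub>ex_fib P b\<^esub> A) = \<Squnion>\<^bsub>ex_fib P a\<^esub> (reindex E f ` A)"
    if A: "A \<subseteq> carrier (ex_fib P b)" for A
  proof -
    have I: "dec P b ` A \<subseteq> ex_sieves P b"
      using A carrierE(1)[OF _ b] by auto
    have "reindex E f (\<Squnion>\<^bsub>ex_fib P b\<^esub> A) = enc P a (pull_sieve P f (gen_sieve P b (\<Union> (dec P b ` A))))"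
      using ex_reindex_enc[OF f gen_dec_ex[OF b A]] by (simp add: ex_sup[OF b A])
    also have "\<dots> = enc P a (gen_sieve P a (\<Union> (pull_sieve P f ` dec P b ` A)))"
      using I ex_closed by (subst pull_gen[OF f]) auto
    also have "\<dots> = \<Squnion>\<^bsub>ex_fib P a\<^esub> (enc P a ` pull_sieve P f ` dec P b ` A)"
      using I ex_pull[OF f] by (intro ex_sup_enc[OF a, symmetric]) auto
    also have "enc P a ` pull_sieve P f ` dec P b ` A = reindex E f ` A"
      by (simp add: image_image ex_reindex[OF f])
    finally show ?thesis .
  qed
qed

lemma ex_completion_doctrine: "is_doctrine E"
  unfolding is_doctrine_def ex_completion_simps
proof (intro conjI ballI impI D(1,2) ex_frame)
  fix f assume f: "f \<in> Arr C"
  show "is_frame_hom (ex_fib P (Cod C f)) (ex_fib P (Dom C f)) (reindex E f)"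
    using f by (intro ex_reindex_frame_hom) (simp add: homs_iff)
  fix g x assume "g \<in> Arr C" "Dom C g = Cod C f" and x: "x \<in> carrier (ex_fib P (Cod C g))"
  then have g: "g \<in> homs C (Cod C f) (Cod C g)" and f: "f \<in> homs C (Dom C f) (Cod C f)"
    using f by (auto simp: homs_iff)
  have "Cod C g \<in> Obj C"
    using homs_obj[OF g] by blast
  note I = carrierE(1)[OF x this]
  show "reindex E (g \<cdot> f) x = reindex E f (reindex E g x)"
    using pull_cmp[OF g f ex_closed[OF I]] ex_pull[OF g I]
    by (simp add: ex_reindex[OF g] ex_reindex[OF cmp_homs[OF g f]] ex_reindex_enc[OF f])
next
  fix c x assume c: "c \<in> Obj C" and x: "x \<in> carrier (ex_fib P c)"
  show "reindex E (Ident C c) x = x"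
    using pull_ident[OF c ex_presieve[OF carrierE(1)[OF x c]]] carrierE(2)[OF x c]
    by (simp add: ex_reindex[OF ident_homs[OF c]])
qed

section \<open>Existential quantification in the completion\<close>

lemma ex_sigma_adjoint:
  assumes \<pi>: "\<pi> \<in> projs C c" and p: "\<pi> \<in> homs C p c"
  shows "is_left_adjoint E \<pi> (\<lambda>u. enc P c (sigma_sieve P \<pi> (dec P p u)))"
proof -
  have c: "c \<in> Obj C" and p': "p \<in> Obj C"
    using homs_obj[OF p] by auto
  have S: "sigma_sieve P \<pi> (dec P p u) \<in> ex_sieves P c" if "u \<in> carrier (ex_fib P p)" for u
    using ex_sigma[OF \<pi> p carrierE(1)[OF that p']] .
  have "enc P c (sigma_sieve P \<pi> (dec P p u)) \<sqsubseteq>\<^bsub>ex_fib P c\<^esub> v \<longleftrightarrow> u \<sqsubseteq>\<^bsub>ex_fib P p\<^esub> reindex E \<pi> v"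
    if u: "u \<in> carrier (ex_fib P p)" and v: "v \<in> carrier (ex_fib P c)" for u v
    using sigma_subset[OF p ex_presieve[OF carrierE(1)[OF u p']] ex_closed[OF carrierE(1)[OF v c]]]
      ex_pull[OF p carrierE(1)[OF v c]] S[OF u] c p'
    by (simp add: ex_le ex_reindex[OF p])
  moreover have "\<pi> \<in> homs (base E) p c"
    using p by simp
  ultimately show ?thesis
    using S by (subst is_left_adjoint_iff[OF ex_completion_doctrine]) auto
qed

text \<open>\<open>Sig E \<pi>\<close> and the explicit formula are both left adjoint to reindexing
  along \<open>\<pi>\<close>, hence agree on the carrier.\<close>

lemma ex_Sig:
  assumes \<pi>: "\<pi> \<in> projs C c" and p: "\<pi> \<in> homs C p c" and I: "I \<in> ex_sieves P p"
  shows "Sig E \<pi> (enc P p I) = enc P c (sigma_sieve P \<pi> I)"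
proof -
  have c: "c \<in> Obj C" and p': "p \<in> Obj C"
    using homs_obj[OF p] by auto
  note F = ex_frame[OF c]
  have pE: "\<pi> \<in> homs (base E) p c"
    using p by simp
  let ?s = "\<lambda>u. enc P c (sigma_sieve P \<pi> (dec P p u))"
  note s = ex_sigma_adjoint[OF \<pi> p]
  note S = Sig_left_adjoint[OF ex_completion_doctrine pE s]
  note iff = is_left_adjoint_iff[OF ex_completion_doctrine pE, unfolded ex_completion_simps]
  have u: "enc P p I \<in> carrier (ex_fib P p)"
    using I by simp
  have "Sig E \<pi> (enc P p I) \<in> carrier (ex_fib P c)" "?s (enc P p I) \<in> carrier (ex_fib P c)"
    using s S u unfolding iff by blast+
  moreover from this have "Sig E \<pi> (enc P p I) \<sqsubseteq>\<^bsub>ex_fib P c\<^esub> ?s (enc P p I)"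
    "?s (enc P p I) \<sqsubseteq>\<^bsub>ex_fib P c\<^esub> Sig E \<pi> (enc P p I)"
    using s S u frame_refl[OF F] unfolding iff by blast+
  ultimately have "Sig E \<pi> (enc P p I) = ?s (enc P p I)"
    using frame_antisym[OF F] by blast
  then show ?thesis
    using p' I by simp
qed

lemma ex_completion_ex_doctrine: "is_ex_doctrine E"
  unfolding is_ex_doctrine_def ex_completion_simps
proof (intro conjI allI impI ballI; (elim conjE)?)
  show "is_doctrine E"
    by (rule ex_completion_doctrine)
  fix d c p \<pi>' \<pi> assume pr: "is_product C d c p \<pi>' \<pi>"
  then have \<pi>: "\<pi> \<in> projs C c" and p: "\<pi> \<in> homs C p c"
    by (auto simp: projs_def is_product_def)
  have c: "c \<in> Obj C" and p': "p \<in> Obj C"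
    using homs_obj[OF p] by auto
  show "\<exists>s. is_left_adjoint E \<pi> s"
    using ex_sigma_adjoint[OF \<pi> p] by blast
  show "x \<sqinter>\<^bsub>ex_fib P c\<^esub> Sig E \<pi> y = Sig E \<pi> (reindex E \<pi> x \<sqinter>\<^bsub>ex_fib P p\<^esub> y)"
    if x: "x \<in> carrier (ex_fib P c)" and y: "y \<in> carrier (ex_fib P p)" for x y
  proof -
    note J = carrierE[OF x c] and I = carrierE[OF y p']
    have "x \<sqinter>\<^bsub>ex_fib P c\<^esub> Sig E \<pi> y = enc P c (dec P c x \<inter> sigma_sieve P \<pi> (dec P p y))"
      using ex_meet[OF c J(1) ex_sigma[OF \<pi> p I(1)]] ex_Sig[OF \<pi> p I(1)] I(2) J(2) by simp
    also have "\<dots> = enc P c (sigma_sieve P \<pi> (pull_sieve P \<pi> (dec P c x) \<inter> dec P p y))"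
      using sigma_frobenius[OF p ex_closed[OF I(1)] ex_closed[OF J(1)]] by simp
    also have "\<dots> = Sig E \<pi> (reindex E \<pi> x \<sqinter>\<^bsub>ex_fib P p\<^esub> y)"
      using ex_meet[OF p' ex_pull[OF p J(1)] I(1)] ex_Sig[OF \<pi> p ex_Int[OF ex_pull[OF p J(1)] I(1)]] I(2)
      by (simp add: ex_reindex[OF p])
    finally show ?thesis .
  qed
  show "reindex E f (Sig E \<pi> y) = Sig E \<rho> (reindex E h y)"
    if q: "is_product C d c' q \<rho>' \<rho>" and f: "f \<in> homs C c' c" and h: "h \<in> homs C q p"
      and e: "Cmp C \<pi>' h = \<rho>'" "Cmp C \<pi> h = Cmp C f \<rho>" and y: "y \<in> carrier (ex_fib P p)"
    for c' q \<rho>' \<rho> f h y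
  proof -
    note I = carrierE[OF y p']
    have \<rho>: "\<rho> \<in> projs C c'" and \<rho>h: "\<rho> \<in> homs C q c'"
      using q by (auto simp: projs_def is_product_def)
    have "bc_square C d c p \<pi>' \<pi> c' q \<rho>' \<rho> f h"
      using pr q f h e by (simp add: bc_square_def)
    then have "pull_sieve P f (sigma_sieve P \<pi> (dec P p y)) = sigma_sieve P \<rho> (pull_sieve P h (dec P p y))"
      by (rule sigma_beck_chevalley[OF _ ex_closed[OF I(1)]])
    then show ?thesis
      using ex_Sig[OF \<pi> p I(1)] I(2) ex_Sig[OF \<rho> \<rho>h ex_pull[OF h I(1)]]
        ex_reindex_enc[OF f ex_sigma[OF \<pi> p I(1)]] ex_reindex[OF h, of y] by simp
  qed
qed

section \<open>The unit and its density\<close>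

lemma principal_frame_hom:
  assumes c: "c \<in> Obj C"
  shows "is_frame_hom (fib P c) (ex_fib P c) (\<lambda>x. enc P c (principal_sieve P c x))"
proof (rule frame_homI[OF D(3)[OF c] ex_frame[OF c]])
  note F = D(3)[OF c]
  show "enc P c (principal_sieve P c x) \<in> carrier (ex_fib P c)" if "x \<in> carrier (fib P c)" for x
    using ex_principal[OF c that] by simp
  show "enc P c (principal_sieve P c \<top>\<^bsub>fib P c\<^esub>) = \<top>\<^bsub>ex_fib P c\<^esub>"
    by (simp add: ex_top c)
  show "enc P c (principal_sieve P c (x \<sqinter>\<^bsub>fib P c\<^esub> y)) =
      enc P c (principal_sieve P c x) \<sqinter>\<^bsub>ex_fib P c\<^esub> enc P c (principal_sieve P c y)"
    if x: "x \<in> carrier (fib P c)" and y: "y \<in> carrier (fib P c)" for x y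
  proof -
    have "(g, z) \<in> principal_sieve P c (x \<sqinter>\<^bsub>fib P c\<^esub> y) \<longleftrightarrow> (g, z) \<in> principal_sieve P c x \<inter> principal_sieve P c y"
      if g: "g \<in> homs C (Dom C g) c" for g z
    proof -
      note r = reindex_closed[OF g x] reindex_closed[OF g y]
      note m = frame_meet[OF frame(1)[OF g] r]
      have "z \<sqsubseteq>[Dom C g] reindex P g x \<sqinter>\<^bsub>fib P (Dom C g)\<^esub> reindex P g y \<longleftrightarrow>
          z \<sqsubseteq>[Dom C g] reindex P g x \<and> z \<sqsubseteq>[Dom C g] reindex P g y" if "z \<in> carrier (fib P (Dom C g))"
        using m(4)[OF that] frame_trans[OF frame(1)[OF g] _ m(2) that m(1) r(1)]
          frame_trans[OF frame(1)[OF g] _ m(3) that m(1) r(2)] by blast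
      then show ?thesis
        using frame_hom_meet[OF D(4)[OF g] x y] by (auto simp: principal_iff[OF g])
    qed
    then have "(g, z) \<in> principal_sieve P c (x \<sqinter>\<^bsub>fib P c\<^esub> y) \<longleftrightarrow> (g, z) \<in> principal_sieve P c x \<inter> principal_sieve P c y"
      for g z
      using principal_elem(1)[of g z] by blast
    then have "principal_sieve P c (x \<sqinter>\<^bsub>fib P c\<^esub> y) = principal_sieve P c x \<inter> principal_sieve P c y"
      by auto
    then show ?thesis
      using ex_meet[OF c ex_principal[OF c x] ex_principal[OF c y]] by simp
  qed
  show "enc P c (principal_sieve P c (\<Squnion>\<^bsub>fib P c\<^esub> A)) =
      \<Squnion>\<^bsub>ex_fib P c\<^esub> ((\<lambda>x. enc P c (principal_sieve P c x)) ` A)" if A: "A \<subseteq> carrier (fib P c)" for A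
  proof -
    note s = frame_sup[OF F A]
    have I: "principal_sieve P c ` A \<subseteq> ex_sieves P c"
      using A ex_principal[OF c] by auto
    note G = ex_closed[OF ex_gen_Union[OF c I]]
    have "principal_sieve P c a \<subseteq> principal_sieve P c (\<Squnion>\<^bsub>fib P c\<^esub> A)" if "a \<in> A" for a
    proof -
      have a: "a \<in> carrier (fib P c)"
        using that A by auto
      show ?thesis
        using s(2)[OF that] a c D(5)[OF c s(1)]
        by (simp add: principal_subset[OF a c closed_presieve[OF principal_closed[OF s(1)]]]
            principal_iff[OF ident_homs[OF c]])
    qed
    then have "gen_sieve P c (\<Union> (principal_sieve P c ` A)) \<subseteq> principal_sieve P c (\<Squnion>\<^bsub>fib P c\<^esub> A)"
      by (intro gen_least[OF principal_closed[OF s(1)]]) blast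
    moreover have "(Ident C c, a) \<in> gen_sieve P c (\<Union> (principal_sieve P c ` A))" if "a \<in> A" for a
    proof -
      have a: "a \<in> carrier (fib P c)"
        using that A by auto
      have "principal_sieve P c a \<subseteq> gen_sieve P c (\<Union> (principal_sieve P c ` A))"
        using that gen_upper[of "\<Union> (principal_sieve P c ` A)" c] by blast
      then show ?thesis
        using principal_subset[OF a c closed_presieve[OF G]] by blast
    qed
    \<comment> \<open>Closedness under joins is used here: it puts the pair of the identity and the
      join of \<open>A\<close> into the generated sieve, so that the unit preserves joins.\<close>
    then have "principal_sieve P c (\<Squnion>\<^bsub>fib P c\<^esub> A) \<subseteq> gen_sieve P c (\<Union> (principal_sieve P c ` A))"
      using closed_sup[OF G ident_homs[OF c] A] principal_subset[OF s(1) c closed_presieve[OF G]] by blast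
    ultimately show ?thesis
      using ex_sup_enc[OF c I] by (simp add: image_image)
  qed
qed

lemma ex_unit_mor: "ex_unit P \<in> doc_mors P E"
proof -
  have i: "ftr (ex_unit P) = ftr (doc_id P)"
    by (simp add: ex_unit_def doc_id_def)
  have "is_frame_hom (fib P c) (ex_fib P c) (fibmap (ex_unit P) c)" if c: "c \<in> Obj C" for c
    using frame_hom_comp[OF frame_hom_id[OF D(3)[OF c]] principal_frame_hom[OF c] D(3)[OF c],
        of "\<lambda>x. x" "fibmap (ex_unit P) c"] c
    by (simp add: ex_unit_def)
  moreover have "fibmap (ex_unit P) (Dom C f) (reindex P f x) =
      reindex E f (fibmap (ex_unit P) (Cod C f) x)"
    if "f \<in> Arr C" and x: "x \<in> carrier (fib P (Cod C f))" for f x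
  proof -
    have f: "f \<in> homs C (Dom C f) (Cod C f)"
      using that by (simp add: homs_iff)
    note o = homs_obj[OF f]
    show ?thesis
      using o x reindex_closed[OF f x] pull_principal[OF f x] ex_principal[OF o(2) x]
      by (simp add: ex_unit_def ex_reindex_enc[OF f])
  qed
  ultimately show ?thesis
    using doc_id_mor[OF P] unfolding doc_mors_def i
    by (auto simp: doc_id_def) (auto simp: ex_unit_def)
qed

text \<open>Transposition and the Yoneda property show that \<open>\<Sigma>\<^sub>\<pi>\<close> of
  the principal sieve of \<open>x\<close> is the closed sieve generated by the single pair
  \<open>(\<pi>, x)\<close>.\<close>

lemma sigma_principal:
  assumes p: "\<pi> \<in> homs C p c" and x: "x \<in> carrier (fib P p)" and K: "K \<in> closed_sieves P c"
  shows "sigma_sieve P \<pi> (principal_sieve P p x) \<subseteq> K \<longleftrightarrow> (\<pi>, x) \<in> K"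
proof -
  have p': "p \<in> Obj C"
    using homs_obj[OF p] by blast
  show ?thesis
    using sigma_subset[OF p closed_presieve[OF principal_closed[OF x]] K]
      principal_subset[OF x p' closed_presieve[OF pull_closed[OF p K]]]
      pull_iff[OF p ident_homs[OF p']] cmp_ident(1)[OF p] by simp
qed

text \<open>Density of the unit: joins and existentials generate everything from its image. This
  gives the uniqueness of extensions.\<close>

lemma ex_sup_basic:
  assumes c: "c \<in> Obj C" and u: "u \<in> carrier (ex_fib P c)"
  shows "u = \<Squnion>\<^bsub>ex_fib P c\<^esub>
    {Sig E \<pi> (fibmap (ex_unit P) (Dom C \<pi>) x) | \<pi> x. \<pi> \<in> projs C c \<and> (\<pi>, x) \<in> dec P c u}"
proof -
  let ?S = "\<lambda>\<pi> x. sigma_sieve P \<pi> (principal_sieve P (Dom C \<pi>) x)"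
  let ?\<I> = "{?S \<pi> x | \<pi> x. \<pi> \<in> projs C c \<and> (\<pi>, x) \<in> dec P c u}"
  note U = carrierE[OF u c]
  note U' = ex_presieve[OF U(1)]
  have elem: "\<pi> \<in> homs C (Dom C \<pi>) c" "x \<in> carrier (fib P (Dom C \<pi>))" "Dom C \<pi> \<in> Obj C"
    if "(\<pi>, x) \<in> dec P c u" for \<pi> x
    using presieve_elem[OF U' that] homs_obj by auto
  have ex: "?S \<pi> x \<in> ex_sieves P c" if "\<pi> \<in> projs C c" "(\<pi>, x) \<in> dec P c u" for \<pi> x
    using ex_sigma[OF that(1) elem(1)[OF that(2)] ex_principal[OF elem(3,2)[OF that(2)]]] .
  then have I: "?\<I> \<subseteq> ex_sieves P c"
    by blast
  note G = ex_closed[OF ex_gen_Union[OF c I]]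
  have "gen_sieve P c (\<Union> ?\<I>) = dec P c u"
  proof
    show "gen_sieve P c (\<Union> ?\<I>) \<subseteq> dec P c u"
      using sigma_principal[OF elem(1,2) ex_closed[OF U(1)]] by (intro gen_least[OF ex_closed[OF U(1)]]) blast
    show "dec P c u \<subseteq> gen_sieve P c (\<Union> ?\<I>)"
    proof (rule ex_subsetI[OF U(1) G])
      fix \<pi> x assume x: "(\<pi>, x) \<in> dec P c u" and \<pi>: "\<pi> \<in> projs C c"
      have "?S \<pi> x \<subseteq> gen_sieve P c (\<Union> ?\<I>)"
        using x \<pi> gen_upper[of "\<Union> ?\<I>" c] by blast
      then show "(\<pi>, x) \<in> gen_sieve P c (\<Union> ?\<I>)"
        using sigma_principal[OF elem(1,2)[OF x] G] by blast
    qed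
  qed
  then have "u = \<Squnion>\<^bsub>ex_fib P c\<^esub> (enc P c ` ?\<I>)"
    using ex_sup_enc[OF c I] U(2) by simp
  also have "enc P c ` ?\<I> = {Sig E \<pi> (fibmap (ex_unit P) (Dom C \<pi>) x) | \<pi> x. \<pi> \<in> projs C c \<and> (\<pi>, x) \<in> dec P c u}"
  proof -
    have "Sig E \<pi> (fibmap (ex_unit P) (Dom C \<pi>) x) = enc P c (?S \<pi> x)"
      if "\<pi> \<in> projs C c" "(\<pi>, x) \<in> dec P c u" for \<pi> x
      using ex_Sig[OF that(1) elem(1)[OF that(2)] ex_principal[OF elem(3,2)[OF that(2)]]] elem[OF that(2)]
      by (simp add: ex_unit_def)
    then show ?thesis
      by (auto simp: image_iff) metis+
  qed
  finally show ?thesis .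
qed

end

text \<open>A closed sieve is determined by its pairs \<open>(g, b)\<close> with \<open>b\<close> in a basis.\<close>

lemma (in doctrine) closed_sieve_eqI:
  assumes B: "\<And>c. c \<in> Obj C \<Longrightarrow> is_basis (fib P c) (B c)"
    and I: "I \<in> closed_sieves P c" and J: "J \<in> closed_sieves P c"
    and e: "I \<inter> (SIGMA g : Arr C. B (Dom C g)) = J \<inter> (SIGMA g : Arr C. B (Dom C g))"
  shows "I = J"
proof -
  have sub: "I \<subseteq> J" if I: "I \<in> closed_sieves P c" and J: "J \<in> closed_sieves P c"
    and e: "I \<inter> (SIGMA g : Arr C. B (Dom C g)) \<subseteq> J" for I J
  proof (rule subrelI)
    fix g y assume gy: "(g, y) \<in> I"
    note g = presieve_elem[OF closed_presieve[OF I] gy]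
    let ?Y = "{b \<in> B (Dom C g). b \<sqsubseteq>[Dom C g] y}"
    have "is_basis (fib P (Dom C g)) (B (Dom C g))"
      using B homs_obj(1)[OF g(1)] .
    then have Y: "?Y \<subseteq> carrier (fib P (Dom C g))" "\<Squnion>\<^bsub>fib P (Dom C g)\<^esub> ?Y = y"
      using g(2) by (auto simp: is_basis_def)
    have "(g, b) \<in> J" if "b \<in> ?Y" for b
    proof -
      have "(g, b) \<in> I"
        using presieve_le[OF closed_presieve[OF I] gy g(1)] that Y(1) by blast
      then show ?thesis
        using that e g(1) by (auto simp: homs_iff)
    qed
    then show "(g, y) \<in> J"
      using closed_sup[OF J g(1) Y(1)] Y(2) by simp
  qed
  show ?thesis
    using sub[OF I J] sub[OF J I] e by blast
qed

section \<open>Size bounds and the existence of encodings\<close>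

lemma Sigma_lepoll:
  assumes "I \<lesssim> A" "\<And>i. i \<in> I \<Longrightarrow> B i \<lesssim> A'"
  shows "Sigma I B \<lesssim> A \<times> A'"
proof -
  obtain f where f: "inj_on f I" "f ` I \<subseteq> A"
    using assms(1) by (auto simp: lepoll_def)
  obtain g where g: "\<And>i. i \<in> I \<Longrightarrow> inj_on (g i) (B i) \<and> g i ` B i \<subseteq> A'"
    using assms(2) unfolding lepoll_def by metis
  have "inj_on (\<lambda>(i, b). (f i, g i b)) (Sigma I B)"
    using f g by (auto simp: inj_on_def)
  moreover have "(\<lambda>(i, b). (f i, g i b)) ` Sigma I B \<subseteq> A \<times> A'"
    using f g by auto
  ultimately show ?thesis
    by (auto simp: lepoll_def)
qed

text \<open>A bound for arrows and for bases is enlarged to one that also bounds the pairs of an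
  arrow and a basis element over its domain. This is where closure of \<open>S\<close> under
  products is used.\<close>

lemma small_doctrine_basis:
  assumes P: "is_small S P" and S: "\<And>A B. A \<in> S \<Longrightarrow> B \<in> S \<Longrightarrow> \<exists>C \<in> S. A \<times> B \<lesssim> C"
  obtains B A where "A \<in> S" "Arr (base P) \<lesssim> A" "\<And>c. c \<in> Obj (base P) \<Longrightarrow> is_basis (fib P c) (B c)"
    "\<And>I. I \<subseteq> Arr (base P) \<Longrightarrow> (\<And>g. g \<in> I \<Longrightarrow> Dom (base P) g \<in> Obj (base P)) \<Longrightarrow>
      (SIGMA g : I. B (Dom (base P) g)) \<lesssim> A"
proof -
  obtain A where A: "A \<in> S" "Arr (base P) \<lesssim> A"
    "\<And>c. c \<in> Obj (base P) \<Longrightarrow> \<exists>B. is_basis (fib P c) B \<and> B \<lesssim> A"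
    using P unfolding is_small_def by blast
  obtain B where B: "\<And>c. c \<in> Obj (base P) \<Longrightarrow> is_basis (fib P c) (B c) \<and> B c \<lesssim> A"
    using A(3) by metis
  obtain A' where A': "A' \<in> S" "A \<times> A \<lesssim> A'"
    using S[OF A(1,1)] by blast
  \<comment> \<open>The diagonal embedding shows that the enlarged \<open>A'\<close> still bounds
    the arrows.\<close>
  have "A \<lesssim> A \<times> A"
    unfolding lepoll_def by (intro exI[of _ "\<lambda>a. (a, a)"]) (auto simp: inj_on_def)
  then have "Arr (base P) \<lesssim> A'"
    by (rule lepoll_trans[OF lepoll_trans[OF A(2)] A'(2)])
  moreover have "(SIGMA g : I. B (Dom (base P) g)) \<lesssim> A'"
    if "I \<subseteq> Arr (base P)" "\<And>g. g \<in> I \<Longrightarrow> Dom (base P) g \<in> Obj (base P)" for I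
  proof -
    have "I \<lesssim> A"
      by (rule lepoll_trans[OF subset_imp_lepoll[OF that(1)] A(2)])
    then have "(SIGMA g : I. B (Dom (base P) g)) \<lesssim> A \<times> A"
      using B that(2) by (intro Sigma_lepoll) auto
    then show ?thesis
      by (rule lepoll_trans[OF _ A'(2)])
  qed
  ultimately show ?thesis
    using that[OF A'(1)] B by blast
qed

text \<open>A closed sieve is recorded by its trace on pairs of an arrow and a basis element. These
  pairs embed into \<open>A\<close>, so traces embed into \<open>Pow A\<close> and from there into
  the type of fibre elements.\<close>

lemma small_doctrine_encoded:
  fixes P :: "('o, 'm, 'p) doctrine"
  assumes P: "is_doctrine P" and sm: "is_small S P"
    and S: "\<And>A B. A \<in> S \<Longrightarrow> B \<in> S \<Longrightarrow> \<exists>C \<in> S. A \<times> B \<lesssim> C"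
    and Pow: "\<And>A. A \<in> S \<Longrightarrow> Pow A \<lesssim> (UNIV :: 'p set)"
  shows "encoded_doctrine P"
proof -
  interpret doctrine P
    by unfold_locales fact
  obtain B A where A: "A \<in> S" and B: "\<And>c. c \<in> Obj C \<Longrightarrow> is_basis (fib P c) (B c)"
    and BA: "\<And>I. I \<subseteq> Arr C \<Longrightarrow> (\<And>g. g \<in> I \<Longrightarrow> Dom C g \<in> Obj C) \<Longrightarrow> (SIGMA g : I. B (Dom C g)) \<lesssim> A"
    using small_doctrine_basis[OF sm S] by metis
  let ?X = "SIGMA g : Arr C. B (Dom C g)"
  have "?X \<lesssim> A"
    using category_dom_cod(1)[OF D(1)] by (intro BA) auto
  then obtain f where f: "inj_on f ?X" "f ` ?X \<subseteq> A"
    by (auto simp: lepoll_def)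
  obtain k :: "_ \<Rightarrow> 'p" where k: "inj_on k (Pow A)"
    using Pow[OF A] by (auto simp: lepoll_def)
  show ?thesis
  proof
    fix c assume "c \<in> Obj C"
    have "inj_on (\<lambda>I. k (f ` (I \<inter> ?X))) (closed_sieves P c)"
    proof (rule inj_onI)
      fix I J assume I: "I \<in> closed_sieves P c" and J: "J \<in> closed_sieves P c"
        and e: "k (f ` (I \<inter> ?X)) = k (f ` (J \<inter> ?X))"
      have "f ` (I \<inter> ?X) = f ` (J \<inter> ?X)"
        using inj_onD[OF k e] f(2) by blast
      then have "I \<inter> ?X = J \<inter> ?X"
        using inj_on_image_eq_iff[OF f(1)] by (metis inf_le2)
      then show "I = J"
        using closed_sieve_eqI[OF B I J] by blast
    qed
    then show "inj_on (enc P c) (closed_sieves P c)"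
      unfolding enc_def by (rule someI[of "\<lambda>e. inj_on e (closed_sieves P c)"])
  qed
qed

text \<open>Base arrows are unchanged, and the elements \<open>\<Sigma>\<^sub>\<pi> b\<close>, with
  \<open>b\<close> from a basis over the domain of \<open>\<pi>\<close>, form a basis of the new
  fibre. They are bounded by pairs of an arrow and a basis element, so the same \<open>A\<close>
  serves for the completion.\<close>

lemma small_ex_completion:
  fixes P :: "('o, 'm, 'p) doctrine"
  assumes P: "is_doctrine P" and sm: "is_small S P"
    and S: "\<And>A B. A \<in> S \<Longrightarrow> B \<in> S \<Longrightarrow> \<exists>C \<in> S. A \<times> B \<lesssim> C"
    and Pow: "\<And>A. A \<in> S \<Longrightarrow> Pow A \<lesssim> (UNIV :: 'p set)"
  shows "is_small S (ex_completion P)"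
proof -
  interpret encoded_doctrine P
    using small_doctrine_encoded[OF assms] .
  obtain B A where A: "A \<in> S" and AA: "Arr C \<lesssim> A" and B: "\<And>c. c \<in> Obj C \<Longrightarrow> is_basis (fib P c) (B c)"
    and BA: "\<And>I. I \<subseteq> Arr C \<Longrightarrow> (\<And>g. g \<in> I \<Longrightarrow> Dom C g \<in> Obj C) \<Longrightarrow> (SIGMA g : I. B (Dom C g)) \<lesssim> A"
    using small_doctrine_basis[OF sm S] by metis
  have "\<exists>B'. is_basis (ex_fib P c) B' \<and> B' \<lesssim> A" if c: "c \<in> Obj C" for c
  proof -
    let ?X = "SIGMA \<pi> : projs C c. B (Dom C \<pi>)"
    let ?S = "\<lambda>(\<pi>, b). sigma_sieve P \<pi> (principal_sieve P (Dom C \<pi>) b)"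
    let ?B = "(\<lambda>x. enc P c (?S x)) ` ?X"
    have X: "\<pi> \<in> projs C c" "\<pi> \<in> homs C (Dom C \<pi>) c" "b \<in> carrier (fib P (Dom C \<pi>))" "Dom C \<pi> \<in> Obj C"
      if "(\<pi>, b) \<in> ?X" for \<pi> b
    proof -
      show \<pi>: "\<pi> \<in> projs C c" "\<pi> \<in> homs C (Dom C \<pi>) c"
        using that projs_homs by auto
      show "Dom C \<pi> \<in> Obj C"
        using homs_obj[OF \<pi>(2)] by blast
      then show "b \<in> carrier (fib P (Dom C \<pi>))"
        using B[of "Dom C \<pi>"] that by (auto simp: is_basis_def)
    qed
    have ex: "?S (\<pi>, b) \<in> ex_sieves P c" if "(\<pi>, b) \<in> ?X" for \<pi> b
      using ex_sigma[OF X(1,2)[OF that] ex_principal[OF X(4,3)[OF that]]] by simp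
    have "u = \<Squnion>\<^bsub>ex_fib P c\<^esub> {b \<in> ?B. b \<sqsubseteq>\<^bsub>ex_fib P c\<^esub> u}" if u: "u \<in> carrier (ex_fib P c)" for u
    proof (rule sym, rule lattice_sup_eqI[OF ex_complete_lattice[OF c] _ u])
      show "{b \<in> ?B. b \<sqsubseteq>\<^bsub>ex_fib P c\<^esub> u} \<subseteq> carrier (ex_fib P c)"
        using ex by auto
      fix t assume t: "t \<in> carrier (ex_fib P c)"
        and le: "\<And>a. a \<in> {b \<in> ?B. b \<sqsubseteq>\<^bsub>ex_fib P c\<^esub> u} \<Longrightarrow> a \<sqsubseteq>\<^bsub>ex_fib P c\<^esub> t"
      note U = carrierE(1)[OF u c] and T = ex_closed[OF carrierE(1)[OF t c]]
      have "dec P c u \<subseteq> dec P c t"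
      proof (rule ex_subsetI[OF U T])
        fix \<pi> x assume x: "(\<pi>, x) \<in> dec P c u" and \<pi>: "\<pi> \<in> projs C c"
        note g = presieve_elem[OF ex_presieve[OF U] x]
        \<comment> \<open>The generator \<open>x\<close> is split into basis elements, each of which
          is covered by the assumption on \<open>t\<close>; closedness of the sieve of
          \<open>t\<close> under joins restores \<open>x\<close>.\<close>
        let ?Y = "{b \<in> B (Dom C \<pi>). b \<sqsubseteq>[Dom C \<pi>] x}"
        have Y: "?Y \<subseteq> carrier (fib P (Dom C \<pi>))" "\<Squnion>\<^bsub>fib P (Dom C \<pi>)\<^esub> ?Y = x"
          using B[OF homs_obj(1)[OF g(1)]] g(2) by (auto simp: is_basis_def)
        have "(\<pi>, b) \<in> dec P c t" if b: "b \<in> ?Y" for b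
        proof -
          have bX: "(\<pi>, b) \<in> ?X"
            using b \<pi> by simp
          have "(\<pi>, b) \<in> dec P c u"
            using presieve_le[OF ex_presieve[OF U] x g(1)] b Y(1) by blast
          then have "?S (\<pi>, b) \<subseteq> dec P c u"
            using sigma_principal[OF X(2,3)[OF bX] ex_closed[OF U]] by simp
          then have "enc P c (?S (\<pi>, b)) \<sqsubseteq>\<^bsub>ex_fib P c\<^esub> u"
            using ex[OF bX] c by (simp add: ex_le)
          then have "enc P c (?S (\<pi>, b)) \<sqsubseteq>\<^bsub>ex_fib P c\<^esub> t"
            using bX by (intro le) blast
          then have "?S (\<pi>, b) \<subseteq> dec P c t"
            using ex[OF bX] c by (simp add: ex_le)
          then show ?thesis
            using sigma_principal[OF X(2,3)[OF bX] T] by simp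
        qed
        then show "(\<pi>, x) \<in> dec P c t"
          using closed_sup[OF T g(1) Y(1)] Y(2) by simp
      qed
      then show "u \<sqsubseteq>\<^bsub>ex_fib P c\<^esub> t"
        by (simp add: ex_le)
    qed auto
    moreover have "?B \<subseteq> carrier (ex_fib P c)"
      using ex by (auto simp del: split_paired_All)
    ultimately have "is_basis (ex_fib P c) ?B"
      unfolding is_basis_def by blast
    moreover have "?B \<lesssim> A"
    proof -
      have "?X \<lesssim> A"
      proof (rule BA)
        show "projs C c \<subseteq> Arr C"
          using projs_homs[of _ C c] by (auto simp: homs_iff)
        show "Dom C g \<in> Obj C" if "g \<in> projs C c" for g
          using homs_obj(1)[OF projs_homs[OF that]] .
      qed
      then show ?thesis
        by (rule lepoll_trans[OF image_lepoll])
    qed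
    ultimately show ?thesis
      by blast
  qed
  then show ?thesis
    using A AA unfolding is_small_def by auto
qed

section \<open>The universal property\<close>

text \<open>The formula is forced by \<open>ex_sup_basic\<close>: an extension has to preserve joins
  and existentials and to restrict to \<open>m\<close> along the unit.\<close>

definition ex_ext_fib ::
  "('o, 'm, 'p) doctrine \<Rightarrow> ('o, 'm, 'p) doctrine \<Rightarrow> ('o, 'm, 'p) doc_mor \<Rightarrow> 'o \<Rightarrow> 'p \<Rightarrow> 'p" where
  "ex_ext_fib P Q m c u = \<Squnion>\<^bsub>fib Q (fobj (ftr m) c)\<^esub>
    {Sig Q (farr (ftr m) \<pi>) (fibmap m (Dom (base P) \<pi>) x) | \<pi> x.
      \<pi> \<in> projs (base P) c \<and> (\<pi>, x) \<in> dec P c u}"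

definition ex_ext ::
  "('o, 'm, 'p) doctrine \<Rightarrow> ('o, 'm, 'p) doctrine \<Rightarrow> ('o, 'm, 'p) doc_mor \<Rightarrow> ('o, 'm, 'p) doc_mor" where
  "ex_ext P Q m = \<lparr>ftr = ftr m,
     fibmap = (\<lambda>c \<in> Obj (base P). \<lambda>u \<in> carrier (ex_fib P c). ex_ext_fib P Q m c u)\<rparr>"

section \<open>Extending a morphism along the unit\<close>

locale ex_extension = encoded_doctrine P for P :: "('o, 'm, 'p) doctrine" +
  fixes Q :: "('o, 'm, 'p) doctrine" and m :: "('o, 'm, 'p) doc_mor"
  assumes Q: "is_ex_doctrine Q" and m: "m \<in> doc_mors P Q"
begin

abbreviation F where "F \<equiv> fobj (ftr m)"
abbreviation Fa where "Fa \<equiv> farr (ftr m)"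
abbreviation \<alpha> where "\<alpha> \<equiv> fibmap m"
abbreviation ext where "ext \<equiv> ex_ext_fib P Q m"

lemmas M = doc_morsD[OF m]
lemmas FD = is_functorD[OF M(1)]
lemmas QD = doctrineD[OF ex_doctrine_is_doctrine[OF Q]]

lemma Fa_proj:
  assumes "\<pi> \<in> projs C c"
  obtains d \<pi>' where "is_product C d c (Dom C \<pi>) \<pi>' \<pi>"
    "is_product (base Q) (F d) (F c) (F (Dom C \<pi>)) (Fa \<pi>') (Fa \<pi>)"
proof -
  obtain d p \<pi>' where p: "is_product C d c p \<pi>' \<pi>"
    using assms by (auto simp: projs_def)
  moreover have "Dom C \<pi> = p"
    using is_productD(2)[OF p] by (simp add: homs_iff)
  ultimately show ?thesis
    using that[of d \<pi>'] M(2) by (simp add: preserves_finite_products_def)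
qed

lemma Q_frame: "c \<in> Obj C \<Longrightarrow> is_frame (fib Q (F c))"
  using QD(3) FD(3) by blast

lemma Q_reindex_closed:
  "f \<in> homs C a b \<Longrightarrow> T \<in> carrier (fib Q (F b)) \<Longrightarrow> reindex Q (Fa f) T \<in> carrier (fib Q (F a))"
  using frame_hom_closed[OF QD(4)[OF FD(4)]] by blast

lemma \<alpha>_closed: "c \<in> Obj C \<Longrightarrow> x \<in> carrier (fib P c) \<Longrightarrow> \<alpha> c x \<in> carrier (fib Q (F c))"
  by (rule doc_mors_fibmap_closed[OF m])

lemma Q_Sig:
  assumes "\<pi> \<in> projs C c" "z \<in> carrier (fib Q (F (Dom C \<pi>)))"
  shows "Sig Q (Fa \<pi>) z \<in> carrier (fib Q (F c))"
    and "T \<in> carrier (fib Q (F c)) \<Longrightarrow>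
      Sig Q (Fa \<pi>) z \<sqsubseteq>\<^bsub>fib Q (F c)\<^esub> T \<longleftrightarrow> z \<sqsubseteq>\<^bsub>fib Q (F (Dom C \<pi>))\<^esub> reindex Q (Fa \<pi>) T"
  using Fa_proj[OF assms(1)] ex_doctrine_Sig[OF Q _ assms(2)] by metis+

text \<open>The right adjoint of \<open>ext\<close>, up to the encoding.\<close>

definition R :: "'o \<Rightarrow> 'p \<Rightarrow> ('m \<times> 'p) set" where
  "R c T = {(g, y). g \<in> Arr C \<and> Cod C g = c \<and> y \<in> carrier (fib P (Dom C g)) \<and>
     \<alpha> (Dom C g) y \<sqsubseteq>\<^bsub>fib Q (F (Dom C g))\<^esub> reindex Q (Fa g) T}"

lemma R_iff:
  "g \<in> homs C e c \<Longrightarrow>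
   (g, y) \<in> R c T \<longleftrightarrow> y \<in> carrier (fib P e) \<and> \<alpha> e y \<sqsubseteq>\<^bsub>fib Q (F e)\<^esub> reindex Q (Fa g) T"
  by (auto simp: R_def homs_iff)

lemma R_elem:
  assumes "(g, y) \<in> R c T"
  shows "g \<in> homs C (Dom C g) c" "y \<in> carrier (fib P (Dom C g))"
    "\<alpha> (Dom C g) y \<sqsubseteq>\<^bsub>fib Q (F (Dom C g))\<^esub> reindex Q (Fa g) T"
  using assms by (auto simp: R_def homs_iff)

text \<open>Downward closure comes from monotonicity and naturality of \<open>\<alpha>\<close>,
  closure under joins from the preservation of joins by each \<open>\<alpha> e\<close>.\<close>

lemma R_closed:
  assumes T: "T \<in> carrier (fib Q (F c))"
  shows "R c T \<in> closed_sieves P c"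
proof (intro closed_sievesI presievesI)
  show "\<exists>e. g \<in> homs C e c \<and> y \<in> carrier (fib P e)" if "(g, y) \<in> R c T" for g y
    using R_elem[OF that] by blast
  fix g y e h x a assume gy: "(g, y) \<in> R c T" and g: "g \<in> homs C e c" and y: "y \<in> carrier (fib P e)"
    and h: "h \<in> homs C a e" and x: "x \<in> carrier (fib P a)" "x \<sqsubseteq>[a] reindex P h y"
  have a: "a \<in> Obj C" and e: "e \<in> Obj C"
    using homs_obj[OF h] by auto
  note gT = Q_reindex_closed[OF g T]
  have 1: "\<alpha> a x \<sqsubseteq>\<^bsub>fib Q (F a)\<^esub> reindex Q (Fa h) (\<alpha> e y)"
    using frame_hom_mono[OF M(3)[OF a] x(1) reindex_closed[OF h y] x(2)] M(4)[OF h y] by simp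
  have 2: "reindex Q (Fa h) (\<alpha> e y) \<sqsubseteq>\<^bsub>fib Q (F a)\<^esub> reindex Q (Fa h) (reindex Q (Fa g) T)"
    using gy R_iff[OF g] by (intro frame_hom_mono[OF QD(4)[OF FD(4)[OF h]] \<alpha>_closed[OF e y] gT]) blast
  show "(g \<cdot> h, x) \<in> R c T"
    using frame_trans[OF Q_frame[OF a] 1 2 \<alpha>_closed[OF a x(1)] Q_reindex_closed[OF h \<alpha>_closed[OF e y]]
        Q_reindex_closed[OF h gT]] x(1) FD(6)[OF g h] QD(6)[OF FD(4)[OF g] FD(4)[OF h] T]
    by (simp add: R_iff[OF cmp_homs[OF g h]])
next
  fix g e Y assume g: "g \<in> homs C e c" and Y: "Y \<subseteq> carrier (fib P e)"
    and gY: "\<And>y. y \<in> Y \<Longrightarrow> (g, y) \<in> R c T"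
  have e: "e \<in> Obj C"
    using homs_obj[OF g] by blast
  have "\<Squnion>\<^bsub>fib Q (F e)\<^esub> (\<alpha> e ` Y) \<sqsubseteq>\<^bsub>fib Q (F e)\<^esub> reindex Q (Fa g) T"
    using gY Y \<alpha>_closed[OF e] by (intro frame_sup(3)[OF Q_frame[OF e] _ Q_reindex_closed[OF g T]])
      (auto simp: R_iff[OF g])
  then show "(g, \<Squnion>\<^bsub>fib P e\<^esub> Y) \<in> R c T"
    using frame_sup(1)[OF D(3)[OF e] Y] frame_hom_sup[OF M(3)[OF e] Y] by (simp add: R_iff[OF g])
qed

text \<open>Functoriality of reindexing in \<open>Q\<close> along the images of arrows. Passed to
  left adjoints, it yields one half of \<open>ext_natural\<close> and all of
  \<open>ext_Sig\<close>.\<close>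

lemma pull_R:
  assumes f: "f \<in> homs C a b" and T: "T \<in> carrier (fib Q (F b))"
  shows "pull_sieve P f (R b T) = R a (reindex Q (Fa f) T)"
proof -
  have "(g, y) \<in> pull_sieve P f (R b T) \<longleftrightarrow> (g, y) \<in> R a (reindex Q (Fa f) T)"
    if g: "g \<in> homs C (Dom C g) a" for g y
    using FD(6)[OF f g] QD(6)[OF FD(4)[OF f] FD(4)[OF g] T]
    by (simp add: pull_iff[OF f g] R_iff[OF g] R_iff[OF cmp_homs[OF f g]])
  then have "(g, y) \<in> pull_sieve P f (R b T) \<longleftrightarrow> (g, y) \<in> R a (reindex Q (Fa f) T)" for g y
    using pull_elem(1)[OF f closed_presieve[OF R_closed[OF T]]] R_elem(1) by blast
  then show ?thesis
    by auto
qed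

lemma dec_elem:
  assumes "c \<in> Obj C" "u \<in> carrier (ex_fib P c)" "(g, x) \<in> dec P c u"
  shows "g \<in> homs C (Dom C g) c" "x \<in> carrier (fib P (Dom C g))" "Dom C g \<in> Obj C"
  using presieve_elem[OF ex_presieve[OF carrierE(1)[OF assms(2,1)]] assms(3)] homs_obj by auto

lemma ext_gens:
  assumes c: "c \<in> Obj C" and u: "u \<in> carrier (ex_fib P c)"
  shows "{Sig Q (Fa \<pi>) (\<alpha> (Dom C \<pi>) x) | \<pi> x. \<pi> \<in> projs C c \<and> (\<pi>, x) \<in> dec P c u} \<subseteq> carrier (fib Q (F c))"
proof (intro subsetI, elim CollectE exE conjE)
  fix T \<pi> x assume "T = Sig Q (Fa \<pi>) (\<alpha> (Dom C \<pi>) x)" "\<pi> \<in> projs C c" "(\<pi>, x) \<in> dec P c u"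
  then show "T \<in> carrier (fib Q (F c))"
    using Q_Sig(1)[OF _ \<alpha>_closed[OF dec_elem(3,2)[OF c u]]] by simp
qed

lemma ext_closed: "c \<in> Obj C \<Longrightarrow> u \<in> carrier (ex_fib P c) \<Longrightarrow> ext c u \<in> carrier (fib Q (F c))"
  unfolding ex_ext_fib_def by (intro frame_sup(1) Q_frame ext_gens)

text \<open>Only projection pairs enter the join \<open>ext c u\<close>, whereas the inclusion in
  \<open>R c T\<close> concerns all pairs. The gap is closed by generation of \<open>u\<close> by
  projections, as \<open>R c T\<close> is closed.\<close>

lemma ext_le:
  assumes c: "c \<in> Obj C" and u: "u \<in> carrier (ex_fib P c)" and T: "T \<in> carrier (fib Q (F c))"
  shows "ext c u \<sqsubseteq>\<^bsub>fib Q (F c)\<^esub> T \<longleftrightarrow> dec P c u \<subseteq> R c T"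
proof -
  let ?G = "{Sig Q (Fa \<pi>) (\<alpha> (Dom C \<pi>) x) | \<pi> x. \<pi> \<in> projs C c \<and> (\<pi>, x) \<in> dec P c u}"
  note F = Q_frame[OF c] and U = carrierE(1)[OF u c]
  note s = frame_sup[OF F ext_gens[OF c u]]
  have iff: "Sig Q (Fa \<pi>) (\<alpha> (Dom C \<pi>) x) \<sqsubseteq>\<^bsub>fib Q (F c)\<^esub> T \<longleftrightarrow> (\<pi>, x) \<in> R c T"
    if \<pi>: "\<pi> \<in> projs C c" and x: "(\<pi>, x) \<in> dec P c u" for \<pi> x
    using Q_Sig(2)[OF \<pi> \<alpha>_closed[OF dec_elem(3,2)[OF c u x]] T] dec_elem[OF c u x]
    by (simp add: R_iff[of \<pi> "Dom C \<pi>"])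
  have "ext c u \<sqsubseteq>\<^bsub>fib Q (F c)\<^esub> T \<longleftrightarrow> (\<forall>a \<in> ?G. a \<sqsubseteq>\<^bsub>fib Q (F c)\<^esub> T)"
  proof
    assume le: "ext c u \<sqsubseteq>\<^bsub>fib Q (F c)\<^esub> T"
    show "\<forall>a \<in> ?G. a \<sqsubseteq>\<^bsub>fib Q (F c)\<^esub> T"
    proof
      fix a assume a: "a \<in> ?G"
      then have "a \<in> carrier (fib Q (F c))"
        using ext_gens[OF c u] by blast
      then show "a \<sqsubseteq>\<^bsub>fib Q (F c)\<^esub> T"
        using frame_trans[OF F s(2)[OF a] le[unfolded ex_ext_fib_def]] s(1) T by blast
    qed
  next
    assume "\<forall>a \<in> ?G. a \<sqsubseteq>\<^bsub>fib Q (F c)\<^esub> T"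
    then show "ext c u \<sqsubseteq>\<^bsub>fib Q (F c)\<^esub> T"
      unfolding ex_ext_fib_def by (intro s(3)[OF T]) blast
  qed
  also have "\<dots> \<longleftrightarrow> dec P c u \<subseteq> R c T"
    using ex_subsetI[OF U R_closed[OF T]] iff by blast
  finally show ?thesis .
qed

lemma ext_unit:
  assumes c: "c \<in> Obj C" and u: "u \<in> carrier (ex_fib P c)"
  shows "dec P c u \<subseteq> R c (ext c u)"
  using ext_le[OF c u ext_closed[OF c u]] frame_refl[OF Q_frame[OF c] ext_closed[OF c u]] by blast

lemma ext_mono:
  assumes c: "c \<in> Obj C" and u: "u \<in> carrier (ex_fib P c)" "v \<in> carrier (ex_fib P c)"
    and le: "dec P c u \<subseteq> dec P c v"
  shows "ext c u \<sqsubseteq>\<^bsub>fib Q (F c)\<^esub> ext c v"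
  using ext_unit[OF c u(2)] le by (subst ext_le[OF c u(1) ext_closed[OF c u(2)]]) blast

text \<open>Beck-Chevalley in \<open>Q\<close> for the image of a square from the base of
  \<open>P\<close>; naturality of \<open>\<alpha>\<close> at \<open>h\<close> then moves the
  reindexing inside \<open>\<alpha>\<close>.\<close>

lemma Q_Sig_reindex:
  assumes \<pi>: "is_product C d c p \<pi>' \<pi>" and f: "f \<in> homs C c' c" and x: "x \<in> carrier (fib P p)"
  obtains \<rho> h where "\<rho> \<in> projs C c'" "h \<in> homs C (Dom C \<rho>) p" "\<pi> \<cdot> h = f \<cdot> \<rho>"
    "reindex Q (Fa f) (Sig Q (Fa \<pi>) (\<alpha> p x)) = Sig Q (Fa \<rho>) (\<alpha> (Dom C \<rho>) (reindex P h x))"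
proof -
  have pobj: "p \<in> Obj C"
    using product_obj[OF D(1) \<pi>] by blast
  obtain q \<rho>' \<rho> h where sq: "bc_square C d c p \<pi>' \<pi> c' q \<rho>' \<rho> f h"
    using bc_square_exists[OF D(1,2) \<pi> f] .
  then have q: "is_product C d c' q \<rho>' \<rho>" and h: "h \<in> homs C q p" and e: "\<pi>' \<cdot> h = \<rho>'" "\<pi> \<cdot> h = f \<cdot> \<rho>"
    by (auto simp: bc_square_def)
  have Dq: "Dom C \<rho> = q"
    using is_productD(2)[OF q] by (simp add: homs_iff)
  have "reindex Q (Fa f) (Sig Q (Fa \<pi>) (\<alpha> p x)) = Sig Q (Fa \<rho>) (reindex Q (Fa h) (\<alpha> p x))"
  proof (rule ex_doctrine_beck_chevalley[OF Q])
    show "is_product (base Q) (F d) (F c) (F p) (Fa \<pi>') (Fa \<pi>)"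
      "is_product (base Q) (F d) (F c') (F q) (Fa \<rho>') (Fa \<rho>)"
      using M(2) \<pi> q by (auto simp: preserves_finite_products_def)
    show "Fa f \<in> homs (base Q) (F c') (F c)" "Fa h \<in> homs (base Q) (F q) (F p)"
      using FD(4) f h by auto
    show "Cmp (base Q) (Fa \<pi>') (Fa h) = Fa \<rho>'"
      using FD(6)[OF is_productD(1)[OF \<pi>] h] e by simp
    show "Cmp (base Q) (Fa \<pi>) (Fa h) = Cmp (base Q) (Fa f) (Fa \<rho>)"
      using FD(6)[OF is_productD(2)[OF \<pi>] h] FD(6)[OF f is_productD(2)[OF q]] e by simp
  qed (rule \<alpha>_closed[OF pobj x])
  then show ?thesis
    using that[of \<rho> h] q h e M(4)[OF h x] Dq by (auto simp: projs_def)
qed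

text \<open>One inequality is adjunction calculus with \<open>pull_R\<close>. The other is checked
  on the generators of \<open>ext b u\<close>, which Beck-Chevalley in \<open>Q\<close> turns into
  generators over \<open>a\<close>.\<close>

lemma ext_natural:
  assumes f: "f \<in> homs C a b" and u: "u \<in> carrier (ex_fib P b)"
  shows "ext a (reindex E f u) = reindex Q (Fa f) (ext b u)"
proof -
  have a: "a \<in> Obj C" and b: "b \<in> Obj C"
    using homs_obj[OF f] by auto
  note U = carrierE[OF u b]
  have fu: "reindex E f u \<in> carrier (ex_fib P a)" and dfu: "dec P a (reindex E f u) = pull_sieve P f (dec P b u)"
    using ex_pull[OF f U(1)] a by (auto simp: ex_reindex[OF f])
  note e = ext_closed[OF b u] and e' = ext_closed[OF a fu]
  note F = Q_frame[OF a]
  let ?G = "{Sig Q (Fa \<pi>) (\<alpha> (Dom C \<pi>) x) | \<pi> x. \<pi> \<in> projs C b \<and> (\<pi>, x) \<in> dec P b u}"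
  show ?thesis
  proof (rule frame_antisym[OF F _ _ e' Q_reindex_closed[OF f e]])
    have "pull_sieve P f (dec P b u) \<subseteq> pull_sieve P f (R b (ext b u))"
      using ext_unit[OF b u] by (auto simp: pull_sieve_def)
    then show "ext a (reindex E f u) \<sqsubseteq>\<^bsub>fib Q (F a)\<^esub> reindex Q (Fa f) (ext b u)"
      by (simp add: ext_le[OF a fu Q_reindex_closed[OF f e]] dfu pull_R[OF f e])
    have r: "reindex Q (Fa f) (ext b u) = \<Squnion>\<^bsub>fib Q (F a)\<^esub> (reindex Q (Fa f) ` ?G)"
      unfolding ex_ext_fib_def by (rule frame_hom_sup[OF QD(4)[OF FD(4)[OF f]] ext_gens[OF b u]])
    have "reindex Q (Fa f) (Sig Q (Fa \<pi>) (\<alpha> (Dom C \<pi>) x)) \<sqsubseteq>\<^bsub>fib Q (F a)\<^esub> ext a (reindex E f u)"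
      if \<pi>: "\<pi> \<in> projs C b" and x: "(\<pi>, x) \<in> dec P b u" for \<pi> x
    proof -
      note xe = dec_elem[OF b u x]
      obtain d \<pi>' where p: "is_product C d b (Dom C \<pi>) \<pi>' \<pi>"
        using Fa_proj[OF \<pi>] by blast
      obtain \<rho> h where \<rho>: "\<rho> \<in> projs C a" and h: "h \<in> homs C (Dom C \<rho>) (Dom C \<pi>)" and e: "\<pi> \<cdot> h = f \<cdot> \<rho>"
        and eq: "reindex Q (Fa f) (Sig Q (Fa \<pi>) (\<alpha> (Dom C \<pi>) x)) = Sig Q (Fa \<rho>) (\<alpha> (Dom C \<rho>) (reindex P h x))"
        using Q_Sig_reindex[OF p f xe(2)] .
      note \<rho>h = projs_homs[OF \<rho>]
      have hx: "reindex P h x \<in> carrier (fib P (Dom C \<rho>))" and \<rho>o: "Dom C \<rho> \<in> Obj C"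
        using reindex_closed[OF h xe(2)] homs_obj[OF h] by auto
      have "(\<pi> \<cdot> h, reindex P h x) \<in> dec P b u"
        using presieve_down[OF ex_presieve[OF U(1)] x xe(1) h hx] frame_refl[OF frame(1)[OF h] hx] by simp
      then have "(\<rho>, reindex P h x) \<in> R a (ext a (reindex E f u))"
        using ext_unit[OF a fu] dfu e pull_iff[OF f \<rho>h] by auto
      then show ?thesis
        using Q_Sig(2)[OF \<rho> \<alpha>_closed[OF \<rho>o hx] e'] eq by (simp add: R_iff[OF \<rho>h])
    qed
    then show "reindex Q (Fa f) (ext b u) \<sqsubseteq>\<^bsub>fib Q (F a)\<^esub> ext a (reindex E f u)"
      unfolding r using ext_gens[OF b u] Q_reindex_closed[OF f]
      by (intro frame_sup(3)[OF F _ e']) blast+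
  qed
qed

lemma reindex_Fa_ident:
  "c \<in> Obj C \<Longrightarrow> T \<in> carrier (fib Q (F c)) \<Longrightarrow> reindex Q (Fa (Ident C c)) T = T"
  using FD(3,5) QD(5) by simp

text \<open>At a principal sieve, inclusion in \<open>R c T\<close> is the single condition
  \<open>\<alpha> c x \<le> T\<close>, so the adjunction yields both inequalities.\<close>

lemma ext_principal:
  assumes c: "c \<in> Obj C" and x: "x \<in> carrier (fib P c)"
  shows "ext c (enc P c (principal_sieve P c x)) = \<alpha> c x"
proof -
  let ?u = "enc P c (principal_sieve P c x)"
  note i = ident_homs[OF c]
  have u: "?u \<in> carrier (ex_fib P c)" and du: "dec P c ?u = principal_sieve P c x"
    using ex_principal[OF c x] c by auto
  note e = ext_closed[OF c u] and a = \<alpha>_closed[OF c x]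
  note sub = principal_subset[OF x c closed_presieve[OF R_closed]]
  show ?thesis
  proof (rule frame_antisym[OF Q_frame[OF c] _ _ e a])
    show "ext c ?u \<sqsubseteq>\<^bsub>fib Q (F c)\<^esub> \<alpha> c x"
      using a x frame_refl[OF Q_frame[OF c] a]
      by (simp add: ext_le[OF c u a] du sub[OF a] R_iff[OF i] reindex_Fa_ident[OF c])
    show "\<alpha> c x \<sqsubseteq>\<^bsub>fib Q (F c)\<^esub> ext c ?u"
      using ext_unit[OF c u] e by (simp add: du sub[OF e] R_iff[OF i] reindex_Fa_ident[OF c])
  qed
qed

text \<open>The nontrivial half of \<open>ext_meet\<close> for a principal argument. The meet is
  distributed over the join \<open>ext c u\<close>, Frobenius in \<open>Q\<close> moves
  \<open>\<alpha> c x\<close> under each existential, and there \<open>\<alpha>\<close> preserves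
  the meet.\<close>

lemma ext_meet_principal:
  assumes c: "c \<in> Obj C" and x: "x \<in> carrier (fib P c)" and u: "u \<in> carrier (ex_fib P c)"
  shows "\<alpha> c x \<sqinter>\<^bsub>fib Q (F c)\<^esub> ext c u \<sqsubseteq>\<^bsub>fib Q (F c)\<^esub> ext c (enc P c (principal_sieve P c x \<inter> dec P c u))"
proof -
  note U = carrierE[OF u c]
  let ?I = "principal_sieve P c x \<inter> dec P c u"
  let ?w = "enc P c ?I"
  have I: "?I \<in> ex_sieves P c"
    using ex_Int[OF ex_principal[OF c x] U(1)] .
  then have w: "?w \<in> carrier (ex_fib P c)" and dw: "dec P c ?w = ?I"
    using c by auto
  note e = ext_closed[OF c w] and a = \<alpha>_closed[OF c x]
  have "\<alpha> c x \<sqinter>\<^bsub>fib Q (F c)\<^esub> Sig Q (Fa \<pi>) (\<alpha> (Dom C \<pi>) y) \<sqsubseteq>\<^bsub>fib Q (F c)\<^esub> ext c ?w"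
    if \<pi>: "\<pi> \<in> projs C c" and y: "(\<pi>, y) \<in> dec P c u" for \<pi> y
  proof -
    note ye = dec_elem[OF c u y]
    obtain d \<pi>' where p: "is_product (base Q) (F d) (F c) (F (Dom C \<pi>)) (Fa \<pi>') (Fa \<pi>)"
      using Fa_proj[OF \<pi>] by blast
    let ?z = "reindex P \<pi> x \<sqinter>\<^bsub>fib P (Dom C \<pi>)\<^esub> y"
    note z = frame_meet[OF frame(1)[OF ye(1)] reindex_closed[OF ye(1) x] ye(2)]
    have "\<alpha> c x \<sqinter>\<^bsub>fib Q (F c)\<^esub> Sig Q (Fa \<pi>) (\<alpha> (Dom C \<pi>) y) =
        Sig Q (Fa \<pi>) (reindex Q (Fa \<pi>) (\<alpha> c x) \<sqinter>\<^bsub>fib Q (F (Dom C \<pi>))\<^esub> \<alpha> (Dom C \<pi>) y)"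
      by (rule ex_doctrine_frobenius[OF Q p a \<alpha>_closed[OF ye(3,2)]])
    also have "\<dots> = Sig Q (Fa \<pi>) (\<alpha> (Dom C \<pi>) ?z)"
      using M(4)[OF ye(1) x] frame_hom_meet[OF M(3)[OF ye(3)] reindex_closed[OF ye(1) x] ye(2)] by simp
    finally have eq: "\<alpha> c x \<sqinter>\<^bsub>fib Q (F c)\<^esub> Sig Q (Fa \<pi>) (\<alpha> (Dom C \<pi>) y) = Sig Q (Fa \<pi>) (\<alpha> (Dom C \<pi>) ?z)" .
    have "(\<pi>, ?z) \<in> ?I"
      using presieve_le[OF ex_presieve[OF U(1)] y ye(1) z(1,3)] z(1,2) principal_iff[OF ye(1)] by blast
    then have "(\<pi>, ?z) \<in> R c (ext c ?w)"
      using ext_unit[OF c w] dw by blast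
    then show ?thesis
      using Q_Sig(2)[OF \<pi> \<alpha>_closed[OF ye(3) z(1)] e] eq by (simp add: R_iff[OF ye(1)])
  qed
  then show ?thesis
    unfolding ex_ext_fib_def[of P Q m c u]
    by (intro frame_meet_sup_le[OF Q_frame[OF c] ext_gens[OF c u] a e]) blast
qed

text \<open>Distributivity reduces the nontrivial inequality to generators \<open>(\<pi>, x)\<close>
  of \<open>u\<close>. Frobenius in \<open>Q\<close> moves the problem from \<open>c\<close> to the
  domain of \<open>\<pi>\<close>, where the element \<open>x\<close> is principal and
  \<open>ext_meet_principal\<close> applies; \<open>ext_natural\<close> relates the two
  levels.\<close>

lemma ext_meet:
  assumes c: "c \<in> Obj C" and u: "u \<in> carrier (ex_fib P c)" and v: "v \<in> carrier (ex_fib P c)"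
  shows "ext c (u \<sqinter>\<^bsub>ex_fib P c\<^esub> v) = ext c u \<sqinter>\<^bsub>fib Q (F c)\<^esub> ext c v"
proof -
  note F = Q_frame[OF c] and U = carrierE[OF u c] and V = carrierE[OF v c]
  let ?I = "dec P c u \<inter> dec P c v"
  let ?w = "u \<sqinter>\<^bsub>ex_fib P c\<^esub> v"
  have w_eq: "?w = enc P c ?I"
    using ex_meet[OF c U(1) V(1)] U(2) V(2) by simp
  have w: "?w \<in> carrier (ex_fib P c)" and dw: "dec P c ?w = ?I"
    using ex_Int[OF U(1) V(1)] c by (auto simp: w_eq)
  note eu = ext_closed[OF c u] and ev = ext_closed[OF c v] and ew = ext_closed[OF c w]
  have "ext c v \<sqinter>\<^bsub>fib Q (F c)\<^esub> Sig Q (Fa \<pi>) (\<alpha> (Dom C \<pi>) x) \<sqsubseteq>\<^bsub>fib Q (F c)\<^esub> ext c ?w"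
    if \<pi>: "\<pi> \<in> projs C c" and x: "(\<pi>, x) \<in> dec P c u" for \<pi> x
  proof -
    note xe = dec_elem[OF c u x]
    let ?p = "Dom C \<pi>"
    obtain d \<pi>' where p: "is_product (base Q) (F d) (F c) (F ?p) (Fa \<pi>') (Fa \<pi>)"
      using Fa_proj[OF \<pi>] by blast
    have \<pi>v: "reindex E \<pi> v \<in> carrier (ex_fib P ?p)" "dec P ?p (reindex E \<pi> v) = pull_sieve P \<pi> (dec P c v)"
      and \<pi>w: "reindex E \<pi> ?w \<in> carrier (ex_fib P ?p)" "dec P ?p (reindex E \<pi> ?w) = pull_sieve P \<pi> ?I"
      using ex_pull[OF xe(1) V(1)] ex_pull[OF xe(1) ex_Int[OF U(1) V(1)]] xe(3)
      by (auto simp: ex_reindex[OF xe(1)] dw)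
    let ?J = "principal_sieve P ?p x \<inter> dec P ?p (reindex E \<pi> v)"
    have J: "?J \<in> ex_sieves P ?p"
      using ex_Int[OF ex_principal[OF xe(3,2)] carrierE(1)[OF \<pi>v(1) xe(3)]] .
    \<comment> \<open>Membership of \<open>(\<pi>, x)\<close> in the sieve of \<open>u\<close>, read
      over the domain of \<open>\<pi>\<close>.\<close>
    have "principal_sieve P ?p x \<subseteq> pull_sieve P \<pi> (dec P c u)"
      using principal_subset[OF xe(2,3) closed_presieve[OF pull_closed[OF xe(1) ex_closed[OF U(1)]]]]
        pull_iff[OF xe(1) ident_homs[OF xe(3)]] cmp_ident(1)[OF xe(1)] x by simp
    then have "?J \<subseteq> pull_sieve P \<pi> ?I"
      using \<pi>v(2) by (auto simp: pull_sieve_def)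
    then have le2: "ext ?p (enc P ?p ?J) \<sqsubseteq>\<^bsub>fib Q (F ?p)\<^esub> ext ?p (reindex E \<pi> ?w)"
      using J xe(3) \<pi>w by (intro ext_mono) auto
    note ax = \<alpha>_closed[OF xe(3,2)]
    note m1 = frame_meet(1)[OF Q_frame[OF xe(3)] ax ext_closed[OF xe(3) \<pi>v(1)]]
    have "\<alpha> ?p x \<sqinter>\<^bsub>fib Q (F ?p)\<^esub> ext ?p (reindex E \<pi> v) \<sqsubseteq>\<^bsub>fib Q (F ?p)\<^esub> ext ?p (reindex E \<pi> ?w)"
      using frame_trans[OF Q_frame[OF xe(3)] ext_meet_principal[OF xe(3,2) \<pi>v(1)] le2 m1]
        ext_closed[OF xe(3)] J \<pi>w(1) by simp
    then have "reindex Q (Fa \<pi>) (ext c v) \<sqinter>\<^bsub>fib Q (F ?p)\<^esub> \<alpha> ?p x \<sqsubseteq>\<^bsub>fib Q (F ?p)\<^esub> reindex Q (Fa \<pi>) (ext c ?w)"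
      using ext_natural[OF xe(1) v] ext_natural[OF xe(1) w] by (subst meet_commute) simp
    then have "Sig Q (Fa \<pi>) (reindex Q (Fa \<pi>) (ext c v) \<sqinter>\<^bsub>fib Q (F ?p)\<^esub> \<alpha> ?p x) \<sqsubseteq>\<^bsub>fib Q (F c)\<^esub> ext c ?w"
      using Q_Sig(2)[OF \<pi> frame_meet(1)[OF Q_frame[OF xe(3)] Q_reindex_closed[OF xe(1) ev] ax] ew] by simp
    then show ?thesis
      using ex_doctrine_frobenius[OF Q p ev ax] by simp
  qed
  then have ge: "ext c v \<sqinter>\<^bsub>fib Q (F c)\<^esub> ext c u \<sqsubseteq>\<^bsub>fib Q (F c)\<^esub> ext c ?w"
    unfolding ex_ext_fib_def[of P Q m c u]
    by (intro frame_meet_sup_le[OF F ext_gens[OF c u] ev ew]) blast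
  show ?thesis
  proof (rule sym, rule lattice_meet_eqI[OF frame_lattice[OF F] eu ev ew])
    show "ext c ?w \<sqsubseteq>\<^bsub>fib Q (F c)\<^esub> ext c u" "ext c ?w \<sqsubseteq>\<^bsub>fib Q (F c)\<^esub> ext c v"
      using dw by (auto intro!: ext_mono c u v w)
    fix t assume t: "t \<in> carrier (fib Q (F c))" "t \<sqsubseteq>\<^bsub>fib Q (F c)\<^esub> ext c u" "t \<sqsubseteq>\<^bsub>fib Q (F c)\<^esub> ext c v"
    show "t \<sqsubseteq>\<^bsub>fib Q (F c)\<^esub> ext c ?w"
      using frame_trans[OF F frame_meet(4)[OF F ev eu t(1,3,2)] ge t(1) frame_meet(1)[OF F ev eu] ew] .
  qed
qed

lemma ext_frame_hom:
  assumes c: "c \<in> Obj C"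
  shows "is_frame_hom (ex_fib P c) (fib Q (F c)) (ext c)"
proof (rule frame_homI[OF ex_frame[OF c] Q_frame[OF c] ext_closed[OF c] _ ext_meet[OF c]])
  show "ext c \<top>\<^bsub>ex_fib P c\<^esub> = \<top>\<^bsub>fib Q (F c)\<^esub>"
    using ext_principal[OF c frame_top(1)[OF D(3)[OF c]]] frame_hom_top[OF M(3)[OF c]]
    by (simp add: ex_top[OF c])
  show "ext c (\<Squnion>\<^bsub>ex_fib P c\<^esub> A) = \<Squnion>\<^bsub>fib Q (F c)\<^esub> (ext c ` A)" if A: "A \<subseteq> carrier (ex_fib P c)" for A
  proof -
    note sup = frame_sup(1)[OF ex_frame[OF c] A]
    \<comment> \<open>By the adjunction with \<open>R c\<close>, the image of the join has the same
      upper bounds as the family of images.\<close>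
    have le: "ext c (\<Squnion>\<^bsub>ex_fib P c\<^esub> A) \<sqsubseteq>\<^bsub>fib Q (F c)\<^esub> T \<longleftrightarrow> (\<forall>a \<in> A. ext c a \<sqsubseteq>\<^bsub>fib Q (F c)\<^esub> T)"
      if T: "T \<in> carrier (fib Q (F c))" for T
    proof -
      have "dec P c (\<Squnion>\<^bsub>ex_fib P c\<^esub> A) = gen_sieve P c (\<Union> (dec P c ` A))"
        using gen_dec_ex[OF c A] c by (simp add: ex_sup[OF c A])
      then have "ext c (\<Squnion>\<^bsub>ex_fib P c\<^esub> A) \<sqsubseteq>\<^bsub>fib Q (F c)\<^esub> T \<longleftrightarrow> gen_sieve P c (\<Union> (dec P c ` A)) \<subseteq> R c T"
        using ext_le[OF c sup T] by simp
      also have "\<dots> \<longleftrightarrow> \<Union> (dec P c ` A) \<subseteq> R c T"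
        using gen_least[OF R_closed[OF T]] gen_upper[of "\<Union> (dec P c ` A)" c] by blast
      also have "\<dots> \<longleftrightarrow> (\<forall>a \<in> A. ext c a \<sqsubseteq>\<^bsub>fib Q (F c)\<^esub> T)"
        using ext_le[OF c subsetD[OF A] T] by (simp add: UN_subset_iff)
      finally show ?thesis .
    qed
    show ?thesis
    proof (rule sym, rule lattice_sup_eqI[OF frame_lattice[OF Q_frame[OF c]]])
      show "ext c ` A \<subseteq> carrier (fib Q (F c))"
        using A ext_closed[OF c] by auto
      show "ext c (\<Squnion>\<^bsub>ex_fib P c\<^esub> A) \<in> carrier (fib Q (F c))"
        using ext_closed[OF c sup] .
      show "a \<sqsubseteq>\<^bsub>fib Q (F c)\<^esub> ext c (\<Squnion>\<^bsub>ex_fib P c\<^esub> A)" if "a \<in> ext c ` A" for a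
        using that le[OF ext_closed[OF c sup]] frame_refl[OF Q_frame[OF c] ext_closed[OF c sup]] by blast
      show "ext c (\<Squnion>\<^bsub>ex_fib P c\<^esub> A) \<sqsubseteq>\<^bsub>fib Q (F c)\<^esub> t"
        if "t \<in> carrier (fib Q (F c))" "\<And>a. a \<in> ext c ` A \<Longrightarrow> a \<sqsubseteq>\<^bsub>fib Q (F c)\<^esub> t" for t
        using le[OF that(1)] that(2) by blast
    qed
  qed
qed

text \<open>Uniqueness of adjoints: as functions of \<open>u\<close>, both sides are left adjoint to
  reindexing followed by the right adjoint of \<open>ext\<close>, since \<open>R\<close> commutes
  with pullback.\<close>

lemma ext_Sig:
  assumes \<pi>: "\<pi> \<in> projs C c" and u: "u \<in> carrier (ex_fib P (Dom C \<pi>))"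
  shows "ext c (Sig E \<pi> u) = Sig Q (Fa \<pi>) (ext (Dom C \<pi>) u)"
proof -
  let ?p = "Dom C \<pi>"
  note \<pi>h = projs_homs[OF \<pi>]
  have c: "c \<in> Obj C" and p: "?p \<in> Obj C"
    using homs_obj[OF \<pi>h] by auto
  note F = Q_frame[OF c] and U = carrierE[OF u p] and eu = ext_closed[OF p u]
  have S: "Sig E \<pi> u = enc P c (sigma_sieve P \<pi> (dec P ?p u))"
    using ex_Sig[OF \<pi> \<pi>h U(1)] U(2) by simp
  have Su: "Sig E \<pi> u \<in> carrier (ex_fib P c)" and dS: "dec P c (Sig E \<pi> u) = sigma_sieve P \<pi> (dec P ?p u)"
    using ex_sigma[OF \<pi> \<pi>h U(1)] c by (auto simp: S)
  have le: "ext c (Sig E \<pi> u) \<sqsubseteq>\<^bsub>fib Q (F c)\<^esub> T \<longleftrightarrow> Sig Q (Fa \<pi>) (ext ?p u) \<sqsubseteq>\<^bsub>fib Q (F c)\<^esub> T"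
    if T: "T \<in> carrier (fib Q (F c))" for T
  proof -
    have "ext c (Sig E \<pi> u) \<sqsubseteq>\<^bsub>fib Q (F c)\<^esub> T \<longleftrightarrow> dec P ?p u \<subseteq> R ?p (reindex Q (Fa \<pi>) T)"
      using ext_le[OF c Su T] sigma_subset[OF \<pi>h ex_presieve[OF U(1)] R_closed[OF T]]
      by (simp add: dS pull_R[OF \<pi>h T])
    then show ?thesis
      using ext_le[OF p u Q_reindex_closed[OF \<pi>h T]] Q_Sig(2)[OF \<pi> eu T] by simp
  qed
  note e = ext_closed[OF c Su] and s = Q_Sig(1)[OF \<pi> eu]
  show ?thesis
    using le[OF e] le[OF s] frame_refl[OF F e] frame_refl[OF F s] by (intro frame_antisym[OF F _ _ e s]) auto
qed

lemma ex_ext_mor: "ex_ext P Q m \<in> ex_doc_mors E Q"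
proof -
  have "is_frame_hom (ex_fib P c) (fib Q (F c)) (fibmap (ex_ext P Q m) c)" if c: "c \<in> Obj C" for c
    using frame_hom_comp[OF frame_hom_id[OF ex_frame[OF c]] ext_frame_hom[OF c] ex_frame[OF c],
        of "\<lambda>x. x" "fibmap (ex_ext P Q m) c"] c
    by (simp add: ex_ext_def)
  moreover have "fibmap (ex_ext P Q m) (Dom C f) (reindex E f u) =
      reindex Q (Fa f) (fibmap (ex_ext P Q m) (Cod C f) u)"
    if "f \<in> Arr C" and u: "u \<in> carrier (ex_fib P (Cod C f))" for f u
  proof -
    have f: "f \<in> homs C (Dom C f) (Cod C f)"
      using that by (simp add: homs_iff)
    show ?thesis
      using homs_obj[OF f] u frame_hom_closed[OF ex_reindex_frame_hom[OF f] u] ext_natural[OF f u]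
      by (simp add: ex_ext_def)
  qed
  ultimately have "ex_ext P Q m \<in> doc_mors E Q"
    using m unfolding doc_mors_def by (auto simp: ex_ext_def)
  moreover have "fibmap (ex_ext P Q m) c (Sig E \<pi> u) = Sig Q (Fa \<pi>) (fibmap (ex_ext P Q m) p u)"
    if "is_product C d c p \<pi>' \<pi>" and u: "u \<in> carrier (ex_fib P p)" for d c p \<pi>' \<pi> u
  proof -
    have \<pi>: "\<pi> \<in> projs C c" and p: "Dom C \<pi> = p"
      using that by (auto simp: projs_def is_product_def homs_iff)
    have o: "c \<in> Obj C" "p \<in> Obj C"
      using homs_obj[OF projs_homs[OF \<pi>]] p by auto
    have "Sig E \<pi> u \<in> carrier (ex_fib P c)"
      using ex_doctrine_Sig(1)[OF ex_completion_ex_doctrine, of d c p \<pi>' \<pi> u] that by simp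
    then show ?thesis
      using ext_Sig[OF \<pi>, unfolded p, OF u] o u by (simp add: ex_ext_def)
  qed
  ultimately show ?thesis
    by (auto simp: ex_doc_mors_def) (simp add: ex_ext_def)
qed

lemma ex_ext_unit: "doc_comp1 P (ex_ext P Q m) (ex_unit P) = m"
proof (rule doc_mor_eqI[OF doc_comp1_mor[OF P ex_unit_mor ex_doc_mors_doc_mors[OF ex_ext_mor]] m])
  show "fibmap (doc_comp1 P (ex_ext P Q m) (ex_unit P)) c x = fibmap m c x"
    if "c \<in> Obj C" "x \<in> carrier (fib P c)" for c x
    using that ex_principal[OF that] ext_principal[OF that]
    by (simp add: doc_comp1_simps ex_unit_def ex_ext_def)
qed (simp_all add: doc_comp1_simps ex_unit_def ex_ext_def)

text \<open>By the adjunction \<open>ext_le\<close>, the inequality between the extensions becomes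
  an inclusion of the sieve of \<open>u\<close> in a sieve \<open>R c T\<close>. This is checked on
  arbitrary pairs, where only the inequality of \<open>t\<close> for elements of \<open>P\<close> is
  needed.\<close>

lemma ex_ext_2cell:
  assumes n: "n \<in> doc_mors P Q" and t: "is_doc_2cell P Q t" and st: "source1 t = m" "target1 t = n"
  shows "is_doc_2cell E Q \<lparr>source1 = ex_ext P Q m, target1 = ex_ext P Q n, nat_tr = nat_tr t\<rparr>"
proof -
  interpret N: ex_extension P Q n
    by unfold_locales (use Q n in auto)
  note T = doc_2cellD[OF t, unfolded st]
  show ?thesis
  proof (rule doc_2cellI; (unfold ex_completion_simps doc_2cell.simps)?)
    fix c u assume c: "c \<in> Obj C" and u: "u \<in> carrier (ex_fib P c)"
    note U = ex_presieve[OF carrierE(1)[OF u c]]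
    let ?e = "ex_ext_fib P Q n c u"
    have e: "?e \<in> carrier (fib Q (N.F c))"
      using N.ext_closed[OF c u] .
    note te = frame_hom_closed[OF QD(4)[OF T(1)[OF c]] e]
    have "dec P c u \<subseteq> R c (reindex Q (nat_tr t c) ?e)"
    proof (rule subrelI)
      fix g y assume gy: "(g, y) \<in> dec P c u"
      note g = dec_elem[OF c u gy]
      let ?a = "Dom C g"
      note ta = T(1)[OF g(3)] and tc = T(1)[OF c]
      have 1: "\<alpha> ?a y \<sqsubseteq>\<^bsub>fib Q (F ?a)\<^esub> reindex Q (nat_tr t ?a) (N.\<alpha> ?a y)"
        using T(3)[OF g(3,2)] .
      have "N.\<alpha> ?a y \<sqsubseteq>\<^bsub>fib Q (N.F ?a)\<^esub> reindex Q (N.Fa g) ?e"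
        using N.ext_unit[OF c u] gy N.R_iff[OF g(1)] by blast
      then have 2: "reindex Q (nat_tr t ?a) (N.\<alpha> ?a y) \<sqsubseteq>\<^bsub>fib Q (F ?a)\<^esub>
          reindex Q (nat_tr t ?a) (reindex Q (N.Fa g) ?e)"
        by (rule frame_hom_mono[OF QD(4)[OF ta] N.\<alpha>_closed[OF g(3,2)] N.Q_reindex_closed[OF g(1) e]])
      \<comment> \<open>Naturality of the 2-cell at \<open>g\<close>, read through functoriality of
        reindexing.\<close>
      have "reindex Q (nat_tr t ?a) (reindex Q (N.Fa g) ?e) = reindex Q (Fa g) (reindex Q (nat_tr t c) ?e)"
        using QD(6)[OF N.FD(4)[OF g(1)] ta e] QD(6)[OF tc FD(4)[OF g(1)] e] T(2)[OF g(1)] by simp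
      then have "\<alpha> ?a y \<sqsubseteq>\<^bsub>fib Q (F ?a)\<^esub> reindex Q (Fa g) (reindex Q (nat_tr t c) ?e)"
        using frame_trans[OF Q_frame[OF g(3)] 1 2 \<alpha>_closed[OF g(3,2)]
            frame_hom_closed[OF QD(4)[OF ta] N.\<alpha>_closed[OF g(3,2)]]
            frame_hom_closed[OF QD(4)[OF ta] N.Q_reindex_closed[OF g(1) e]]] by simp
      then show "(g, y) \<in> R c (reindex Q (nat_tr t c) ?e)"
        using g(2) by (simp add: R_iff[OF g(1)])
    qed
    then show "fibmap (ex_ext P Q m) c u \<sqsubseteq>\<^bsub>fib Q (fobj (ftr (ex_ext P Q m)) c)\<^esub>
        reindex Q (nat_tr t c) (fibmap (ex_ext P Q n) c u)"
      using ext_le[OF c u te] c u by (simp add: ex_ext_def)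
  qed (use T ex_doc_mors_doc_mors[OF ex_ext_mor] ex_doc_mors_doc_mors[OF N.ex_ext_mor] in
      \<open>auto simp: ex_ext_def\<close>)
qed

end

section \<open>Uniqueness of extensions and the isomorphism of hom-categories\<close>

context encoded_doctrine
begin

text \<open>The unit is the identity on the base, so the functors agree at once. On fibres, both
  morphisms preserve joins and existentials, which generate every element from the image of the unit
  by \<open>ex_sup_basic\<close>.\<close>

lemma ex_ext_unique:
  assumes n: "n \<in> ex_doc_mors E Q" and n': "n' \<in> ex_doc_mors E Q"
    and e: "doc_comp1 P n (ex_unit P) = doc_comp1 P n' (ex_unit P)"
  shows "n = n'"
proof -
  note N = ex_doc_mors_doc_mors[OF n] and N' = ex_doc_mors_doc_mors[OF n']
  have obj: "fobj (ftr n) c = fobj (ftr n') c" if "c \<in> Obj C" for c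
    using doc_comp1_simps(1)[OF that, of n "ex_unit P"] doc_comp1_simps(1)[OF that, of n' "ex_unit P"] e that
    by (simp add: ex_unit_def)
  have arr: "farr (ftr n) f = farr (ftr n') f" if "f \<in> Arr C" for f
    using doc_comp1_simps(2)[OF that, of n "ex_unit P"] doc_comp1_simps(2)[OF that, of n' "ex_unit P"] e that
    by (simp add: ex_unit_def)
  have unit: "fibmap n c (fibmap (ex_unit P) c x) = fibmap n' c (fibmap (ex_unit P) c x)"
    if "c \<in> Obj C" "x \<in> carrier (fib P c)" for c x
    using doc_comp1_simps(3)[OF that, of n "ex_unit P"] doc_comp1_simps(3)[OF that, of n' "ex_unit P"] e that
    by (simp add: ex_unit_def)
  show ?thesis
  proof (rule doc_mor_eqI[OF N N'])
    fix c u assume "c \<in> Obj (base E)" "u \<in> carrier (fib E c)"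
    then have c: "c \<in> Obj C" and u: "u \<in> carrier (ex_fib P c)"
      by auto
    let ?G = "{Sig E \<pi> (fibmap (ex_unit P) (Dom C \<pi>) x) | \<pi> x. \<pi> \<in> projs C c \<and> (\<pi>, x) \<in> dec P c u}"
    have gen: "g \<in> carrier (ex_fib P c) \<and> fibmap n c g = fibmap n' c g" if gG: "g \<in> ?G" for g
    proof -
      obtain \<pi> x where g: "g = Sig E \<pi> (fibmap (ex_unit P) (Dom C \<pi>) x)" and \<pi>: "\<pi> \<in> projs C c"
        and x: "(\<pi>, x) \<in> dec P c u"
        using gG by blast
      have x': "x \<in> carrier (fib P (Dom C \<pi>))"
        using presieve_elem(2)[OF ex_presieve[OF carrierE(1)[OF u c]] x] .
      note \<pi>h = projs_homs[OF \<pi>]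
      have p: "Dom C \<pi> \<in> Obj C" and \<pi>a: "\<pi> \<in> Arr C"
        using homs_obj[OF \<pi>h] \<pi>h by (auto simp: homs_iff)
      have y: "fibmap (ex_unit P) (Dom C \<pi>) x \<in> carrier (fib E (Dom C \<pi>))"
        using doc_mors_fibmap_closed[OF ex_unit_mor p x'] p by (simp add: ex_unit_def)
      obtain d q \<pi>' where "is_product C d c q \<pi>' \<pi>"
        using \<pi> by (auto simp: projs_def)
      moreover from this have "q = Dom C \<pi>"
        using is_productD(2) by (fastforce simp: homs_iff)
      ultimately have pr: "is_product (base E) d c (Dom C \<pi>) \<pi>' \<pi>"
        by simp
      have "fibmap n c g = Sig Q (farr (ftr n) \<pi>) (fibmap n (Dom C \<pi>) (fibmap (ex_unit P) (Dom C \<pi>) x))"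
        using n pr y unfolding ex_doc_mors_def g by blast
      moreover have "fibmap n' c g = Sig Q (farr (ftr n') \<pi>) (fibmap n' (Dom C \<pi>) (fibmap (ex_unit P) (Dom C \<pi>) x))"
        using n' pr y unfolding ex_doc_mors_def g by blast
      ultimately show ?thesis
        using ex_doctrine_Sig(1)[OF ex_completion_ex_doctrine pr y] unit[OF p x'] arr[OF \<pi>a] by (simp add: g)
    qed
    then have G: "?G \<subseteq> carrier (ex_fib P c)"
      by blast
    have cE: "c \<in> Obj (base E)"
      using c by simp
    have "fibmap n c u = \<Squnion>\<^bsub>fib Q (fobj (ftr n) c)\<^esub> (fibmap n c ` ?G)"
      using frame_hom_sup[OF doc_morsD(3)[OF N cE], of ?G] G ex_sup_basic[OF c u] by simp
    also have "fibmap n c ` ?G = fibmap n' c ` ?G"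
      by (rule image_cong[OF refl]) (use gen in blast)
    also have "\<Squnion>\<^bsub>fib Q (fobj (ftr n) c)\<^esub> (fibmap n' c ` ?G) = fibmap n' c u"
      using frame_hom_sup[OF doc_morsD(3)[OF N' cE], of ?G] G ex_sup_basic[OF c u] obj[OF c] by simp
    finally show "fibmap n c u = fibmap n' c u" .
  qed (use obj arr in simp_all)
qed

lemma ex_unit_bij1:
  assumes Q: "is_ex_doctrine Q"
  shows "bij_betw (\<lambda>n. doc_comp1 P n (ex_unit P)) (ex_doc_mors E Q) (doc_mors P Q)"
proof (rule bij_betw_byWitness[where f' = "ex_ext P Q"])
  have ext: "ex_extension P Q m" if "m \<in> doc_mors P Q" for m
    by unfold_locales (use Q that in auto)
  show into: "(\<lambda>n. doc_comp1 P n (ex_unit P)) ` ex_doc_mors E Q \<subseteq> doc_mors P Q"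
    using doc_comp1_mor[OF P ex_unit_mor] ex_doc_mors_doc_mors by blast
  show "ex_ext P Q ` doc_mors P Q \<subseteq> ex_doc_mors E Q"
    using ex_extension.ex_ext_mor[OF ext] by blast
  show r: "\<forall>m \<in> doc_mors P Q. doc_comp1 P (ex_ext P Q m) (ex_unit P) = m"
    using ex_extension.ex_ext_unit[OF ext] by blast
  show "\<forall>n \<in> ex_doc_mors E Q. ex_ext P Q (doc_comp1 P n (ex_unit P)) = n"
  proof
    fix n assume n: "n \<in> ex_doc_mors E Q"
    then have m: "doc_comp1 P n (ex_unit P) \<in> doc_mors P Q"
      using into by blast
    show "ex_ext P Q (doc_comp1 P n (ex_unit P)) = n"
      using ex_ext_unique[OF ex_extension.ex_ext_mor[OF ext[OF m]] n] r m by blast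
  qed
qed

text \<open>Whiskering with the unit keeps the components of a 2-cell, so injectivity concerns only
  sources and targets and follows from \<open>ex_unit_bij1\<close>. Surjectivity is
  \<open>ex_ext_2cell\<close>.\<close>

lemma ex_unit_bij2:
  assumes Q: "is_ex_doctrine Q"
  shows "bij_betw (\<lambda>t. doc_comp2 P Q t (Ident (doc_hom P E M) (ex_unit P)))
    (Arr (doc_hom E Q (ex_doc_mors E Q))) (Arr (doc_hom P Q (doc_mors P Q)))"
proof -
  note QD = ex_doctrine_is_doctrine[OF Q]
  note bij = ex_unit_bij1[OF Q]
  let ?w = "\<lambda>t. doc_comp2 P Q t (Ident (doc_hom P E M) (ex_unit P))"
  have src: "source1 (?w t) = doc_comp1 P (source1 t) (ex_unit P)"
    "target1 (?w t) = doc_comp1 P (target1 t) (ex_unit P)" for t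
    by (simp_all add: doc_comp2_simps doc_hom_ident)
  have nat: "nat_tr (?w t) c = nat_tr t c"
    if t: "is_doc_2cell E Q t" "source1 t \<in> doc_mors E Q" and c: "c \<in> Obj C" for t c
  proof -
    have cE: "c \<in> Obj (base E)"
      using c by simp
    show ?thesis
      using is_functorD(5)[OF doc_morsD(1)[OF t(2)] cE] doc_2cellD(1)[OF t(1) cE]
        category_cmp_ident(1)[OF doctrineD(1)[OF QD]] c
      by (simp add: doc_comp2_simps doc_hom_ident) (simp add: ex_unit_def)
  qed
  have into: "is_doc_2cell P Q (?w t)"
    if "is_doc_2cell E Q t" "source1 t \<in> doc_mors E Q" "target1 t \<in> doc_mors E Q" for t
    using that ex_unit_mor
    by (intro doc_comp2_2cell[OF P ex_completion_doctrine QD]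
        doc_ident_2cell[OF ex_completion_doctrine ex_unit_mor]) (auto simp: doc_hom_ident)
  show ?thesis
    unfolding bij_betw_def
  proof
    show "inj_on ?w (Arr (doc_hom E Q (ex_doc_mors E Q)))"
    proof (rule inj_onI)
      fix s t assume "s \<in> Arr (doc_hom E Q (ex_doc_mors E Q))" "t \<in> Arr (doc_hom E Q (ex_doc_mors E Q))"
        and e: "?w s = ?w t"
      then have s: "is_doc_2cell E Q s" "source1 s \<in> ex_doc_mors E Q" "target1 s \<in> ex_doc_mors E Q"
        and t: "is_doc_2cell E Q t" "source1 t \<in> ex_doc_mors E Q" "target1 t \<in> ex_doc_mors E Q"
        by auto
      show "s = t"
      proof (rule doc_2cell_eqI[OF s(1) t(1)])
        show "source1 s = source1 t" "target1 s = target1 t"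
          using bij_betw_imp_inj_on[OF bij] s t src[of s] src[of t] e by (auto simp: inj_on_def)
        show "nat_tr s c = nat_tr t c" if "c \<in> Obj (base E)" for c
          using that nat[OF s(1) ex_doc_mors_doc_mors[OF s(2)], of c]
            nat[OF t(1) ex_doc_mors_doc_mors[OF t(2)], of c] e by simp
      qed
    qed
    show "?w ` Arr (doc_hom E Q (ex_doc_mors E Q)) = Arr (doc_hom P Q (doc_mors P Q))"
    proof
      show "?w ` Arr (doc_hom E Q (ex_doc_mors E Q)) \<subseteq> Arr (doc_hom P Q (doc_mors P Q))"
      proof (rule image_subsetI)
        fix t assume "t \<in> Arr (doc_hom E Q (ex_doc_mors E Q))"
        then have t: "is_doc_2cell E Q t" "source1 t \<in> doc_mors E Q" "target1 t \<in> doc_mors E Q"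
          using ex_doc_mors_doc_mors by auto
        show "?w t \<in> Arr (doc_hom P Q (doc_mors P Q))"
          using into[OF t] doc_comp1_mor[OF P ex_unit_mor] t by (simp add: src)
      qed
      show "Arr (doc_hom P Q (doc_mors P Q)) \<subseteq> ?w ` Arr (doc_hom E Q (ex_doc_mors E Q))"
      proof
        fix t assume "t \<in> Arr (doc_hom P Q (doc_mors P Q))"
        then have t: "is_doc_2cell P Q t" "source1 t \<in> doc_mors P Q" "target1 t \<in> doc_mors P Q"
          by auto
        let ?t = "\<lparr>source1 = ex_ext P Q (source1 t), target1 = ex_ext P Q (target1 t), nat_tr = nat_tr t\<rparr>"
        interpret m: ex_extension P Q "source1 t"
          by unfold_locales (use Q t in auto)
        interpret n: ex_extension P Q "target1 t"
          by unfold_locales (use Q t in auto)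
        have t': "is_doc_2cell E Q ?t"
          by (rule m.ex_ext_2cell[OF t(3,1) refl refl])
        note m' = ex_doc_mors_doc_mors[OF m.ex_ext_mor] and n' = ex_doc_mors_doc_mors[OF n.ex_ext_mor]
        have "?w ?t = t"
        proof (rule doc_2cell_eqI[OF into[OF t'] t(1)])
          show "nat_tr (?w ?t) c = nat_tr t c" if "c \<in> Obj C" for c
            using nat[OF t' _ that] m' by simp
        qed (use m' n' m.ex_ext_unit n.ex_ext_unit in \<open>simp_all add: src\<close>)
        moreover have "?t \<in> Arr (doc_hom E Q (ex_doc_mors E Q))"
          using t' m.ex_ext_mor n.ex_ext_mor by simp
        ultimately show "t \<in> ?w ` Arr (doc_hom E Q (ex_doc_mors E Q))"
          by (metis image_eqI)
      qed
    qed
  qed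
qed

end

theorem theorem2p7:
  fixes S :: "'s set set"
  assumes "\<And>A B. A \<in> S \<Longrightarrow> B \<in> S \<Longrightarrow> \<exists>C \<in> S. A \<times> B \<lesssim> C"
    and "\<And>A. A \<in> S \<Longrightarrow> Pow A \<lesssim> (UNIV :: 'p set)"
  shows "has_left_two_adjoint
           (ExDoc S :: (('o, 'm, 'p) doctrine, ('o, 'm, 'p) doc_mor, ('o, 'm, 'p) doc_2cell) two_category)
           (Doc S :: (('o, 'm, 'p) doctrine, ('o, 'm, 'p) doc_mor, ('o, 'm, 'p) doc_2cell) two_category)
           forget"
proof -
  let ?Y = "ExDoc S :: (('o, 'm, 'p) doctrine, ('o, 'm, 'p) doc_mor, ('o, 'm, 'p) doc_2cell) two_category"
  let ?X = "Doc S :: (('o, 'm, 'p) doctrine, ('o, 'm, 'p) doc_mor, ('o, 'm, 'p) doc_2cell) two_category"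
  have enc: "encoded_doctrine P" "is_small S (ex_completion P)"
    if "P \<in> Cell0 ?X" for P
    using small_doctrine_encoded[OF _ _ assms, of P] small_ex_completion[OF _ _ assms, of P] that
    by (auto simp: Doc_def)
  \<comment> \<open>\<open>forget\<close> is the identity on cells, so the two bijectivity
    conditions unfold to \<open>ex_unit_bij1\<close> and \<open>ex_unit_bij2\<close>.\<close>
  interpret universal_arrows ?X ?Y forget ex_completion ex_unit
  proof unfold_locales
    show "is_two_category ?X"
      by (rule Doc_two_category)
    show "is_two_category ?Y"
      by (rule ExDoc_two_category)
    show "is_two_functor ?Y ?X forget"
      by (rule forget_two_functor)
    show "ex_completion P \<in> Cell0 ?Y" if "P \<in> Cell0 ?X" for P
      using enc[OF that] encoded_doctrine.ex_completion_ex_doctrine[OF enc(1)[OF that]]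
      by (simp add: ExDoc_def)
    show "ex_unit P \<in> Cell1 ?X P (fun0 forget (ex_completion P))" if "P \<in> Cell0 ?X" for P
      using encoded_doctrine.ex_unit_mor[OF enc(1)[OF that]] by (simp add: Doc_def forget_def)
    fix P Q assume P: "P \<in> Cell0 ?X" and "Q \<in> Cell0 ?Y"
    then have Q: "is_ex_doctrine Q"
      by (simp add: ExDoc_def)
    show "bij_betw (\<lambda>g. cmp1 ?X P (fun0 forget (ex_completion P)) (fun0 forget Q)
          (fobj (fun12 forget (ex_completion P) Q) g) (ex_unit P))
        (Cell1 ?Y (ex_completion P) Q) (Cell1 ?X P (fun0 forget Q))"
      using encoded_doctrine.ex_unit_bij1[OF enc(1)[OF P] Q] by (simp add: Doc_def ExDoc_def forget_def)
    show "bij_betw (\<lambda>t. cmp2 ?X P (fun0 forget (ex_completion P)) (fun0 forget Q)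
          (farr (fun12 forget (ex_completion P) Q) t)
          (Id2 ?X P (fun0 forget (ex_completion P)) (ex_unit P)))
        (Cell2 ?Y (ex_completion P) Q) (Cell2 ?X P (fun0 forget Q))"
      using encoded_doctrine.ex_unit_bij2[OF enc(1)[OF P] Q] by (simp add: Doc_def ExDoc_def forget_def)
  qed
  show ?thesis
    unfolding has_left_two_adjoint_def using two_adjunction by blast
qed

end
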